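(* Let $\beta,\gamma\in\mathbb R$, let $\mathcal W,\varepsilon_0,C_\delta$ be as in the context, let $0<\varepsilon\le\varepsilon_0$, let $u$ be the global small-data solution with $\|u(1)\|_\Sigma\le\varepsilon$, and let $A$ be its modified scattering profile. Set $$\zeta_0=-\frac\gamma2,\quad A_0=A(-\gamma),\quad \alpha=\beta|A_0|^2,\quad M_0=\int_{\mathbb R}\mathcal W(x)\,dx,\quad \delta=C_\delta|\beta|\varepsilon^2,\quad a_*=\tfrac14-2\delta>0,$$ $$\mathfrak F_\alpha(\eta)=\int_1^\infty\tau^{-5/2-i\alpha}e^{i\eta^2\tau}\,d\tau .$$ Then for every $R_{\mathrm{in}}>0$ and every $0\le\kappa<1/2$ there is $C_{R_{\mathrm{in}},\kappa}<\infty$, independent of $T$ (it may depend on the fixed solution, $\beta$ and $\mathcal W$), such that for $T\ge2$ $$\sup_{|\eta|\le R_{\mathrm{in}}T^\kappa}\left|T^{3/2}e^{i\alpha\log T}\big[\mathcal P_{u,+}-\mathcal P_u(T)\big]\Big(\zeta_0+\frac{\eta}{\sqrt T}\Big)-iM_0|A_0|^4A_0\,\mathfrak F_\alpha(\eta)\right|\le C_{R_{\mathrm{in}},\kappa}\big(T^{-a_*}+T^{-1/2+\kappa}\big).$$ In particular, for $\kappa=0$ the convergence is uniform on every fixed compact $\eta$-interval at rate $O(T^{-a_*})$. Furthermore, at the edge $|\eta|\asymp T^\kappa$ the limiting profile has its natural size $T^{-2\kappa}$ (since $\mathfrak F_\alpha(\eta)=ie^{i\eta^2}/\eta^2+O_\alpha(|\eta|^{-4})$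 as $|\eta|\to\infty$), and the error bound above is of smaller order than $T^{-2\kappa}$ only when $2\kappa<\min\{a_*,1/2-\kappa\}$, equivalently $\kappa<\frac18-\delta$.
   Context: Notation: $\langle x\rangle=(1+x^2)^{1/2}$; $\|\cdot\|_q$ is the $L^q(\mathbb R)$ norm; $C_0(\mathbb R)$ is the space of continuous functions vanishing at infinity; $\Sigma=\{f\in H^1(\mathbb R):xf\in L^2(\mathbb R)\}$ with $\|f\|_\Sigma=\|f\|_{H^1}+\|xf\|_2$; Fourier transform $\widehat f(\zeta)=\int_{\mathbb R}e^{-i\zeta y}f(y)\,dy$. Assumption on $\mathcal W$: $\mathcal W:\mathbb R\to\mathbb R$ is smooth and there exist $p>2$ and constants $C_{\mathcal W,j}>0$ such that $|\partial_x^j\mathcal W(x)|\le C_{\mathcal W,j}\langle x\rangle^{-p-j}$ for all $x\in\mathbb R$ and all integers $j\ge0$. Equation: $i\partial_tu+\partial_y^2u-\beta|u|^2u+\mathcal W(y+\gamma t)|u|^4u=0$, $t\ge1$, $y\in\mathbb R$ (mild solutions). Small-data solution and profile: $\varepsilon_0=\varepsilon_0(\beta,\mathcal W)>0$ is a sufficiently small threshold, independent of $\gamma$, and $C_\delta,C>0$ are constants such that whenever $\|u_1\|_\Sigma\le\varepsilon\le\varepsilon_0$ there is a unique global solution $u\in C([1,\infty);\Sigma)\cap C^1([1,\infty);H^{-1})$ with $u(1)=u_1$; with $\delta=C_\delta|\beta|\varepsilon^2<1/16$ it satisfies $\|u(t)\|_\infty\le C\varepsilon t^{-1/2}$, $\|u(t)\|_{H^1}+\|(y+2it\partial_y)u(t)\|_2\le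 C\varepsilon t^\delta$ for $t\ge1$, and there is a unique $A\in L^2\cap L^\infty$ (the modified scattering profile) with $\|A\|_2+\|A\|_\infty\le C\varepsilon$ and $$\Big\|u(t,y)-t^{-1/2}e^{iy^2/(4t)}A(y/t)e^{-i\beta|A(y/t)|^2\log t}\Big\|_{L^q_y}\le C\varepsilon t^{-b_q+2\delta},\quad t\ge1,\ q\in\{2,\infty\},\quad b_2=\tfrac12,\ b_\infty=\tfrac34 .$$ Moreover $A\in H^\varsigma(\mathbb R)$ for every $\varsigma<1-2\delta$; $A$ denotes its continuous representative, so $A(-\gamma)$ makes sense. Cubic-renormalized profile: $$\mathcal P_u(t,\zeta)=e^{it\zeta^2}\widehat u(t,\zeta)+i\beta\int_1^te^{is\zeta^2}\,\widehat{|u(s)|^2u(s)}(\zeta)\,ds,\qquad t\ge1;$$ as $t\to\infty$, $\mathcal P_u(t)$ converges in $L^2_\zeta$ and uniformly to a limit $\mathcal P_{u,+}\in L^2(\mathbb R)\cap C_0(\mathbb R)$. *)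

theory Defs
  imports "HOL-Probability.Probability" "HOL-Library.Landau_Symbols"
begin

text \<open>
  Elements of $L^2(\mathbb R)$, $L^\infty(\mathbb R)$, $H^s(\mathbb R)$ and $\Sigma$ are represented
  by Borel functions; statements about them are invariant under changes on null sets.
\<close>

definition jap :: "real \<Rightarrow> real" where
  "jap x = sqrt (1 + x\<^sup>2)"

definition L2 :: "(real \<Rightarrow> complex) \<Rightarrow> bool" where
  "L2 f \<longleftrightarrow> f \<in> borel_measurable lborel \<and> integrable lborel (\<lambda>x. (cmod (f x))\<^sup>2)"

definition L2_norm :: "(real \<Rightarrow> complex) \<Rightarrow> real" where
  "L2_norm f = sqrt (LINT x|lborel. (cmod (f x))\<^sup>2)"

definition Linf :: "(real \<Rightarrow> complex) \<Rightarrow> bool" where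
  "Linf f \<longleftrightarrow> f \<in> borel_measurable lborel \<and> esssup lborel (\<lambda>x. ereal (cmod (f x))) < \<infinity>"

definition Linf_norm :: "(real \<Rightarrow> complex) \<Rightarrow> real" where
  "Linf_norm f = real_of_ereal (esssup lborel (\<lambda>x. ereal (cmod (f x))))"

text \<open>Convergence in $L^2$.  Membership of the difference is demanded because the Bochner integral
  of a non-integrable function is $0$.\<close>

definition L2_tendsto :: "('i \<Rightarrow> real \<Rightarrow> complex) \<Rightarrow> (real \<Rightarrow> complex) \<Rightarrow> 'i filter \<Rightarrow> bool" where
  "L2_tendsto F g \<Phi> \<longleftrightarrow> (\<forall>\<^sub>F i in \<Phi>. L2 (\<lambda>x. F i x - g x)) \<and>
     ((\<lambda>i. L2_norm (\<lambda>x. F i x - g x)) \<longlongrightarrow> 0) \<Phi>"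

definition C0 :: "(real \<Rightarrow> complex) \<Rightarrow> bool" where
  "C0 f \<longleftrightarrow> continuous_on UNIV f \<and> (f \<longlongrightarrow> 0) at_infinity"

text \<open>The Fourier transform of an integrable function, with the inverse transform normalised
  accordingly.\<close>

definition fourier :: "(real \<Rightarrow> complex) \<Rightarrow> real \<Rightarrow> complex" where
  "fourier f \<zeta> = (LINT y|lborel. iexp (- (\<zeta> * y)) * f y)"

definition inv_fourier :: "(real \<Rightarrow> complex) \<Rightarrow> real \<Rightarrow> complex" where
  "inv_fourier g y = (LINT \<zeta>|lborel. iexp (\<zeta> * y) * g \<zeta>) / of_real (2 * pi)"

text \<open>Its extension to $L^2$: \<open>g\<close> is the $L^2$-limit of the transforms of the truncations of \<open>f\<close>.
  By Plancherel's theorem such a \<open>g\<close> exists for each \<open>f\<close> in $L^2$, and is unique up to null sets.\<close>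

definition has_L2_fourier :: "(real \<Rightarrow> complex) \<Rightarrow> (real \<Rightarrow> complex) \<Rightarrow> bool" where
  "has_L2_fourier f g \<longleftrightarrow> L2 f \<and> L2 g \<and>
     L2_tendsto (\<lambda>n::nat. fourier (\<lambda>y. indicator {- real n..real n} y * f y)) g sequentially"

definition L2_fourier :: "(real \<Rightarrow> complex) \<Rightarrow> real \<Rightarrow> complex" where
  "L2_fourier f = (SOME g. has_L2_fourier f g)"

text \<open>\<open>Hs s f\<close> means $f \in L^2 \cap H^s$, which is $f \in H^s$ when $s \ge 0$.
  With the factor $(2\pi)^{-1/2}$ the norm of $H^1$ is
  $(\|f\|_2^2 + \|\partial_y f\|_2^2)^{1/2}$.\<close>

definition Hs :: "real \<Rightarrow> (real \<Rightarrow> complex) \<Rightarrow> bool" where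
  "Hs s f \<longleftrightarrow> (\<exists>g. has_L2_fourier f g \<and> L2 (\<lambda>\<zeta>. of_real (jap \<zeta> powr s) * g \<zeta>))"

definition Hs_norm :: "real \<Rightarrow> (real \<Rightarrow> complex) \<Rightarrow> real" where
  "Hs_norm s f = L2_norm (\<lambda>\<zeta>. of_real (jap \<zeta> powr s) * L2_fourier f \<zeta>) / sqrt (2 * pi)"

definition Sigma_space :: "(real \<Rightarrow> complex) \<Rightarrow> bool" where
  "Sigma_space f \<longleftrightarrow> Hs 1 f \<and> L2 (\<lambda>x. of_real x * f x)"

definition Sigma_norm :: "(real \<Rightarrow> complex) \<Rightarrow> real" where
  "Sigma_norm f = Hs_norm 1 f + L2_norm (\<lambda>x. of_real x * f x)"

definition smooth :: "(real \<Rightarrow> real) \<Rightarrow> bool" where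
  "smooth f \<longleftrightarrow> (\<forall>j x. (deriv ^^ j) f differentiable at x)"

definition test_function :: "(real \<Rightarrow> real) \<Rightarrow> bool" where
  "test_function \<phi> \<longleftrightarrow> smooth \<phi> \<and> (\<exists>r. \<forall>x. \<bar>x\<bar> > r \<longrightarrow> \<phi> x = 0)"

definition weak_deriv :: "(real \<Rightarrow> complex) \<Rightarrow> real \<Rightarrow> complex" where
  "weak_deriv f = (SOME g. L2 g \<and> (\<forall>\<phi>. test_function \<phi> \<longrightarrow>
     (LINT y|lborel. f y * of_real (deriv \<phi> y)) = - (LINT y|lborel. g y * of_real (\<phi> y))))"

definition potential :: "(real \<Rightarrow> real) \<Rightarrow> bool" where
  "potential W \<longleftrightarrow> smooth W \<and>
     (\<exists>p>2. \<exists>C. \<forall>j. C j > 0 \<and> (\<forall>x. \<bar>(deriv ^^ j) W x\<bar> \<le> C j * jap x powr (- p - real j)))"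

text \<open>The free propagator $e^{it\partial_y^2}$.  It is only applied to elements of $\Sigma$; these
  are integrable and so are their Fourier transforms.\<close>

definition propagator :: "real \<Rightarrow> (real \<Rightarrow> complex) \<Rightarrow> real \<Rightarrow> complex" where
  "propagator t f = inv_fourier (\<lambda>\<zeta>. iexp (- (t * \<zeta>\<^sup>2)) * fourier f \<zeta>)"

definition cubic :: "(real \<Rightarrow> complex) \<Rightarrow> real \<Rightarrow> complex" where
  "cubic f y = of_real ((cmod (f y))\<^sup>2) * f y"

definition nonlinearity ::
  "real \<Rightarrow> real \<Rightarrow> (real \<Rightarrow> real) \<Rightarrow> real \<Rightarrow> (real \<Rightarrow> complex) \<Rightarrow> real \<Rightarrow> complex" where
  "nonlinearity \<beta> \<gamma> W t f y =
     - of_real \<beta> * cubic f y + of_real (W (y + \<gamma> * t) * (cmod (f y)) ^ 4) * f y"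

definition mild_solution ::
  "real \<Rightarrow> real \<Rightarrow> (real \<Rightarrow> real) \<Rightarrow> (real \<Rightarrow> real \<Rightarrow> complex) \<Rightarrow> bool" where
  "mild_solution \<beta> \<gamma> W u \<longleftrightarrow> (\<forall>t\<ge>1. AE y in lborel.
     u t y = propagator (t - 1) (u 1) y +
       \<i> * (LINT s:{1..t}|lborel. propagator (t - s) (nonlinearity \<beta> \<gamma> W s (u s)) y))"

definition continuous_in_Sigma :: "(real \<Rightarrow> real \<Rightarrow> complex) \<Rightarrow> bool" where
  "continuous_in_Sigma u \<longleftrightarrow> (\<forall>t\<ge>1. Sigma_space (u t)) \<and>
     (\<forall>t\<ge>1. ((\<lambda>s. Sigma_norm (\<lambda>y. u s y - u t y)) \<longlongrightarrow> 0) (at t within {1..}))"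

text \<open>$u \in C^1([1,\infty);H^{-1})$ for a curve of elements of $\Sigma$.  Elements of $H^{-1}$ are
  represented by their Fourier transforms \<open>v\<close>, the functions with
  $\langle\zeta\rangle^{-1} v \in L^2$; below \<open>v t\<close> is the transform of $\partial_t u(t)$.\<close>

definition C1_in_H_minus_1 :: "(real \<Rightarrow> real \<Rightarrow> complex) \<Rightarrow> bool" where
  "C1_in_H_minus_1 u \<longleftrightarrow> (\<exists>v :: real \<Rightarrow> real \<Rightarrow> complex. \<forall>t\<ge>1.
     L2 (\<lambda>\<zeta>. v t \<zeta> / of_real (jap \<zeta>)) \<and>
     L2_tendsto (\<lambda>s \<zeta>. (fourier (u s) \<zeta> - fourier (u t) \<zeta>) / of_real (s - t) / of_real (jap \<zeta>))
       (\<lambda>\<zeta>. v t \<zeta> / of_real (jap \<zeta>)) (at t within {1..}) \<and>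
     L2_tendsto (\<lambda>s \<zeta>. v s \<zeta> / of_real (jap \<zeta>)) (\<lambda>\<zeta>. v t \<zeta> / of_real (jap \<zeta>)) (at t within {1..}))"

definition global_solution ::
  "real \<Rightarrow> real \<Rightarrow> (real \<Rightarrow> real) \<Rightarrow> (real \<Rightarrow> real \<Rightarrow> complex) \<Rightarrow> bool" where
  "global_solution \<beta> \<gamma> W u \<longleftrightarrow>
     continuous_in_Sigma u \<and> C1_in_H_minus_1 u \<and> mild_solution \<beta> \<gamma> W u"

definition galilei :: "real \<Rightarrow> (real \<Rightarrow> complex) \<Rightarrow> real \<Rightarrow> complex" where
  "galilei t f y = of_real y * f y + 2 * \<i> * of_real t * weak_deriv f y"

definition small_data_bounds ::
  "real \<Rightarrow> real \<Rightarrow> real \<Rightarrow> (real \<Rightarrow> real \<Rightarrow> complex) \<Rightarrow> bool" where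
  "small_data_bounds C \<epsilon> \<delta> u \<longleftrightarrow> (\<forall>t\<ge>1.
     Linf (u t) \<and> Linf_norm (u t) \<le> C * \<epsilon> * t powr (- 1 / 2) \<and>
     Hs 1 (u t) \<and> L2 (galilei t (u t)) \<and>
     Hs_norm 1 (u t) + L2_norm (galilei t (u t)) \<le> C * \<epsilon> * t powr \<delta>)"

definition scattering_ansatz ::
  "real \<Rightarrow> (real \<Rightarrow> complex) \<Rightarrow> real \<Rightarrow> real \<Rightarrow> complex" where
  "scattering_ansatz \<beta> A t y =
     of_real (t powr (- 1 / 2)) * iexp (y\<^sup>2 / (4 * t)) * A (y / t) *
       iexp (- (\<beta> * (cmod (A (y / t)))\<^sup>2 * ln t))"

definition scattering_profile ::
  "real \<Rightarrow> real \<Rightarrow> real \<Rightarrow> real \<Rightarrow> (real \<Rightarrow> real \<Rightarrow> complex) \<Rightarrow> (real \<Rightarrow> complex) \<Rightarrow> bool" where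
  "scattering_profile \<beta> C \<epsilon> \<delta> u A \<longleftrightarrow>
     L2 A \<and> Linf A \<and> L2_norm A + Linf_norm A \<le> C * \<epsilon> \<and>
     (\<forall>t\<ge>1. let r = (\<lambda>y. u t y - scattering_ansatz \<beta> A t y) in
        L2 r \<and> L2_norm r \<le> C * \<epsilon> * t powr (- 1 / 2 + 2 * \<delta>) \<and>
        Linf r \<and> Linf_norm r \<le> C * \<epsilon> * t powr (- 3 / 4 + 2 * \<delta>))"

text \<open>The threshold \<open>\<epsilon>0\<close> and the constants \<open>C\<delta>\<close>, \<open>C\<close> are admissible for \<open>\<beta>\<close> and \<open>W\<close> if the
  small-data theory holds with them, for all velocities \<open>\<gamma>\<close>.\<close>

definition small_data_theory ::
  "real \<Rightarrow> (real \<Rightarrow> real) \<Rightarrow> real \<Rightarrow> real \<Rightarrow> real \<Rightarrow> bool" where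
  "small_data_theory \<beta> W \<epsilon>0 C\<delta> C \<longleftrightarrow> \<epsilon>0 > 0 \<and> C\<delta> > 0 \<and> C > 0 \<and>
     (\<forall>\<gamma> \<epsilon> u1. 0 < \<epsilon> \<and> \<epsilon> \<le> \<epsilon>0 \<and> Sigma_space u1 \<and> Sigma_norm u1 \<le> \<epsilon> \<longrightarrow>
        (let \<delta> = C\<delta> * \<bar>\<beta>\<bar> * \<epsilon>\<^sup>2;
             sol = (\<lambda>u. global_solution \<beta> \<gamma> W u \<and> (AE y in lborel. u 1 y = u1 y))
         in \<delta> < 1 / 16 \<and>
            (\<exists>u. sol u) \<and>
            (\<forall>u v. sol u \<and> sol v \<longrightarrow> (\<forall>t\<ge>1. AE y in lborel. u t y = v t y)) \<and>
            (\<forall>u. sol u \<longrightarrow> small_data_bounds C \<epsilon> \<delta> u \<and>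
               (\<exists>A. scattering_profile \<beta> C \<epsilon> \<delta> u A \<and>
                  (\<forall>B. scattering_profile \<beta> C \<epsilon> \<delta> u B \<longrightarrow> (AE x in lborel. B x = A x)) \<and>
                  (\<forall>\<sigma><1 - 2 * \<delta>. Hs \<sigma> A)))))"

definition renormalized_profile ::
  "real \<Rightarrow> (real \<Rightarrow> real \<Rightarrow> complex) \<Rightarrow> real \<Rightarrow> real \<Rightarrow> complex" where
  "renormalized_profile \<beta> u t \<zeta> =
     iexp (t * \<zeta>\<^sup>2) * fourier (u t) \<zeta> +
       \<i> * of_real \<beta> * (LINT s:{1..t}|lborel. iexp (s * \<zeta>\<^sup>2) * fourier (cubic (u s)) \<zeta>)"

definition limit_profile ::
  "real \<Rightarrow> (real \<Rightarrow> real \<Rightarrow> complex) \<Rightarrow> (real \<Rightarrow> complex) \<Rightarrow> bool" where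
  "limit_profile \<beta> u P \<longleftrightarrow> L2 P \<and> C0 P \<and>
     L2_tendsto (renormalized_profile \<beta> u) P at_top \<and>
     uniform_limit UNIV (renormalized_profile \<beta> u) P at_top"

definition edge_integral :: "real \<Rightarrow> real \<Rightarrow> complex" where
  "edge_integral \<alpha> \<eta> =
     (LINT \<tau>:{1..}|lborel. of_real \<tau> powr (- 5 / 2 - \<i> * of_real \<alpha>) * iexp (\<eta>\<^sup>2 * \<tau>))"

end

theory Submission
  imports Defs
begin

text \<open>
  Taking the Fourier transform of the mild equation and undoing the free evolution
  turns it into the Duhamel formula in the interaction picture.  The cubic
  integral in the definition of the renormalized profile cancels the cubic part of that formula
  exactly (\<open>renormalized_profile_eq\<close>), so the profile changes only through the quintic term with the
  moving potential.  Letting the final time tend to infinity, the profile increment from \<open>T\<close> on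
  is \<open>\<i>\<close> times the integral over \<open>s \<ge> T\<close> of \<open>q(s)\<close>, the phase \<open>s\<zeta>\<^sup>2\<close> times the
  transform of \<open>W(y + \<gamma>s) |u|\<^sup>4 u\<close> (\<open>profile_tail\<close>).

  In the moving frame \<open>x = y + \<gamma>s\<close> the potential stands still and the solution is seen near the ray
  \<open>y = -\<gamma>s\<close>, where the scattering asymptotics give \<open>s\<close> to the power \<open>-1/2\<close> times an oscillating
  factor times \<open>A(x/s - \<gamma>)\<close>.  At frequency \<open>-\<gamma>/2 + x0\<close> all large phases cancel: what remains is
  \<open>s x0\<^sup>2 - x x0 + x\<^sup>2/(4s)\<close>.  Since \<open>W\<close> is localized in \<open>x\<close>, one may freeze \<open>A\<close> at \<open>-\<gamma>\<close> and drop the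
  last two terms of the phase, and \<open>q(s)\<close> becomes \<open>M0 |A0|\<^sup>4 A0\<close> times the power
  \<open>s\<close> to \<open>-5/2 - \<i>\<alpha>\<close> times the phase \<open>s x0\<^sup>2\<close> (\<open>moving_quintic_fourier_estimate\<close>).  With
  \<open>x0 = \<eta>/\<surd>T\<close> and \<open>s = T\<tau>\<close> the integral of this main term is exactly the edge integral
  (\<open>main_term_integral\<close>).

  The errors, relative to \<open>s\<close> to the power \<open>-5/2\<close>: replacing the solution by its asymptotics costs
  \<open>s\<close> to \<open>-a\<close>, and this determines the rate; freezing \<open>A\<close> costs no more, because \<open>A\<close> is Hoelder
  continuous of an order larger than \<open>a\<close> and the logarithmic phase loses only a logarithm; the
  phase terms cost \<open>|x0|\<close> and \<open>s\<close> to \<open>-1/2\<close>, one power of \<open>|x|\<close> being all that the decay of a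
  general \<open>W\<close> can absorb.  Integrating in \<open>s\<close> gives \<open>edge_profile_estimate\<close>, and the bounds of the
  theorem follow by inserting the admissible range of \<open>\<eta>\<close>.

  Transferring the mild equation to the Fourier side needs every transform to be integrable, so
  that Fubini's theorem and Fourier inversion apply.  This is obtained in the Wiener algebra of
  functions with integrable transform: it contains the weighted Sobolev space, is closed under the
  products in the nonlinearity, and contains the potential.  Inversion itself is deduced from
  Levy's uniqueness theorem for characteristic functions by comparing Gaussian regularizations.

  The expansion of the edge integral is two integrations by parts.
\<close>

section \<open>Uniqueness of the Fourier transform\<close>

lemma integrable_iexp_mult:
  fixes f :: "'a \<Rightarrow> complex"
  assumes "integrable M f" "g \<in> borel_measurable M"
  shows "integrable M (\<lambda>x. iexp (g x) * f x)"
proof (rule Bochner_Integration.integrable_bound[OF assms(1)])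
  have [measurable]: "f \<in> borel_measurable M" "g \<in> borel_measurable M" using assms by auto
  show "(\<lambda>x. iexp (g x) * f x) \<in> borel_measurable M" by measurable
qed (auto simp: norm_mult)

lemma integrable_pair_kernel:
  fixes f g :: "real \<Rightarrow> complex" and k :: "real \<times> real \<Rightarrow> complex"
  assumes f: "integrable lborel f" and g: "integrable lborel g"
    and k[measurable]: "k \<in> borel_measurable (lborel \<Otimes>\<^sub>M lborel)" and k1: "\<And>p. cmod (k p) \<le> B"
  shows "integrable (lborel \<Otimes>\<^sub>M lborel) (\<lambda>(x, y). k (x, y) * f x * g y)"
proof -
  have [measurable]: "f \<in> borel_measurable borel" "g \<in> borel_measurable borel" using f g by auto
  have "integrable (lborel \<Otimes>\<^sub>M lborel) (\<lambda>(x, y). f x * g y)"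
  proof (rule lborel_pair.Fubini_integrable)
    show "integrable lborel (\<lambda>x. LINT y|lborel. norm (case (x, y) of (x, y) \<Rightarrow> f x * g y))"
      using f by (simp add: norm_mult)
    show "AE x in lborel. integrable lborel (\<lambda>y. case (x, y) of (x, y) \<Rightarrow> f x * g y)"
      using g by simp
  qed measurable
  then have "integrable (lborel \<Otimes>\<^sub>M lborel) (\<lambda>p. of_real B * (case p of (x, y) \<Rightarrow> f x * g y))"
    by (rule integrable_mult_right)
  then show ?thesis
  proof (rule Bochner_Integration.integrable_bound)
    show "AE p in lborel \<Otimes>\<^sub>M lborel. cmod (case p of (x, y) \<Rightarrow> k (x, y) * f x * g y)
       \<le> cmod (of_real B * (case p of (x, y) \<Rightarrow> f x * g y))"
    proof (rule AE_I2)
      fix p :: "real \<times> real"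
      obtain x y where p: "p = (x, y)" by (cases p)
      have "cmod (k (x, y)) * (cmod (f x) * cmod (g y)) \<le> \<bar>B\<bar> * (cmod (f x) * cmod (g y))"
        using k1[of "(x, y)"] by (intro mult_right_mono) auto
      then show "cmod (case p of (x, y) \<Rightarrow> k (x, y) * f x * g y)
       \<le> cmod (of_real B * (case p of (x, y) \<Rightarrow> f x * g y))" by (simp add: p norm_mult mult_ac)
    qed
  qed measurable
qed

lemma swap_kernel:
  fixes f g :: "real \<Rightarrow> complex" and k :: "real \<times> real \<Rightarrow> complex"
  assumes f: "integrable lborel f" and g: "integrable lborel g"
    and k[measurable]: "k \<in> borel_measurable (lborel \<Otimes>\<^sub>M lborel)" and k1: "\<And>p. cmod (k p) \<le> B"
  shows "(LINT y|lborel. LINT x|lborel. k (x, y) * f x * g y) =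
         (LINT x|lborel. LINT y|lborel. k (x, y) * f x * g y)"
  by (rule lborel_pair.Fubini_integral[OF integrable_pair_kernel[OF assms]])

text \<open>
  The positive and the negative part of \<open>f\<close> have equal integrals and equal transforms.
  Normalized, they are the densities of two probability measures with the same characteristic
  function, which Levy's uniqueness theorem identifies.
\<close>

lemma fourier_unique_real:
  fixes f :: "real \<Rightarrow> real"
  assumes f: "integrable lborel f"
    and zero: "\<And>t. (LINT x|lborel. iexp (t * x) * of_real (f x)) = 0"
  shows "AE x in lborel. f x = 0"
proof -
  have [measurable]: "f \<in> borel_measurable borel" using f by auto
  define p where "p x = max 0 (f x)" for x
  define n where "n x = max 0 (- f x)" for x
  have ip: "integrable lborel p" and iN: "integrable lborel n"
    using f unfolding p_def n_def by auto
  have [measurable]: "p \<in> borel_measurable borel" "n \<in> borel_measurable borel" using ip iN by auto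
  have pn: "p x \<ge> 0" "n x \<ge> 0" for x by (auto simp: p_def n_def)
  have fpn: "f x = p x - n x" for x by (auto simp: p_def n_def)
  have ie: "integrable lborel (\<lambda>x. iexp (t * x) * complex_of_real (q x))" if "integrable lborel q" for t q
    using that by (intro integrable_iexp_mult) auto
  have eq: "(LINT x|lborel. iexp (t * x) * of_real (p x)) = (LINT x|lborel. iexp (t * x) * of_real (n x))" for t
  proof -
    have "(LINT x|lborel. iexp (t * x) * of_real (p x)) - (LINT x|lborel. iexp (t * x) * of_real (n x))
      = (LINT x|lborel. iexp (t * x) * of_real (f x))"
      by (subst Bochner_Integration.integral_diff[symmetric, OF ie[OF ip] ie[OF iN]])
         (simp add: fpn algebra_simps)
    then show ?thesis using zero[of t] by simp
  qed
  define m where "m = (LINT x|lborel. p x)"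
  have mn: "m = (LINT x|lborel. n x)"
    using eq[of 0] unfolding m_def by simp
  show ?thesis
  proof (cases "m = 0")
    case True
    have "AE x in lborel. p x = 0" "AE x in lborel. n x = 0"
      using integral_nonneg_eq_0_iff_AE[OF ip] integral_nonneg_eq_0_iff_AE[OF iN] True mn m_def pn by auto
    then show ?thesis by eventually_elim (simp add: fpn)
  next
    case False
    have "m \<ge> 0" unfolding m_def by (intro integral_nonneg_AE) (use pn in auto)
    with False have m: "m > 0" by simp
    let ?D = "\<lambda>q. density lborel (\<lambda>x. ennreal (q x / m))"
    have D: "real_distribution (?D q)" "char (?D q) t = (LINT x|lborel. iexp (t * x) * of_real (q x)) / m"
      if q: "integrable lborel q" "\<And>x. q x \<ge> 0" "(LINT x|lborel. q x) = m" for q t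
    proof -
      have [measurable]: "q \<in> borel_measurable borel" using q by auto
      have "emeasure (?D q) UNIV = (\<integral>\<^sup>+x. ennreal (q x / m) \<partial>lborel)"
        by (simp add: emeasure_density)
      also have "\<dots> = ennreal (LINT x|lborel. q x / m)"
        by (rule nn_integral_eq_integral) (use q m in auto)
      also have "\<dots> = 1" using q m by simp
      finally have "prob_space (?D q)" by (intro prob_spaceI) simp
      then show "real_distribution (?D q)"
        by (simp add: real_distribution_def real_distribution_axioms_def)
      show "char (?D q) t = (LINT x|lborel. iexp (t * x) * of_real (q x)) / m"
        unfolding char_def
        by (subst integral_density) (use q m in \<open>auto simp: scaleR_conv_of_real mult_ac\<close>)
    qed
    have "?D p = ?D n"
      by (rule Levy_uniqueness) (use D ip iN pn m_def mn eq in auto)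
    then have "AE x in lborel. ennreal (p x / m) = ennreal (n x / m)"
      by (subst (asm) sigma_finite_measure.density_unique_iff[OF sigma_finite_lborel]) auto
    then show ?thesis
      by eventually_elim (use pn m in \<open>auto simp: fpn\<close>)
  qed
qed

text \<open>
  The transform of the conjugate function is the reflected conjugate of the transform, so the
  transforms of the real and the imaginary part vanish as well.
\<close>

lemma fourier_unique:
  fixes f :: "real \<Rightarrow> complex"
  assumes f: "integrable lborel f" and zero: "\<And>\<zeta>. fourier f \<zeta> = 0"
  shows "AE x in lborel. f x = 0"
proof -
  have i1: "integrable lborel (\<lambda>x. iexp (t * x) * f x)" for t
    by (intro integrable_iexp_mult f) auto
  have i2: "integrable lborel (\<lambda>x. iexp (t * x) * cnj (f x))" for t
    by (intro integrable_iexp_mult integrable_cnj f) auto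
  have z1: "(LINT x|lborel. iexp (t * x) * f x) = 0" for t
    using zero[of "- t"] by (simp add: fourier_def)
  have z2: "(LINT x|lborel. iexp (t * x) * cnj (f x)) = 0" for t
  proof -
    have "(LINT x|lborel. iexp (t * x) * cnj (f x)) = cnj (LINT x|lborel. iexp (- t * x) * f x)"
      by (simp add: exp_cnj flip: Bochner_Integration.integral_cnj)
    then show ?thesis using z1[of "- t"] by simp
  qed
  have re: "complex_of_real (Re (f x)) = (f x + cnj (f x)) / 2" for x
    by (simp add: complex_eq_iff)
  have im: "complex_of_real (Im (f x)) = (f x - cnj (f x)) / (2 * \<i>)" for x
    by (simp add: complex_eq_iff)
  have "AE x in lborel. Re (f x) = 0"
  proof (rule fourier_unique_real)
    show "integrable lborel (\<lambda>x. Re (f x))" using f by auto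
    fix t :: real
    have "(LINT x|lborel. iexp (t * x) * of_real (Re (f x))) =
      ((LINT x|lborel. iexp (t * x) * f x) + (LINT x|lborel. iexp (t * x) * cnj (f x))) / 2"
      by (subst Bochner_Integration.integral_add[symmetric, OF i1 i2])
        (simp add: re algebra_simps flip: integral_divide_zero)
    then show "(LINT x|lborel. iexp (t * x) * of_real (Re (f x))) = 0" using z1 z2 by simp
  qed
  moreover have "AE x in lborel. Im (f x) = 0"
  proof (rule fourier_unique_real)
    show "integrable lborel (\<lambda>x. Im (f x))" using f by auto
    fix t :: real
    have "(LINT x|lborel. iexp (t * x) * of_real (Im (f x))) =
      ((LINT x|lborel. iexp (t * x) * f x) - (LINT x|lborel. iexp (t * x) * cnj (f x))) / (2 * \<i>)"
      by (subst Bochner_Integration.integral_diff[symmetric, OF i1 i2])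
        (simp add: im algebra_simps flip: integral_divide_zero)
    then show "(LINT x|lborel. iexp (t * x) * of_real (Im (f x))) = 0" using z1 z2 by simp
  qed
  ultimately show ?thesis by eventually_elim (simp add: complex_eq_iff)
qed

section \<open>Gaussian regularization and Fourier inversion\<close>

lemma gaussian_char:
  "(LINT v|lborel. iexp (v * y) * complex_of_real (std_normal_density v)) = of_real (exp (- y\<^sup>2 / 2))"
proof -
  have "char std_normal_distribution y = (LINT v|lborel. std_normal_density v *\<^sub>R iexp (y * v))"
    unfolding char_def by (subst integral_density) (auto simp: normal_density_nonneg)
  then show ?thesis unfolding char_std_normal_distribution
    by (simp add: scaleR_conv_of_real mult_ac)
qed

lemma integrable_std_normal: "integrable lborel (\<lambda>v. complex_of_real (std_normal_density v))"
  using integrable_std_normal_moment[of 0] by simp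

lemma exp_eq_std_normal:
  "complex_of_real (exp (- y\<^sup>2 / 2)) = of_real (sqrt (2 * pi)) * of_real (std_normal_density y)"
proof -
  have "exp (- y\<^sup>2 / 2) = sqrt (2 * pi) * std_normal_density y"
    unfolding std_normal_density_def by simp
  then show ?thesis by (simp only: of_real_mult)
qed

lemma integrable_gaussian: "integrable lborel (\<lambda>v. complex_of_real (std_normal_density (z - v)))"
  using lborel_integrable_real_affine[OF integrable_std_normal, of "-1" z] by simp

lemma gaussian_char_shifted:
  "(LINT x|lborel. iexp (- (x * y)) * complex_of_real (std_normal_density (z - x)))
     = iexp (- (z * y)) * of_real (exp (- y\<^sup>2 / 2))"
proof -
  have "(LINT x|lborel. iexp (- (x * y)) * complex_of_real (std_normal_density (z - x)))
      = (LINT v|lborel. iexp (- ((z - v) * y)) * complex_of_real (std_normal_density v))"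
    by (subst lborel_integral_real_affine[where c="-1" and t=z]) simp_all
  also have "\<dots> = (LINT v|lborel. iexp (- (z * y)) * (iexp (v * y) * complex_of_real (std_normal_density v)))"
  proof (intro Bochner_Integration.integral_cong refl)
    fix v
    have "iexp (- ((z - v) * y)) = iexp (- (z * y)) * iexp (v * y)"
      by (simp add: algebra_simps flip: exp_add)
    then show "iexp (- ((z - v) * y)) * complex_of_real (std_normal_density v)
      = iexp (- (z * y)) * (iexp (v * y) * complex_of_real (std_normal_density v))"
      by (simp only: mult.assoc)
  qed
  finally show ?thesis using gaussian_char[of y] by simp
qed

text \<open>
  Multiplying by a Gaussian in space averages the transform against a Gaussian.  The same average
  appears in \<open>fourier_gaussian_inv_fourier\<close>, where the function is only known as an inverse transform
  and need not be integrable before the multiplication.  Comparing the two is what proves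
  inversion.
\<close>

lemma fourier_gaussian_mult:
  assumes f: "integrable lborel f"
  shows "fourier (\<lambda>y. of_real (exp (- y\<^sup>2 / 2)) * f y) z
       = (LINT x|lborel. complex_of_real (std_normal_density (z - x)) * fourier f x)"
proof -
  let ?k = "\<lambda>p::real\<times>real. iexp (- (fst p * snd p))"
  let ?g = "\<lambda>x. complex_of_real (std_normal_density (z - x))"
  have "(LINT x|lborel. ?g x * fourier f x) = (LINT x|lborel. LINT y|lborel. ?k (x, y) * ?g x * f y)"
    by (intro Bochner_Integration.integral_cong refl)
       (simp add: fourier_def mult_ac flip: integral_mult_right_zero)
  also have "\<dots> = (LINT y|lborel. LINT x|lborel. ?k (x, y) * ?g x * f y)"
    by (rule swap_kernel[symmetric, where B=1, OF integrable_gaussian f]) simp_all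
  also have "\<dots> = (LINT y|lborel. (LINT x|lborel. iexp (- (x * y)) * ?g x) * f y)"
    by simp
  also have "\<dots> = fourier (\<lambda>y. of_real (exp (- y\<^sup>2 / 2)) * f y) z"
    unfolding gaussian_char_shifted fourier_def by (simp add: mult_ac)
  finally show ?thesis ..
qed

lemma fourier_gaussian_inv_fourier:
  assumes g: "integrable lborel g"
  shows "fourier (\<lambda>y. of_real (exp (- y\<^sup>2 / 2)) * inv_fourier g y) z
       = (LINT x|lborel. complex_of_real (std_normal_density (z - x)) * g x)"
proof -
  let ?k = "\<lambda>p::real\<times>real. iexp (fst p * snd p - z * snd p)"
  let ?G = "\<lambda>y. complex_of_real (std_normal_density y)"
  have G: "integrable lborel ?G" by (rule integrable_std_normal)
  have "fourier (\<lambda>y. of_real (exp (- y\<^sup>2 / 2)) * inv_fourier g y) z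
     = (LINT y|lborel. of_real (1 / sqrt (2 * pi)) * (LINT x|lborel. ?k (x, y) * g x * ?G y))"
    unfolding fourier_def
  proof (intro Bochner_Integration.integral_cong refl)
    fix y
    have c: "complex_of_real (sqrt (2 * pi)) / of_real (2 * pi) = of_real (1 / sqrt (2 * pi))"
      by (simp add: field_simps flip: of_real_mult of_real_divide)
    have "iexp (- (z * y)) * (of_real (exp (- y\<^sup>2 / 2)) * inv_fourier g y) =
      (complex_of_real (sqrt (2 * pi)) / of_real (2 * pi)) * (iexp (- (z * y)) * ?G y * (LINT x|lborel. iexp (x * y) * g x))"
      unfolding exp_eq_std_normal inv_fourier_def by simp
    also have "iexp (- (z * y)) * ?G y * (LINT x|lborel. iexp (x * y) * g x)
       = (LINT x|lborel. ?k (x, y) * g x * ?G y)"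
      by (subst integral_mult_right_zero[symmetric])
        (simp add: exp_diff exp_minus divide_simps algebra_simps)
    finally show "iexp (- (z * y)) * (of_real (exp (- y\<^sup>2 / 2)) * inv_fourier g y) =
      of_real (1 / sqrt (2 * pi)) * (LINT x|lborel. ?k (x, y) * g x * ?G y)" unfolding c .
  qed
  also have "\<dots> = of_real (1 / sqrt (2 * pi)) * (LINT x|lborel. LINT y|lborel. ?k (x, y) * g x * ?G y)"
    by (simp only: integral_mult_right_zero) (subst swap_kernel[where B=1, OF g G]; simp)
  also have "(LINT x|lborel. LINT y|lborel. ?k (x, y) * g x * ?G y)
      = (LINT x|lborel. g x * of_real (exp (- (z - x)\<^sup>2 / 2)))"
  proof (intro Bochner_Integration.integral_cong refl)
    fix x
    have "(LINT y|lborel. ?k (x, y) * g x * ?G y) = (LINT y|lborel. g x * (iexp (y * (x - z)) * ?G y))"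
      by (intro Bochner_Integration.integral_cong refl) (simp add: algebra_simps)
    also have "\<dots> = g x * of_real (exp (- (z - x)\<^sup>2 / 2))"
      using gaussian_char[of "x - z"] by (simp add: power2_commute)
    finally show "(LINT y|lborel. ?k (x, y) * g x * ?G y) = g x * of_real (exp (- (z - x)\<^sup>2 / 2))" .
  qed
  also have "of_real (1 / sqrt (2 * pi)) * \<dots> = (LINT x|lborel. complex_of_real (std_normal_density (z - x)) * g x)"
    by (subst integral_mult_right_zero[symmetric])
       (simp add: std_normal_density_def mult_ac)
  finally show ?thesis .
qed

lemma cmod_fourier_le: "cmod (fourier f z) \<le> (LINT x|lborel. cmod (f x))"
proof -
  have "cmod (fourier f z) \<le> (LINT x|lborel. cmod (iexp (- (z * x)) * f x))"
    unfolding fourier_def by (rule integral_norm_bound)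
  then show ?thesis by (simp add: norm_mult)
qed

lemma cmod_inv_fourier_le: "cmod (inv_fourier g y) \<le> (LINT x|lborel. cmod (g x)) / (2 * pi)"
proof -
  have "cmod (LINT x|lborel. iexp (x * y) * g x) \<le> (LINT x|lborel. cmod (iexp (x * y) * g x))"
    by (rule integral_norm_bound)
  then show ?thesis by (simp add: inv_fourier_def norm_mult norm_divide divide_right_mono)
qed

lemma AE_zero_continuous:
  fixes f :: "real \<Rightarrow> complex"
  assumes c: "continuous_on UNIV f" and ae: "AE x in lborel. f x = 0"
  shows "f x = 0"
proof (rule ccontr)
  assume "f x \<noteq> 0"
  moreover have "open {y. f y \<noteq> 0}"
    using c by (intro open_Collect_neq continuous_intros)
  ultimately obtain e where e: "e > 0" "ball x e \<subseteq> {y. f y \<noteq> 0}"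
    unfolding open_contains_ball by auto
  then have sub: "{x - e / 2..x + e / 2} \<subseteq> {y. f y \<noteq> 0}"
    by (force simp: dist_real_def subset_eq)
  have "AE y in lborel. y \<notin> {x - e / 2..x + e / 2}"
    using ae by eventually_elim (use sub in auto)
  then have "{x - e / 2..x + e / 2} \<in> null_sets lborel"
    by (subst AE_iff_null_sets) auto
  then show False using e by (simp add: null_sets_def)
qed

lemma AE_eq_continuous:
  fixes f g :: "real \<Rightarrow> complex"
  assumes "continuous_on UNIV f" "continuous_on UNIV g" "AE x in lborel. f x = g x"
  shows "f x = g x"
proof -
  have "f x - g x = 0"
    by (rule AE_zero_continuous[of "\<lambda>x. f x - g x"]) (use assms in \<open>auto intro!: continuous_intros\<close>)
  then show ?thesis by simp
qed

lemma continuous_on_iexp_integral: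
  assumes f: "integrable lborel f"
  shows "continuous_on UNIV (\<lambda>z. LINT y|lborel. iexp (z * y) * f y)"
  unfolding continuous_on_sequentially
proof (intro allI ballI impI)
  fix s :: "nat \<Rightarrow> real" and a :: real
  assume "(\<forall>n. s n \<in> UNIV) \<and> s \<longlonglongrightarrow> a"
  then have s: "s \<longlonglongrightarrow> a" by simp
  have [measurable]: "f \<in> borel_measurable borel" using f by auto
  show "((\<lambda>z. LINT y|lborel. iexp (z * y) * f y) \<circ> s) \<longlonglongrightarrow> (LINT y|lborel. iexp (a * y) * f y)"
    unfolding o_def
  proof (rule integral_dominated_convergence[where w="\<lambda>y. cmod (f y)"])
    show "AE y in lborel. (\<lambda>n. iexp (s n * y) * f y) \<longlonglongrightarrow> iexp (a * y) * f y"
      by (intro AE_I2 tendsto_intros s)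
  qed (use f in \<open>auto simp: norm_mult\<close>)
qed

lemma continuous_on_fourier:
  assumes f: "integrable lborel f"
  shows "continuous_on UNIV (fourier f)"
proof -
  have "continuous_on UNIV (\<lambda>z. (\<lambda>z. LINT y|lborel. iexp (z * y) * f y) (- z))"
    by (rule continuous_on_compose2[OF continuous_on_iexp_integral[OF f]]) (auto intro!: continuous_intros)
  then show ?thesis by (simp add: fourier_def[abs_def])
qed

lemma continuous_on_inv_fourier:
  assumes f: "integrable lborel f"
  shows "continuous_on UNIV (inv_fourier f)"
  using continuous_on_iexp_integral[OF f]
  by (auto simp: inv_fourier_def[abs_def] mult.commute intro!: continuous_intros)

lemma fourier_measurable:
  "integrable lborel f \<Longrightarrow> fourier f \<in> borel_measurable borel"
  by (intro borel_measurable_continuous_onI continuous_on_fourier)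

lemma inv_fourier_measurable:
  "integrable lborel f \<Longrightarrow> inv_fourier f \<in> borel_measurable borel"
  by (intro borel_measurable_continuous_onI continuous_on_inv_fourier)

lemma fourier_diff:
  assumes "integrable lborel f" "integrable lborel g"
  shows "fourier (\<lambda>x. f x - g x) z = fourier f z - fourier g z"
proof -
  have i: "integrable lborel (\<lambda>x. iexp (- (z * x)) * f x)" "integrable lborel (\<lambda>x. iexp (- (z * x)) * g x)"
    by (intro integrable_iexp_mult assms; simp)+
  show ?thesis unfolding fourier_def
    by (subst Bochner_Integration.integral_diff[OF i, symmetric]) (simp only: ring_distribs)
qed

lemma fourier_add:
  assumes "integrable lborel f" "integrable lborel g"
  shows "fourier (\<lambda>x. f x + g x) z = fourier f z + fourier g z"
proof -
  have i: "integrable lborel (\<lambda>x. iexp (- (z * x)) * f x)" "integrable lborel (\<lambda>x. iexp (- (z * x)) * g x)"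
    by (intro integrable_iexp_mult assms; simp)+
  show ?thesis unfolding fourier_def
    by (subst Bochner_Integration.integral_add[OF i, symmetric]) (simp only: ring_distribs)
qed

lemma fourier_cmult: "fourier (\<lambda>x. c * f x) z = c * fourier f z"
  unfolding fourier_def
  by (subst integral_mult_right_zero[symmetric]) (simp add: mult_ac)

lemma fourier_cong_AE:
  assumes "AE x in lborel. f x = g x" "f \<in> borel_measurable borel" "g \<in> borel_measurable borel"
  shows "fourier f z = fourier g z"
  unfolding fourier_def
proof (rule integral_cong_AE)
  show "AE x in lborel. iexp (- (z * x)) * f x = iexp (- (z * x)) * g x"
    using assms(1) by eventually_elim simp
qed (use assms in measurable)

lemma inv_fourier_unique:
  assumes g: "integrable lborel g" and h: "integrable lborel h"
    and ae: "AE y in lborel. inv_fourier g y = inv_fourier h y"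
  shows "AE x in lborel. g x = h x"
proof -
  have "AE x in lborel. (g x - h x) = 0"
  proof (rule fourier_unique)
    show "integrable lborel (\<lambda>x. g x - h x)" using g h by simp
    fix z
    have "inv_fourier g (- z) = inv_fourier h (- z)"
      by (rule AE_eq_continuous) (use g h ae continuous_on_inv_fourier in auto)
    moreover have "fourier f z = of_real (2 * pi) * inv_fourier f (- z)" for f
      by (simp add: fourier_def inv_fourier_def mult.commute)
    ultimately show "fourier (\<lambda>x. g x - h x) z = 0"
      by (simp add: fourier_diff[OF g h])
  qed
  then show ?thesis by simp
qed

text \<open>
  The Gaussian makes the bounded function \<open>inv_fourier g\<close> integrable, so uniqueness of the
  transform applies to the regularized functions; dividing by the Gaussian, which never vanishes,
  gives the claim.
\<close>

lemma AE_eq_by_gaussian: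
  assumes f: "integrable lborel (\<lambda>y. complex_of_real (exp (- y\<^sup>2 / 2)) * f y)"
    and g: "integrable lborel g"
    and eq: "\<And>z. fourier (\<lambda>y. complex_of_real (exp (- y\<^sup>2 / 2)) * f y) z
        = (LINT x|lborel. complex_of_real (std_normal_density (z - x)) * g x)"
  shows "AE y in lborel. f y = inv_fourier g y"
proof -
  let ?e = "\<lambda>y. complex_of_real (exp (- y\<^sup>2 / 2))"
  define M where "M = (LINT x|lborel. cmod (g x)) / (2 * pi)"
  have M: "cmod (inv_fourier g y) \<le> M" for y unfolding M_def by (rule cmod_inv_fourier_le)
  have "integrable lborel ?e" unfolding exp_eq_std_normal by (intro integrable_mult_right integrable_std_normal)
  then have "integrable lborel (\<lambda>y. of_real M * ?e y)"
    by (rule integrable_mult_right)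
  then have i: "integrable lborel (\<lambda>y. ?e y * inv_fourier g y)"
  proof (rule Bochner_Integration.integrable_bound)
    show "(\<lambda>y. ?e y * inv_fourier g y) \<in> borel_measurable lborel"
      using g inv_fourier_measurable[OF g] by measurable
    show "AE y in lborel. cmod (?e y * inv_fourier g y) \<le> cmod (of_real M * ?e y)"
    proof (rule AE_I2)
      fix y
      have "cmod (?e y) * cmod (inv_fourier g y) \<le> cmod (?e y) * \<bar>M\<bar>"
        using M[of y] by (intro mult_left_mono) auto
      then show "cmod (?e y * inv_fourier g y) \<le> cmod (of_real M * ?e y)"
        by (simp add: norm_mult mult.commute)
    qed
  qed
  have "AE y in lborel. ?e y * f y - ?e y * inv_fourier g y = 0"
  proof (rule fourier_unique)
    show "integrable lborel (\<lambda>y. ?e y * f y - ?e y * inv_fourier g y)"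
      by (rule Bochner_Integration.integrable_diff[OF f i])
    show "fourier (\<lambda>y. ?e y * f y - ?e y * inv_fourier g y) z = 0" for z
      unfolding fourier_diff[OF f i] eq fourier_gaussian_inv_fourier[OF g] by (rule diff_self)
  qed
  then show ?thesis by eventually_elim simp
qed

lemma fourier_inversion_L1:
  assumes f: "integrable lborel f" and g: "integrable lborel (fourier f)"
  shows "AE y in lborel. f y = inv_fourier (fourier f) y"
proof (rule AE_eq_by_gaussian[OF _ g])
  have [measurable]: "f \<in> borel_measurable borel" using f by auto
  show "integrable lborel (\<lambda>y. complex_of_real (exp (- y\<^sup>2 / 2)) * f y)"
    by (rule Bochner_Integration.integrable_bound[OF f]) (auto simp: norm_mult mult_left_le_one_le)
qed (rule fourier_gaussian_mult[OF f])

section \<open>Square integrable functions and their transforms\<close>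

lemma Cauchy_Schwarz_L2:
  assumes f: "L2 f" and g: "L2 g"
  shows "integrable lborel (\<lambda>x. f x * g x)"
    and "(LINT x|lborel. cmod (f x) * cmod (g x)) \<le> L2_norm f * L2_norm g"
proof -
  have [measurable]: "f \<in> borel_measurable borel" "g \<in> borel_measurable borel"
    and i: "integrable lborel (\<lambda>x. (cmod (f x))\<^sup>2)" "integrable lborel (\<lambda>x. (cmod (g x))\<^sup>2)"
    using f g by (auto simp: L2_def)
  show j: "integrable lborel (\<lambda>x. f x * g x)"
  proof (rule Bochner_Integration.integrable_bound[OF Bochner_Integration.integrable_add[OF i]])
    show "AE x in lborel. cmod (f x * g x) \<le> norm ((cmod (f x))\<^sup>2 + (cmod (g x))\<^sup>2)"
    proof (rule AE_I2)
      fix x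
      have "2 * cmod (f x) * cmod (g x) \<le> (cmod (f x))\<^sup>2 + (cmod (g x))\<^sup>2"
        using sum_squares_bound by blast
      moreover have "0 \<le> cmod (f x) * cmod (g x)" by simp
      ultimately have "cmod (f x) * cmod (g x) \<le> (cmod (f x))\<^sup>2 + (cmod (g x))\<^sup>2" by linarith
      then show "cmod (f x * g x) \<le> norm ((cmod (f x))\<^sup>2 + (cmod (g x))\<^sup>2)"
        by (simp add: norm_mult)
    qed
  qed measurable
  have k: "integrable lborel (\<lambda>x. cmod (f x) * cmod (g x))"
    using integrable_norm[OF j] by (simp add: norm_mult)
  let ?F = "LINT x|lborel. (cmod (f x))\<^sup>2" and ?G = "LINT x|lborel. (cmod (g x))\<^sup>2"
    and ?I = "LINT x|lborel. cmod (f x) * cmod (g x)"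
  have pos: "?F \<ge> 0" "?G \<ge> 0" "?I \<ge> 0" by (auto intro!: integral_nonneg_AE)
  have "(\<integral>\<^sup>+x. ennreal (cmod (f x)) * ennreal (cmod (g x)) \<partial>lborel)\<^sup>2
    \<le> (\<integral>\<^sup>+x. ennreal (cmod (f x)) ^ 2 \<partial>lborel) * (\<integral>\<^sup>+x. ennreal (cmod (g x)) ^ 2 \<partial>lborel)"
    by (rule Cauchy_Schwarz_nn_integral) measurable
  also have "(\<integral>\<^sup>+x. ennreal (cmod (f x)) ^ 2 \<partial>lborel) = ennreal ?F"
    by (subst nn_integral_eq_integral[symmetric, OF i(1)]) (auto simp: ennreal_power)
  also have "(\<integral>\<^sup>+x. ennreal (cmod (g x)) ^ 2 \<partial>lborel) = ennreal ?G"
    by (subst nn_integral_eq_integral[symmetric, OF i(2)]) (auto simp: ennreal_power)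
  also have "(\<integral>\<^sup>+x. ennreal (cmod (f x)) * ennreal (cmod (g x)) \<partial>lborel) = ennreal ?I"
    by (subst nn_integral_eq_integral[symmetric, OF k]) (auto simp: ennreal_mult)
  finally have "ennreal (?I\<^sup>2) \<le> ennreal (?F * ?G)"
    using pos by (simp add: ennreal_power ennreal_mult)
  then have "?I\<^sup>2 \<le> ?F * ?G" using pos by (simp add: ennreal_le_iff)
  then have "?I \<le> sqrt (?F * ?G)" by (rule real_le_rsqrt)
  then show "?I \<le> L2_norm f * L2_norm g" by (simp add: L2_norm_def real_sqrt_mult)
qed

lemma L2_norm_nonneg [simp]: "L2_norm f \<ge> 0"
  by (simp add: L2_norm_def integral_nonneg_AE)

lemma L2_add:
  assumes "L2 f" "L2 g" shows "L2 (\<lambda>x. f x + c * g x)"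
proof -
  have [measurable]: "f \<in> borel_measurable borel" "g \<in> borel_measurable borel"
    and i: "integrable lborel (\<lambda>x. (cmod (f x))\<^sup>2)" "integrable lborel (\<lambda>x. (cmod (g x))\<^sup>2)"
    using assms by (auto simp: L2_def)
  have "integrable lborel (\<lambda>x. 2 * (cmod (f x))\<^sup>2 + 2 * (cmod c)\<^sup>2 * (cmod (g x))\<^sup>2)"
    using i by auto
  then have "integrable lborel (\<lambda>x. (cmod (f x + c * g x))\<^sup>2)"
  proof (rule Bochner_Integration.integrable_bound)
    show "AE x in lborel. norm ((cmod (f x + c * g x))\<^sup>2)
       \<le> norm (2 * (cmod (f x))\<^sup>2 + 2 * (cmod c)\<^sup>2 * (cmod (g x))\<^sup>2)"
    proof (rule AE_I2)
      fix x
      have "(cmod (f x + c * g x))\<^sup>2 \<le> (cmod (f x) + cmod (c * g x))\<^sup>2"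
        by (intro power_mono norm_triangle_ineq) simp
      also have "\<dots> \<le> 2 * (cmod (f x))\<^sup>2 + 2 * (cmod (c * g x))\<^sup>2"
        using sum_squares_bound[of "cmod (f x)" "cmod (c * g x)"] by (simp add: power2_sum)
      finally show "norm ((cmod (f x + c * g x))\<^sup>2)
       \<le> norm (2 * (cmod (f x))\<^sup>2 + 2 * (cmod c)\<^sup>2 * (cmod (g x))\<^sup>2)"
        by (simp add: norm_mult power_mult_distrib)
    qed
  qed measurable
  then show ?thesis by (auto simp: L2_def)
qed

lemma L2_diff: "L2 f \<Longrightarrow> L2 g \<Longrightarrow> L2 (\<lambda>x. f x - g x)"
  using L2_add[of f g "-1"] by simp

lemma L2_norm_diff_le:
  assumes f: "L2 f" and g: "L2 g"
  shows "L2_norm (\<lambda>x. f x - g x) \<le> sqrt 2 * (L2_norm f + L2_norm g)"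
proof -
  have i: "integrable lborel (\<lambda>x. (cmod (f x))\<^sup>2)" "integrable lborel (\<lambda>x. (cmod (g x))\<^sup>2)"
     "integrable lborel (\<lambda>x. (cmod (f x - g x))\<^sup>2)"
    using f g L2_diff[OF f g] by (auto simp: L2_def)
  let ?F = "LINT x|lborel. (cmod (f x))\<^sup>2" and ?G = "LINT x|lborel. (cmod (g x))\<^sup>2"
  have pos: "?F \<ge> 0" "?G \<ge> 0" by (auto intro!: integral_nonneg_AE)
  have "(LINT x|lborel. (cmod (f x - g x))\<^sup>2) \<le> (LINT x|lborel. 2 * (cmod (f x))\<^sup>2 + 2 * (cmod (g x))\<^sup>2)"
  proof (rule integral_mono)
    fix x
    have "(cmod (f x - g x))\<^sup>2 \<le> (cmod (f x) + cmod (g x))\<^sup>2"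
      by (intro power_mono norm_triangle_ineq4) simp
    also have "\<dots> \<le> 2 * (cmod (f x))\<^sup>2 + 2 * (cmod (g x))\<^sup>2"
      using sum_squares_bound[of "cmod (f x)" "cmod (g x)"] by (simp add: power2_sum)
    finally show "(cmod (f x - g x))\<^sup>2 \<le> 2 * (cmod (f x))\<^sup>2 + 2 * (cmod (g x))\<^sup>2" .
  qed (use i in auto)
  also have "\<dots> = 2 * (?F + ?G)" using i by simp
  finally have "L2_norm (\<lambda>x. f x - g x) \<le> sqrt (2 * (?F + ?G))"
    unfolding L2_norm_def by simp
  also have "\<dots> \<le> sqrt 2 * (sqrt ?F + sqrt ?G)"
    unfolding real_sqrt_mult by (intro mult_left_mono sqrt_add_le_add_sqrt pos) simp
  finally show ?thesis by (simp add: L2_norm_def)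
qed

lemma L2_tendsto_diff:
  assumes "L2_tendsto F f \<Phi>" "L2_tendsto G g \<Phi>"
  shows "L2_tendsto (\<lambda>i x. F i x - G i x) (\<lambda>x. f x - g x) \<Phi>"
  unfolding L2_tendsto_def
proof
  have eq: "(\<lambda>x. F i x - G i x - (f x - g x)) = (\<lambda>x. (F i x - f x) - (G i x - g x))" for i
    by (simp add: algebra_simps)
  have ev: "\<forall>\<^sub>F i in \<Phi>. L2 (\<lambda>x. F i x - f x) \<and> L2 (\<lambda>x. G i x - g x)"
    using assms by (auto simp: L2_tendsto_def intro: eventually_conj)
  then show "\<forall>\<^sub>F i in \<Phi>. L2 (\<lambda>x. F i x - G i x - (f x - g x))"
    by eventually_elim (use L2_diff eq in auto)
  have "((\<lambda>i. sqrt 2 * (L2_norm (\<lambda>x. F i x - f x) + L2_norm (\<lambda>x. G i x - g x))) \<longlongrightarrow> sqrt 2 * (0 + 0)) \<Phi>"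
    using assms by (intro tendsto_intros) (auto simp: L2_tendsto_def)
  then have t: "((\<lambda>i. sqrt 2 * (L2_norm (\<lambda>x. F i x - f x) + L2_norm (\<lambda>x. G i x - g x))) \<longlongrightarrow> 0) \<Phi>"
    by simp
  show "((\<lambda>i. L2_norm (\<lambda>x. F i x - G i x - (f x - g x))) \<longlongrightarrow> 0) \<Phi>"
  proof (rule tendsto_sandwich[OF _ _ tendsto_const t])
    show "\<forall>\<^sub>F i in \<Phi>. L2_norm (\<lambda>x. F i x - G i x - (f x - g x))
       \<le> sqrt 2 * (L2_norm (\<lambda>x. F i x - f x) + L2_norm (\<lambda>x. G i x - g x))"
      using ev by eventually_elim (use L2_norm_diff_le eq in auto)
  qed simp
qed

lemma L2_cmult:
  assumes "L2 f" shows "L2 (\<lambda>x. c * f x)"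
proof -
  have "(\<lambda>x. f x + (c - 1) * f x) = (\<lambda>x. c * f x)" by (simp add: algebra_simps)
  then show ?thesis using L2_add[OF assms assms, of "c - 1"] by simp
qed

lemma L2_trunc_integrable:
  assumes "L2 f" shows "integrable lborel (\<lambda>y. indicator {- real n..real n} y * f y)"
proof (rule Cauchy_Schwarz_L2(1)[OF _ assms])
  have "(\<lambda>y. (cmod (indicator {- real n..real n} y))\<^sup>2) = (indicator {- real n..real n} :: real \<Rightarrow> real)"
    by (auto simp: fun_eq_iff indicator_def)
  then show "L2 (indicator {- real n..real n})" by (auto simp: L2_def)
qed

lemma has_L2_fourier_diff:
  assumes "has_L2_fourier f f'" "has_L2_fourier g g'"
  shows "has_L2_fourier (\<lambda>x. f x - g x) (\<lambda>x. f' x - g' x)"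
proof -
  let ?t = "\<lambda>n f y. indicator {- real n..real n} y * f y :: complex"
  have L: "L2 f" "L2 g" "L2 f'" "L2 g'" using assms by (auto simp: has_L2_fourier_def)
  have "fourier (?t n (\<lambda>x. f x - g x)) = (\<lambda>z. fourier (?t n f) z - fourier (?t n g) z)" for n
    using fourier_diff[OF L2_trunc_integrable[OF L(1)] L2_trunc_integrable[OF L(2)], of n n]
    by (simp add: right_diff_distrib fun_eq_iff)
  moreover have "L2_tendsto (\<lambda>n z. fourier (?t n f) z - fourier (?t n g) z) (\<lambda>x. f' x - g' x) sequentially"
    using assms by (intro L2_tendsto_diff) (auto simp: has_L2_fourier_def)
  ultimately show ?thesis
    using L by (auto simp: has_L2_fourier_def intro: L2_diff)
qed

lemma L2_gaussian: "L2 (\<lambda>x. complex_of_real (std_normal_density (z - x)))"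
  unfolding L2_def
proof
  have le: "std_normal_density v \<le> 1" for v
  proof -
    have "1 / sqrt (2 * pi) * exp (- v\<^sup>2 / 2) \<le> 1 * 1"
      using pi_gt3 by (intro mult_mono) (auto simp: divide_le_eq real_le_rsqrt)
    then show ?thesis by (simp add: std_normal_density_def)
  qed
  show "integrable lborel (\<lambda>x. (cmod (complex_of_real (std_normal_density (z - x))))\<^sup>2)"
  proof (rule Bochner_Integration.integrable_bound[OF integrable_gaussian[of z]])
    show "AE x in lborel. norm ((cmod (complex_of_real (std_normal_density (z - x))))\<^sup>2)
        \<le> cmod (complex_of_real (std_normal_density (z - x)))"
      using le by (auto simp: normal_density_nonneg power2_eq_square intro!: mult_left_le)
  qed measurable
qed measurable

lemma fourier_trunc_tendsto:
  assumes f: "integrable lborel f"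
  shows "(\<lambda>n. fourier (\<lambda>y. indicator {- real n..real n} y * f y) z) \<longlonglongrightarrow> fourier f z"
  unfolding fourier_def
proof (rule integral_dominated_convergence[where w="\<lambda>y. cmod (f y)"])
  have [measurable]: "f \<in> borel_measurable borel" using f by auto
  show "(\<lambda>x. iexp (- (z * x)) * f x) \<in> borel_measurable lborel" by measurable
  show "(\<lambda>x. iexp (- (z * x)) * (indicator {- real n..real n} x * f x)) \<in> borel_measurable lborel" for n
    by measurable
  show "AE x in lborel. (\<lambda>n. iexp (- (z * x)) * (indicator {- real n..real n} x * f x))
     \<longlonglongrightarrow> iexp (- (z * x)) * f x"
  proof (rule AE_I2)
    fix x :: real
    obtain N where N: "\<bar>x\<bar> \<le> real N" using real_arch_simple by blast
    show "(\<lambda>n. iexp (- (z * x)) * (indicator {- real n..real n} x * f x)) \<longlonglongrightarrow> iexp (- (z * x)) * f x"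
    proof (rule tendsto_eventually)
      show "\<forall>\<^sub>F n in sequentially. iexp (- (z * x)) * (indicator {- real n..real n} x * f x) = iexp (- (z * x)) * f x"
        using eventually_ge_at_top[of N]
      proof eventually_elim
        case (elim n)
        then have "x \<in> {- real n..real n}" using N by auto
        then show ?case by simp
      qed
    qed
  qed
  show "AE x in lborel. cmod (iexp (- (z * x)) * (indicator {- real n..real n} x * f x)) \<le> cmod (f x)" for n
    by (auto simp: norm_mult indicator_def)
qed (use f in auto)

text \<open>
  The truncations of \<open>f\<close> are integrable, so their Gaussian regularizations are known from
  \<open>fourier_gaussian_mult\<close>.  On one side they converge by dominated convergence, on the other side by
  the Cauchy--Schwarz inequality, because the transforms converge in $L^2$ and the Gaussian is in
  $L^2$.
\<close>

lemma has_L2_fourier_inversion: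
  assumes h: "has_L2_fourier f g" and g: "integrable lborel g"
  shows "AE y in lborel. f y = inv_fourier g y"
proof (rule AE_eq_by_gaussian[OF _ g])
  have L: "L2 f" "L2 g" using h by (auto simp: has_L2_fourier_def)
  then have [measurable]: "f \<in> borel_measurable borel" by (auto simp: L2_def)
  let ?e = "\<lambda>y. complex_of_real (exp (- y\<^sup>2 / 2))"
  let ?t = "\<lambda>n y. indicator {- real n..real n} y * f y :: complex"
  have "L2 ?e" unfolding exp_eq_std_normal
    using L2_cmult[OF L2_gaussian[of 0], of "of_real (sqrt (2 * pi))"]
    by (simp only: normal_density_def power2_commute[of "0 - _" 0] diff_0 power2_minus diff_0_right)
  then show i: "integrable lborel (\<lambda>y. ?e y * f y)" by (rule Cauchy_Schwarz_L2(1)) (rule L)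
  fix z
  have ti: "integrable lborel (?t n)" for n by (rule L2_trunc_integrable[OF L(1)])
  have eq: "fourier (\<lambda>y. indicator {- real n..real n} y * (?e y * f y)) z
      = (LINT x|lborel. complex_of_real (std_normal_density (z - x)) * fourier (?t n) x)" for n
    using fourier_gaussian_mult[OF ti[of n], of z] by (simp add: mult_ac)
  have T: "(\<lambda>n. LINT x|lborel. complex_of_real (std_normal_density (z - x)) * fourier (?t n) x)
     \<longlonglongrightarrow> fourier (\<lambda>y. ?e y * f y) z"
    using fourier_trunc_tendsto[OF i, of z] unfolding eq .
  have lim: "L2_tendsto (\<lambda>n. fourier (?t n)) g sequentially" using h by (simp add: has_L2_fourier_def)
  let ?G = "\<lambda>x. complex_of_real (std_normal_density (z - x))"
  have "(\<lambda>n. LINT x|lborel. ?G x * fourier (?t n) x) \<longlonglongrightarrow> (LINT x|lborel. ?G x * g x)"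
  proof (rule LIM_zero_cancel, rule tendsto_norm_zero_cancel, rule tendsto_sandwich[OF _ _ tendsto_const])
    show "\<forall>\<^sub>F n in sequentially. norm ((LINT x|lborel. ?G x * fourier (?t n) x) - (LINT x|lborel. ?G x * g x))
        \<le> L2_norm ?G * L2_norm (\<lambda>x. fourier (?t n) x - g x)"
    proof -
      have "\<forall>\<^sub>F n in sequentially. L2 (\<lambda>x. fourier (?t n) x - g x)" using lim by (simp add: L2_tendsto_def)
      then show ?thesis
      proof eventually_elim
        case (elim n)
        have i2: "integrable lborel (\<lambda>x. ?G x * g x)" by (rule Cauchy_Schwarz_L2(1)[OF L2_gaussian L(2)])
        have i3: "integrable lborel (\<lambda>x. ?G x * (fourier (?t n) x - g x))"
          by (rule Cauchy_Schwarz_L2(1)[OF L2_gaussian elim])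
        have i1: "integrable lborel (\<lambda>x. ?G x * fourier (?t n) x)"
          using Bochner_Integration.integrable_add[OF i2 i3] by (simp add: algebra_simps)
        have "(LINT x|lborel. ?G x * fourier (?t n) x) - (LINT x|lborel. ?G x * g x)
          = (LINT x|lborel. ?G x * (fourier (?t n) x - g x))"
          by (subst Bochner_Integration.integral_diff[OF i1 i2, symmetric]) (simp only: ring_distribs)
        then have "norm ((LINT x|lborel. ?G x * fourier (?t n) x) - (LINT x|lborel. ?G x * g x))
          \<le> (LINT x|lborel. cmod (?G x * (fourier (?t n) x - g x)))"
          by (simp only: integral_norm_bound)
        also have "\<dots> \<le> L2_norm ?G * L2_norm (\<lambda>x. fourier (?t n) x - g x)"
          unfolding norm_mult by (rule Cauchy_Schwarz_L2(2)[OF L2_gaussian elim])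
        finally show ?case .
      qed
    qed
    have "(\<lambda>n. L2_norm ?G * L2_norm (\<lambda>x. fourier (?t n) x - g x)) \<longlonglongrightarrow> L2_norm ?G * 0"
      using lim by (intro tendsto_intros) (auto simp: L2_tendsto_def)
    then show "(\<lambda>n. L2_norm ?G * L2_norm (\<lambda>x. fourier (?t n) x - g x)) \<longlonglongrightarrow> 0" by simp
  qed auto
  from LIMSEQ_unique[OF T this]
  show "fourier (\<lambda>y. ?e y * f y) z = (LINT x|lborel. ?G x * g x)" .
qed

text \<open>
  For integrable \<open>f\<close> the transforms of the truncations converge pointwise by dominated
  convergence, and a subsequence of them converges almost everywhere to the $L^2$-limit.
\<close>

lemma has_L2_fourier_eq_fourier:
  assumes h: "has_L2_fourier f g" and f: "integrable lborel f"
  shows "AE x in lborel. g x = fourier f x"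
proof -
  let ?t = "\<lambda>n y. indicator {- real n..real n} y * f y :: complex"
  have lim: "L2_tendsto (\<lambda>n. fourier (?t n)) g sequentially" using h by (simp add: has_L2_fourier_def)
  then obtain N where N: "\<And>n. n \<ge> N \<Longrightarrow> L2 (\<lambda>x. fourier (?t n) x - g x)"
    by (auto simp: L2_tendsto_def eventually_sequentially)
  \<comment> \<open>The shift by \<open>N\<close> skips the indices for which the difference may fail to be in $L^2$.\<close>
  let ?u = "\<lambda>n x. (cmod (fourier (?t (n + N)) x - g x))\<^sup>2"
  have "(\<lambda>n. (L2_norm (\<lambda>x. fourier (?t (n + N)) x - g x))\<^sup>2) \<longlonglongrightarrow> 0\<^sup>2"
    using lim by (intro tendsto_power LIMSEQ_ignore_initial_segment[where k=N]) (auto simp: L2_tendsto_def)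
  then have "(\<lambda>n. LINT x|lborel. ?u n x) \<longlonglongrightarrow> 0"
    by (simp add: L2_norm_def integral_nonneg_AE)
  then have "(\<lambda>n. LINT x|lborel. norm (?u n x)) \<longlonglongrightarrow> 0" by simp
  moreover have "integrable lborel (?u n)" for n using N[of "n + N"] by (simp add: L2_def)
  ultimately obtain r where r: "strict_mono r" "AE x in lborel. (\<lambda>n. ?u (r n) x) \<longlonglongrightarrow> 0"
    using tendsto_L1_AE_subseq[of lborel ?u] by blast
  show ?thesis using r(2)
  proof eventually_elim
    case (elim x)
    have "(\<lambda>n. sqrt (?u (r n) x)) \<longlonglongrightarrow> sqrt 0" using elim by (rule tendsto_real_sqrt)
    then have "(\<lambda>n. cmod (fourier (?t (r n + N)) x - g x)) \<longlonglongrightarrow> 0" by simp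
    then have 1: "(\<lambda>n. fourier (?t (r n + N)) x) \<longlonglongrightarrow> g x"
      using tendsto_norm_zero_iff LIM_zero_cancel by blast
    have "filterlim (\<lambda>n. r n + N) at_top sequentially"
      using filterlim_compose[OF filterlim_add_const_nat_at_top filterlim_subseq[OF r(1)]] .
    from filterlim_compose[OF fourier_trunc_tendsto[OF f] this]
    have 2: "(\<lambda>n. fourier (?t (r n + N)) x) \<longlonglongrightarrow> fourier f x" .
    show ?case by (rule LIMSEQ_unique[OF 1 2])
  qed
qed

section \<open>Power weights\<close>

lemma powr_tail:
  fixes q T :: real
  assumes q: "q > 1" and T: "T > 0"
  shows "has_bochner_integral lborel (\<lambda>s. indicator {T..} s * s powr (- q)) (T powr (1 - q) / (q - 1))"
proof -
  let ?F = "\<lambda>x. x powr (1 - q) / (1 - q)"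
  have d: "(?F has_real_derivative x powr (- q)) (at x)" if "T < x" for x
  proof -
    have "(?F has_real_derivative ((1 - q) * x powr (1 - q - 1)) / (1 - q)) (at x)"
      using that T by (intro DERIV_cdivide has_real_derivative_powr) auto
    moreover have "((1 - q) * x powr (1 - q - 1)) / (1 - q) = x powr (- q)" using q by simp
    ultimately show ?thesis by simp
  qed
  have A: "((?F \<circ> real_of_ereal) \<longlongrightarrow> ?F T) (at_right (ereal T))"
    unfolding ereal_tendsto_simps using T q by (auto intro!: tendsto_intros)
  have "((\<lambda>x. x powr (1 - q) / (1 - q)) \<longlongrightarrow> 0 / (1 - q)) at_top"
    using q by (intro tendsto_intros tendsto_neg_powr filterlim_ident) auto
  then have B: "((?F \<circ> real_of_ereal) \<longlongrightarrow> 0) (at_left \<infinity>)"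
    unfolding ereal_tendsto_simps by simp
  have c: "isCont (\<lambda>x. x powr (- q)) x" if "T < x" for x
    using that T by (intro continuous_intros) auto
  have *: "set_integrable lborel (einterval T \<infinity>) (\<lambda>x. x powr (- q))"
    "(LBINT x=ereal T..\<infinity>. x powr (- q)) = 0 - ?F T"
    by (rule interval_integral_FTC_nonneg[where F="?F", OF _ _ _ _ A B]; use d c in auto)+
  have ei: "einterval (ereal T) \<infinity> = {T<..}" by (auto simp: einterval_def)
  have 1: "integrable lborel (\<lambda>s. indicator {T<..} s * s powr (- q))"
    using *(1) unfolding ei set_integrable_def by simp
  have 2: "(LINT s|lborel. indicator {T<..} s * s powr (- q)) = T powr (1 - q) / (q - 1)"
    using *(2) q unfolding ei interval_lebesgue_integral_def set_lebesgue_integral_def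
    by (simp add: minus_divide_right)
  have ae: "AE s in lborel. indicator {T<..} s * s powr (- q) = indicator {T..} s * s powr (- q)"
    using AE_lborel_singleton[of T] by eventually_elim (auto simp: indicator_def)
  have "has_bochner_integral lborel (\<lambda>s. indicator {T<..} s * s powr (- q)) (T powr (1 - q) / (q - 1))"
    using 1 2 by (simp add: has_bochner_integral_iff)
  then show ?thesis
    by (subst (asm) has_bochner_integral_cong_AE[OF _ _ ae]) auto
qed

lemma jap_props: "jap x > 0" "jap x \<ge> 1" "jap x \<ge> \<bar>x\<bar>" "(jap x)\<^sup>2 = 1 + x\<^sup>2"
proof -
  show "jap x > 0" unfolding jap_def by (simp add: add_pos_nonneg)
  show "jap x \<ge> 1" unfolding jap_def by simp
  show "jap x \<ge> \<bar>x\<bar>" unfolding jap_def by (rule real_le_rsqrt) simp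
  show "(jap x)\<^sup>2 = 1 + x\<^sup>2" unfolding jap_def by simp
qed

lemma jap_measurable [measurable]: "jap \<in> borel_measurable borel"
  unfolding jap_def[abs_def] by measurable

lemma integrable_jap_powr:
  assumes q: "q > 1"
  shows "integrable lborel (\<lambda>x. jap x powr (- q))"
proof (rule Bochner_Integration.integrable_bound)
  let ?h = "\<lambda>s. indicator {1..} s * s powr (- q) :: real"
  have i: "integrable lborel ?h" using powr_tail[OF q, of 1] by (auto simp: has_bochner_integral_iff)
  have j: "integrable lborel (\<lambda>x. ?h (- x))"
    using lborel_integrable_real_affine[OF i, of "-1" 0] by simp
  show "integrable lborel (\<lambda>x. indicator {-1..1} x + ?h x + ?h (- x))"
    by (intro Bochner_Integration.integrable_add i j) simp
  show "AE x in lborel. norm (jap x powr (- q)) \<le> norm (indicator {-1..1} x + ?h x + ?h (- x))"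
  proof (rule AE_I2)
    fix x :: real
    have m: "jap x powr (- q) \<le> y powr (- q)" if "0 < y" "y \<le> jap x" for y
      using that q by (intro powr_mono2') auto
    have "jap x powr (- q) \<le> 1" using m[of 1] jap_props[of x] by simp
    moreover have "jap x powr (- q) \<le> \<bar>x\<bar> powr (- q)" if "x \<noteq> 0"
      using m[of "\<bar>x\<bar>"] jap_props[of x] that by simp
    ultimately show "norm (jap x powr (- q)) \<le> norm (indicator {-1..1} x + ?h x + ?h (- x))"
      by (auto simp: indicator_def)
  qed
qed measurable

text \<open>
  The Cauchy--Schwarz inequality against \<open>jap\<close> to the power \<open>h - \<sigma>\<close>, which is in $L^2$ exactly
  under the stated condition.  The case \<open>h = 0\<close> gives integrable transforms, the case \<open>h > 0\<close>
  Hoelder continuity.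
\<close>

lemma weighted_L2_imp_L1:
  assumes g: "L2 (\<lambda>x. of_real (jap x powr \<sigma>) * g x)" and \<sigma>: "2 * (\<sigma> - h) > 1"
  shows "integrable lborel (\<lambda>x. of_real (jap x powr h) * g x)"
    and "(LINT x|lborel. cmod (of_real (jap x powr h) * g x))
      \<le> L2_norm (\<lambda>x. of_real (jap x powr (h - \<sigma>))) * L2_norm (\<lambda>x. of_real (jap x powr \<sigma>) * g x)"
proof -
  have "(\<lambda>x. (cmod (of_real (jap x powr (h - \<sigma>))))\<^sup>2) = (\<lambda>x. jap x powr (- (2 * (\<sigma> - h))))"
  proof
    fix x
    have "(jap x powr (h - \<sigma>))\<^sup>2 = jap x powr (h - \<sigma> + (h - \<sigma>))"
      unfolding powr_add power2_eq_square ..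
    also have "h - \<sigma> + (h - \<sigma>) = - (2 * (\<sigma> - h))" by simp
    finally show "(cmod (of_real (jap x powr (h - \<sigma>))))\<^sup>2 = jap x powr (- (2 * (\<sigma> - h)))"
      by simp
  qed
  then have w: "L2 (\<lambda>x. of_real (jap x powr (h - \<sigma>)))"
    unfolding L2_def using integrable_jap_powr[OF \<sigma>] by auto
  have eq: "of_real (jap x powr h) * g x = of_real (jap x powr (h - \<sigma>)) * (of_real (jap x powr \<sigma>) * g x)" for x
  proof -
    have "jap x powr h = jap x powr (h - \<sigma>) * jap x powr \<sigma>"
      by (simp flip: powr_add)
    then show ?thesis by simp
  qed
  show "integrable lborel (\<lambda>x. of_real (jap x powr h) * g x)"
    unfolding eq by (rule Cauchy_Schwarz_L2(1)[OF w g])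
  show "(LINT x|lborel. cmod (of_real (jap x powr h) * g x))
      \<le> L2_norm (\<lambda>x. of_real (jap x powr (h - \<sigma>))) * L2_norm (\<lambda>x. of_real (jap x powr \<sigma>) * g x)"
    unfolding eq norm_mult[of "of_real (jap _ powr (h - \<sigma>))"] by (rule Cauchy_Schwarz_L2(2)[OF w g])
qed

section \<open>The Wiener algebra\<close>

text \<open>
  The next two definitions are quantitative forms of membership in the Wiener algebra.  They
  differ in that \<open>wiener_bound\<close> does not ask for integrability of the function itself; in a product
  it suffices that one factor is integrable.
\<close>

definition fourier_L1_bound :: "(real \<Rightarrow> complex) \<Rightarrow> real \<Rightarrow> bool" where
  "fourier_L1_bound f B \<longleftrightarrow> integrable lborel f \<and> integrable lborel (fourier f) \<and>
     (LINT z|lborel. cmod (fourier f z)) \<le> B"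

definition wiener_bound :: "(real \<Rightarrow> complex) \<Rightarrow> real \<Rightarrow> bool" where
  "wiener_bound h B \<longleftrightarrow> h \<in> borel_measurable borel \<and>
     (\<exists>H. integrable lborel H \<and> (AE y in lborel. h y = inv_fourier H y) \<and> (LINT z|lborel. cmod (H z)) \<le> B)"

lemma fourier_L1_imp_wiener: "fourier_L1_bound f B \<Longrightarrow> wiener_bound f B"
  unfolding fourier_L1_bound_def wiener_bound_def using fourier_inversion_L1[of f] by auto

lemma wiener_bound_AE:
  assumes "wiener_bound h B" shows "AE y in lborel. cmod (h y) \<le> B / (2 * pi)"
proof -
  obtain H where H: "AE y in lborel. h y = inv_fourier H y" "(LINT z|lborel. cmod (H z)) \<le> B"
    using assms by (auto simp: wiener_bound_def)
  show ?thesis using H(1)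
  proof eventually_elim
    case (elim y)
    have "cmod (h y) \<le> (LINT z|lborel. cmod (H z)) / (2 * pi)"
      unfolding elim by (rule cmod_inv_fourier_le)
    also have "\<dots> \<le> B / (2 * pi)" by (intro divide_right_mono H) simp
    finally show ?case .
  qed
qed

lemma wiener_bound_nonneg: "wiener_bound h B \<Longrightarrow> B \<ge> 0"
proof -
  assume "wiener_bound h B"
  then obtain H :: "real \<Rightarrow> complex" where H: "(LINT z|lborel. cmod (H z)) \<le> B" by (auto simp: wiener_bound_def)
  have "0 \<le> (LINT z|lborel. cmod (H z))" by (rule integral_nonneg_AE) simp
  also note H
  finally show "B \<ge> 0" .
qed

lemma wiener_bound_cnj:
  assumes "wiener_bound h B" shows "wiener_bound (\<lambda>y. cnj (h y)) B"
proof -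
  obtain H where h: "h \<in> borel_measurable borel" and H: "integrable lborel H"
     "AE y in lborel. h y = inv_fourier H y" "(LINT z|lborel. cmod (H z)) \<le> B"
    using assms by (auto simp: wiener_bound_def)
  let ?K = "\<lambda>x. cnj (H (- x))"
  have i: "integrable lborel (\<lambda>x. H (- x))"
    using lborel_integrable_real_affine[OF H(1), of "-1" 0] by simp
  have "inv_fourier ?K y = cnj (inv_fourier H y)" for y
  proof -
    have "(LINT x|lborel. iexp (x * y) * ?K x) = (LINT x|lborel. iexp (- x * y) * ?K (- x))"
      by (subst lborel_integral_real_affine[where c="-1" and t=0]) simp_all
    also have "\<dots> = cnj (LINT x|lborel. iexp (x * y) * H x)"
      by (simp add: exp_cnj flip: Bochner_Integration.integral_cnj)
    finally show ?thesis by (simp add: inv_fourier_def)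
  qed
  then have "AE y in lborel. cnj (h y) = inv_fourier ?K y" using H(2) by auto
  moreover have "(LINT z|lborel. cmod (?K z)) = (LINT z|lborel. cmod (H z))"
    by (subst (2) lborel_integral_real_affine[where c="-1" and t=0]) simp_all
  ultimately show ?thesis
    using i H(3) unfolding wiener_bound_def
    by (intro conjI exI[of _ ?K] measurable_compose[OF h] borel_measurable_continuous_onI continuous_intros) auto
qed

lemma wiener_bound_shift:
  assumes "wiener_bound h B" shows "wiener_bound (\<lambda>y. h (y + c)) B"
proof -
  obtain H where h[measurable]: "h \<in> borel_measurable borel" and H: "integrable lborel H"
     "AE y in lborel. h y = inv_fourier H y" "(LINT z|lborel. cmod (H z)) \<le> B"
    using assms by (auto simp: wiener_bound_def)
  note inv_fourier_measurable[OF H(1), measurable]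
  let ?K = "\<lambda>x. iexp (c * x) * H x"
  have "inv_fourier ?K y = inv_fourier H (y + c)" for y
    unfolding inv_fourier_def by (simp add: algebra_simps exp_add)
  moreover have "AE y in lborel. h (c + 1 * y) = inv_fourier H (c + 1 * y)"
    by (rule AE_borel_affine) (use H(2) in auto)
  ultimately have "AE y in lborel. h (y + c) = inv_fourier ?K y" by (simp add: add.commute)
  then show ?thesis
    using integrable_iexp_mult[OF H(1), of "\<lambda>x. c * x"] H(3) unfolding wiener_bound_def
    by (intro conjI exI[of _ ?K]) (auto simp: norm_mult)
qed

text \<open>
  The transform of the product is the convolution of \<open>H\<close> with the transform of \<open>g\<close>, divided by
  \<open>2 * pi\<close>; its $L^1$-norm is estimated by Tonelli's theorem.
\<close>

lemma fourier_L1_bound_mult: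
  assumes h: "wiener_bound h B" and g: "fourier_L1_bound g N"
  shows "fourier_L1_bound (\<lambda>y. h y * g y) (B * N / (2 * pi))"
proof -
  obtain H where [measurable]: "h \<in> borel_measurable borel" and H: "integrable lborel H"
     "AE y in lborel. h y = inv_fourier H y" "(LINT z|lborel. cmod (H z)) \<le> B"
    using h by (auto simp: wiener_bound_def)
  have G: "integrable lborel g" "integrable lborel (fourier g)" "(LINT z|lborel. cmod (fourier g z)) \<le> N"
    using g by (auto simp: fourier_L1_bound_def)
  have [measurable]: "H \<in> borel_measurable borel" "g \<in> borel_measurable borel"
    "fourier g \<in> borel_measurable borel" "inv_fourier H \<in> borel_measurable borel"
    using H G inv_fourier_measurable[OF H(1)] by auto
  have B: "B \<ge> 0" using wiener_bound_nonneg[OF h] .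
  have ae: "AE y in lborel. cmod (h y) \<le> B / (2 * pi)" by (rule wiener_bound_AE[OF h])
  have i: "integrable lborel (\<lambda>y. h y * g y)"
  proof (rule Bochner_Integration.integrable_bound[OF integrable_mult_right[OF G(1), of "of_real (B / (2 * pi))"]])
    show "AE x in lborel. cmod (h x * g x) \<le> cmod (complex_of_real (B / (2 * pi)) * g x)"
      using ae
    proof eventually_elim
      case (elim y)
      have "cmod (h y) * cmod (g y) \<le> B / (2 * pi) * cmod (g y)" by (intro mult_right_mono elim) simp
      then show ?case using B by (simp only: norm_mult norm_of_real) simp
    qed
  qed measurable
  have eq: "fourier (\<lambda>y. h y * g y) z = (LINT x|lborel. H x * fourier g (z - x)) / of_real (2 * pi)" for z
  proof -
    let ?k = "\<lambda>p::real\<times>real. iexp (fst p * snd p - z * snd p)"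
    have "fourier (\<lambda>y. h y * g y) z = fourier (\<lambda>y. inv_fourier H y * g y) z"
      by (rule fourier_cong_AE) (use H(2) in \<open>auto elim!: eventually_mono\<close>)
    also have "\<dots> = (LINT y|lborel. (LINT x|lborel. ?k (x, y) * H x * g y) / of_real (2 * pi))"
      unfolding fourier_def
    proof (intro Bochner_Integration.integral_cong refl)
      fix y
      have "iexp (- (z * y)) * (LINT x|lborel. iexp (x * y) * H x) * g y
         = (LINT x|lborel. ?k (x, y) * H x * g y)"
      proof -
        have "?k (x, y) * H x * g y = (iexp (- (z * y)) * (iexp (x * y) * H x)) * g y" for x
          by (simp add: algebra_simps exp_diff exp_minus divide_inverse)
        then show ?thesis by (simp only: integral_mult_left_zero integral_mult_right_zero)
      qed
      then show "iexp (- (z * y)) * (inv_fourier H y * g y) = (LINT x|lborel. ?k (x, y) * H x * g y) / of_real (2 * pi)"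
        by (simp add: inv_fourier_def)
    qed
    also have "\<dots> = (LINT y|lborel. LINT x|lborel. ?k (x, y) * H x * g y) / of_real (2 * pi)"
      by (rule integral_divide_zero)
    also have "(LINT y|lborel. LINT x|lborel. ?k (x, y) * H x * g y) = (LINT x|lborel. LINT y|lborel. ?k (x, y) * H x * g y)"
      by (rule swap_kernel[where B=1, OF H(1) G(1)]) simp_all
    also have "(\<lambda>x. LINT y|lborel. ?k (x, y) * H x * g y) = (\<lambda>x. H x * fourier g (z - x))"
    proof
      fix x
      have "?k (x, y) * H x * g y = H x * (iexp (- ((z - x) * y)) * g y)" for y
        by (simp add: algebra_simps)
      then show "(LINT y|lborel. ?k (x, y) * H x * g y) = H x * fourier g (z - x)"
        unfolding fourier_def by (simp only: integral_mult_right_zero)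
    qed
    finally show ?thesis .
  qed
  let ?F = "\<lambda>x z. H x * fourier g (z - x)"
  have sh: "(LINT z|lborel. cmod (fourier g (z - x))) = (LINT z|lborel. cmod (fourier g z))" for x
    using lborel_integral_real_affine[of 1 "\<lambda>z. cmod (fourier g z)" "-x"] by simp
  have shi: "integrable lborel (\<lambda>z. fourier g (z - x))" for x
    using lborel_integrable_real_affine[OF G(2), of 1 "-x"] by simp
  have int: "integrable (lborel \<Otimes>\<^sub>M lborel) (case_prod ?F)"
  proof (rule lborel_pair.Fubini_integrable)
    show "integrable lborel (\<lambda>x. LINT z|lborel. norm (case_prod ?F (x, z)))"
      using H(1) by (simp add: norm_mult sh)
    show "AE x in lborel. integrable lborel (\<lambda>z. case_prod ?F (x, z))" using shi by simp
  qed measurable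
  have i2: "integrable lborel (\<lambda>z. LINT x|lborel. ?F x z)" by (rule lborel_pair.integrable_snd[OF int])
  then have i3: "integrable lborel (fourier (\<lambda>y. h y * g y))" unfolding eq by simp
  have intn: "integrable (lborel \<Otimes>\<^sub>M lborel) (case_prod (\<lambda>x z. cmod (?F x z)))"
    using integrable_norm[OF int] by (simp add: case_prod_unfold)
  have "(LINT z|lborel. cmod (LINT x|lborel. ?F x z)) \<le> (LINT z|lborel. LINT x|lborel. cmod (?F x z))"
    by (intro integral_mono integrable_norm i2 lborel_pair.integrable_snd[OF intn] integral_norm_bound)
  also have "\<dots> = (LINT x|lborel. LINT z|lborel. cmod (?F x z))"
    by (rule lborel_pair.Fubini_integral[OF intn])
  also have "\<dots> = (LINT x|lborel. cmod (H x)) * (LINT z|lborel. cmod (fourier g z))"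
    by (simp add: norm_mult sh)
  also have "\<dots> \<le> B * N"
    by (intro mult_mono H G B integral_nonneg_AE) auto
  finally have "(LINT z|lborel. cmod (fourier (\<lambda>y. h y * g y) z)) \<le> B * N / (2 * pi)"
    unfolding eq by (simp add: norm_divide divide_right_mono)
  then show ?thesis unfolding fourier_L1_bound_def using i i3 by simp
qed

section \<open>The weighted Sobolev space and the potential\<close>

lemma Sigma_imp_L1:
  assumes "Sigma_space f" shows "integrable lborel f"
proof -
  have L: "L2 f" "L2 (\<lambda>x. of_real x * f x)" using assms by (auto simp: Sigma_space_def Hs_def has_L2_fourier_def)
  then have [measurable]: "f \<in> borel_measurable borel" by (auto simp: L2_def)
  have "L2 (\<lambda>x. of_real (jap x powr 1) * f x)"
    unfolding L2_def
  proof
    have eq: "(cmod (of_real (jap x powr 1) * f x))\<^sup>2 = (cmod (f x))\<^sup>2 + (cmod (of_real x * f x))\<^sup>2" for x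
      using jap_props[of x] by (simp add: norm_mult power_mult_distrib algebra_simps)
    show "integrable lborel (\<lambda>x. (cmod (of_real (jap x powr 1) * f x))\<^sup>2)"
      unfolding eq using L by (auto simp: L2_def)
  qed measurable
  from weighted_L2_imp_L1(1)[OF this, of 0] show ?thesis using jap_props(1) by (simp add: less_imp_neq[symmetric])
qed

text \<open>
  The weight \<open>1 / jap\<close> is in $L^2$, so the $H^1$-norm controls the $L^1$-norm of the transform.
  Together with inversion this also bounds the supremum of a function in
  \<open>Sigma_space\<close>.
\<close>

lemma Sigma_fourier_L1_bound:
  "\<exists>K>0. \<forall>f. Sigma_space f \<longrightarrow> fourier_L1_bound f (K * Hs_norm 1 f)"
proof -
  define K where "K = (1 + L2_norm (\<lambda>x. of_real (jap x powr (0 - 1)))) * sqrt (2 * pi)"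
  have K: "K > 0" unfolding K_def by (intro mult_pos_pos add_pos_nonneg) auto
  have "fourier_L1_bound f (K * Hs_norm 1 f)" if f: "Sigma_space f" for f
  proof -
    have i: "integrable lborel f" by (rule Sigma_imp_L1[OF f])
    obtain g where g: "has_L2_fourier f g" "L2 (\<lambda>\<zeta>. of_real (jap \<zeta> powr 1) * g \<zeta>)"
      using f by (auto simp: Sigma_space_def Hs_def)
    have G: "has_L2_fourier f (L2_fourier f)"
      unfolding L2_fourier_def by (rule someI[of "has_L2_fourier f", OF g(1)])
    have [measurable]: "fourier f \<in> borel_measurable borel" by (rule fourier_measurable[OF i])
    have [measurable]: "g \<in> borel_measurable borel" "L2_fourier f \<in> borel_measurable borel"
      using g(1) G by (auto simp: has_L2_fourier_def L2_def)
    have ae: "AE x in lborel. L2_fourier f x = fourier f x" "AE x in lborel. g x = fourier f x"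
      by (rule has_L2_fourier_eq_fourier[OF G i] has_L2_fourier_eq_fourier[OF g(1) i])+
    let ?F = "\<lambda>x. of_real (jap x powr 1) * fourier f x"
    have "integrable lborel (\<lambda>x. (cmod (?F x))\<^sup>2) \<longleftrightarrow>
          integrable lborel (\<lambda>x. (cmod (of_real (jap x powr 1) * g x))\<^sup>2)"
      by (rule Bochner_Integration.integrable_cong_AE; (measurable)?) (use ae(2) in eventually_elim, simp)
    then have L: "L2 ?F" using g(2) by (auto simp: L2_def)
    have n: "L2_norm ?F = L2_norm (\<lambda>x. of_real (jap x powr 1) * L2_fourier f x)"
      unfolding L2_norm_def
      by (intro arg_cong[where f=sqrt] integral_cong_AE; (measurable)?) (use ae(1) in eventually_elim, simp)
    have "(LINT x|lborel. cmod (of_real (jap x powr 0) * fourier f x))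
      \<le> L2_norm (\<lambda>x. of_real (jap x powr (0 - 1))) * L2_norm ?F"
      by (rule weighted_L2_imp_L1(2)[OF L]) simp
    also have "\<dots> \<le> (1 + L2_norm (\<lambda>x. of_real (jap x powr (0 - 1)))) * L2_norm ?F"
      by (intro mult_right_mono) auto
    also have "\<dots> = K * Hs_norm 1 f"
      unfolding n K_def Hs_norm_def by simp
    finally have "(LINT x|lborel. cmod (fourier f x)) \<le> K * Hs_norm 1 f"
      using jap_props(1) by (simp add: less_imp_neq[symmetric])
    moreover have "integrable lborel (fourier f)"
      using weighted_L2_imp_L1(1)[OF L, of 0] jap_props(1) by (simp add: less_imp_neq[symmetric])
    ultimately show ?thesis using i by (simp add: fourier_L1_bound_def)
  qed
  then show ?thesis using K by blast
qed

lemma Sigma_diff: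
  assumes f: "Sigma_space f" and g: "Sigma_space g"
  shows "Sigma_space (\<lambda>x. f x - g x)"
proof -
  obtain f' where f': "has_L2_fourier f f'" "L2 (\<lambda>\<zeta>. of_real (jap \<zeta> powr 1) * f' \<zeta>)"
    using f by (auto simp: Sigma_space_def Hs_def)
  obtain g' where g': "has_L2_fourier g g'" "L2 (\<lambda>\<zeta>. of_real (jap \<zeta> powr 1) * g' \<zeta>)"
    using g by (auto simp: Sigma_space_def Hs_def)
  have "L2 (\<lambda>\<zeta>. of_real (jap \<zeta> powr 1) * (f' \<zeta> - g' \<zeta>))"
    using L2_diff[OF f'(2) g'(2)] by (simp only: right_diff_distrib)
  moreover have "L2 (\<lambda>x. of_real x * (f x - g x))"
    using f g unfolding right_diff_distrib by (intro L2_diff) (auto simp: Sigma_space_def)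
  ultimately show ?thesis
    using has_L2_fourier_diff[OF f'(1) g'(1)] by (auto simp: Sigma_space_def Hs_def)
qed

lemma integral_indicator_add:
  fixes k :: "real \<Rightarrow> real"
  assumes "integrable lborel k"
  shows "integrable lborel (\<lambda>x. indicator {-1..1} x * M + 2 * k x)"
    and "(LINT x|lborel. indicator {-1..1} x * M + 2 * k x) = 2 * M + 2 * (LINT x|lborel. k x)"
proof -
  have i: "integrable lborel (\<lambda>x::real. indicator {-1..1} x * M)" "integrable lborel (\<lambda>x. 2 * k x)"
    using assms by auto
  show "integrable lborel (\<lambda>x. indicator {-1..1} x * M + 2 * k x)"
    by (rule Bochner_Integration.integrable_add[OF i])
  show "(LINT x|lborel. indicator {-1..1} x * M + 2 * k x) = 2 * M + 2 * (LINT x|lborel. k x)"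
    by (subst Bochner_Integration.integral_add[OF i]) simp
qed

text \<open>
  Near the origin the function is controlled by its supremum, which the $H^1$-norm bounds; away
  from the origin the weight \<open>x\<close> is used.
\<close>

lemma Sigma_L1_norm_le:
  "\<exists>K>0. \<forall>f. Sigma_space f \<longrightarrow> (LINT x|lborel. cmod (f x)) \<le> K * Sigma_norm f"
proof -
  obtain K where K: "K > 0" "\<And>f. Sigma_space f \<Longrightarrow> fourier_L1_bound f (K * Hs_norm 1 f)"
    using Sigma_fourier_L1_bound by blast
  let ?j = "\<lambda>x. complex_of_real (1 / jap x)"
  have cj: "cmod (?j x) = 1 / jap x" for x
    using jap_props(1)[of x] by (simp only: norm_of_real) simp
  have j2: "(cmod (?j x))\<^sup>2 = jap x powr (- 2)" for x
    unfolding cj using jap_props(1)[of x] by (simp add: powr_minus powr_numeral power_inverse divide_inverse)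
  have j: "L2 ?j" unfolding L2_def j2 using integrable_jap_powr[of 2] by auto
  define K' where "K' = K / pi + 2 * L2_norm ?j"
  have "(LINT x|lborel. cmod (f x)) \<le> K' * Sigma_norm f" if f: "Sigma_space f" for f
  proof -
    have i: "integrable lborel f" by (rule Sigma_imp_L1[OF f])
    have L: "L2 (\<lambda>x. of_real x * f x)" using f by (simp add: Sigma_space_def)
    let ?M = "K * Hs_norm 1 f / (2 * pi)"
    have M: "AE x in lborel. cmod (f x) \<le> ?M"
      by (intro wiener_bound_AE fourier_L1_imp_wiener K f)
    have k: "integrable lborel (\<lambda>x. cmod (?j x) * cmod (of_real x * f x))"
      using integrable_norm[OF Cauchy_Schwarz_L2(1)[OF j L]] by (simp only: norm_mult)
    have "(LINT x|lborel. cmod (f x)) \<le> (LINT x|lborel. indicator {-1..1} x * ?M + 2 * (cmod (?j x) * cmod (of_real x * f x)))"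
    proof (rule integral_mono_AE)
      show "integrable lborel (\<lambda>x. cmod (f x))" using i by simp
      show "integrable lborel (\<lambda>x. indicator {-1..1} x * ?M + 2 * (cmod (?j x) * cmod (of_real x * f x)))"
        by (rule integral_indicator_add(1)[OF k])
      show "AE x in lborel. cmod (f x) \<le> indicator {-1..1} x * ?M + 2 * (cmod (?j x) * cmod (of_real x * f x))"
        using M
      proof eventually_elim
        case (elim x)
        show ?case
        proof (cases "x \<in> {-1..1}")
          case True
          then show ?thesis using elim by (simp add: add_increasing2)
        next
          case False
          then have x: "\<bar>x\<bar> \<ge> 1" by auto
          \<comment> \<open>Outside of \<open>[-1, 1]\<close> this bounds \<open>|f|\<close> by \<open>2 |x f| / jap\<close>.\<close>
          have "jap x \<le> 2 * \<bar>x\<bar>"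
          proof (rule power2_le_imp_le)
            have "1 \<le> \<bar>x\<bar>\<^sup>2" using x by (rule one_le_power)
            then show "(jap x)\<^sup>2 \<le> (2 * \<bar>x\<bar>)\<^sup>2" using jap_props(4)[of x] by (simp add: power_mult_distrib)
          qed simp
          then have "1 \<le> 2 * (1 / jap x * \<bar>x\<bar>)"
            using jap_props(1)[of x] by (simp add: field_simps)
          then have "1 * cmod (f x) \<le> 2 * (1 / jap x * \<bar>x\<bar>) * cmod (f x)"
            by (intro mult_right_mono) auto
          moreover have "indicator {-1..1} x * ?M = 0" using False by simp
          ultimately show ?thesis unfolding norm_mult cj unfolding norm_of_real by (simp only: mult_ac add_0_left mult_1_left)
        qed
      qed
    qed
    also have "\<dots> = 2 * ?M + 2 * (LINT x|lborel. cmod (?j x) * cmod (of_real x * f x))"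
      by (rule integral_indicator_add(2)[OF k])
    also have "\<dots> \<le> 2 * ?M + 2 * (L2_norm ?j * L2_norm (\<lambda>x. of_real x * f x))"
      by (intro add_left_mono mult_left_mono Cauchy_Schwarz_L2(2)[OF j L]) simp
    also have "\<dots> = K / pi * Hs_norm 1 f + 2 * L2_norm ?j * L2_norm (\<lambda>x. of_real x * f x)" by simp
    also have "\<dots> \<le> K' * Hs_norm 1 f + K' * L2_norm (\<lambda>x. of_real x * f x)"
      unfolding K'_def using K by (intro add_mono mult_right_mono) (auto simp: Hs_norm_def)
    finally show ?thesis by (simp add: Sigma_norm_def distrib_left)
  qed
  moreover have "K' > 0" unfolding K'_def using K by (intro add_pos_nonneg) auto
  ultimately show ?thesis by blast
qed

text \<open>
  The derivative of \<open>e\<close> to \<open>-\<i>zy\<close> times \<open>f(y)\<close> integrates to zero over the line, because \<open>f\<close> vanishes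
  at both ends.
\<close>

lemma fourier_vector_derivative:
  fixes f f' :: "real \<Rightarrow> complex"
  assumes d: "\<And>x. (f has_vector_derivative f' x) (at x)" and c: "continuous_on UNIV f'"
    and i: "integrable lborel f" "integrable lborel f'"
    and l: "(f \<longlongrightarrow> 0) at_top" "(f \<longlongrightarrow> 0) at_bot"
  shows "fourier f' z = \<i> * of_real z * fourier f z"
proof -
  let ?F = "\<lambda>y. iexp (- (z * y)) * f y"
  let ?G = "\<lambda>y. iexp (- (z * y)) * f' y - \<i> * of_real z * (iexp (- (z * y)) * f y)"
  have j: "integrable lborel (\<lambda>y. iexp (- (z * y)) * f' y)" "integrable lborel (\<lambda>y. iexp (- (z * y)) * f y)"
    by (intro integrable_iexp_mult i; simp)+
  have F: "(?F has_vector_derivative ?G x) (at x)" for x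
  proof -
    let ?A = "- (\<i> * complex_of_real z)"
    have e: "iexp (- (z * y)) = exp (y *\<^sub>R ?A)" for y by (simp add: scaleR_conv_of_real mult_ac)
    have "((\<lambda>y. exp (y *\<^sub>R ?A) * f y) has_vector_derivative
       exp (x *\<^sub>R ?A) * f' x + exp (x *\<^sub>R ?A) * ?A * f x) (at x)"
      by (intro has_vector_derivative_mult exp_scaleR_has_vector_derivative_right d)
    moreover have "exp (x *\<^sub>R ?A) * f' x + exp (x *\<^sub>R ?A) * ?A * f x = ?G x"
      unfolding e by (simp add: algebra_simps)
    ultimately have "((\<lambda>y. exp (y *\<^sub>R ?A) * f y) has_vector_derivative ?G x) (at x)"
      by (rule has_vector_derivative_eq_rhs)
    then show ?thesis by (simp only: e)
  qed
  have fc: "isCont f x" for x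
    using d[of x] by (rule has_vector_derivative_continuous)
  have cG: "isCont ?G x" for x
    using c fc by (intro continuous_intros) (auto simp: continuous_on_eq_continuous_at)
  have nz: "((\<lambda>y. iexp (- (z * y)) * f y) \<longlongrightarrow> 0) F" if "(f \<longlongrightarrow> 0) F" for F
  proof (rule tendsto_norm_zero_cancel)
    show "((\<lambda>y. norm (iexp (- (z * y)) * f y)) \<longlongrightarrow> 0) F"
      using tendsto_norm_zero[OF that] by (simp add: norm_mult)
  qed
  have si: "set_integrable lborel (einterval (-\<infinity>) \<infinity>) ?G"
    unfolding set_integrable_def
    using Bochner_Integration.integrable_diff[OF j(1) integrable_mult_right[OF j(2), of "\<i> * of_real z"]]
    by simp
  have "(LBINT x=-\<infinity>..\<infinity>. ?G x) = 0 - 0"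
  proof (rule interval_integral_FTC_integrable[where F="?F"])
    show "((?F \<circ> real_of_ereal) \<longlongrightarrow> 0) (at_right (- \<infinity>))"
      unfolding ereal_tendsto_simps by (rule nz[OF l(2)])
    show "((?F \<circ> real_of_ereal) \<longlongrightarrow> 0) (at_left \<infinity>)"
      unfolding ereal_tendsto_simps by (rule nz[OF l(1)])
  qed (use F cG si in auto)
  then have "(LINT x|lborel. ?G x) = 0"
    by (simp add: interval_lebesgue_integral_def set_lebesgue_integral_def)
  moreover have "(LINT x|lborel. ?G x) = fourier f' z - \<i> * of_real z * fourier f z"
    unfolding fourier_def
    by (subst Bochner_Integration.integral_diff[OF j(1) integrable_mult_right[OF j(2)]])
       (simp only: integral_mult_right_zero)
  ultimately show ?thesis by simp
qed

lemma jap_powr_tendsto_0: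
  assumes "q > 0"
  shows "((\<lambda>x. jap x powr (- q)) \<longlongrightarrow> 0) at_top" "((\<lambda>x. jap x powr (- q)) \<longlongrightarrow> 0) at_bot"
proof -
  have 1: "filterlim jap at_top at_top"
    by (rule filterlim_at_top_mono[OF filterlim_ident])
       (intro always_eventually allI order_trans[OF abs_ge_self jap_props(3)])
  have 2: "filterlim jap at_top at_bot"
    by (rule filterlim_at_top_mono[OF filterlim_uminus_at_top_at_bot])
       (intro always_eventually allI order_trans[OF abs_ge_minus_self jap_props(3)])
  show "((\<lambda>x. jap x powr (- q)) \<longlongrightarrow> 0) at_top" "((\<lambda>x. jap x powr (- q)) \<longlongrightarrow> 0) at_bot"
    by (rule tendsto_neg_powr[OF _ 1] tendsto_neg_powr[OF _ 2]; use assms in simp)+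
qed

text \<open>
  The transforms of \<open>W\<close> and of its second derivative are bounded, so the transform of \<open>W\<close> decays
  quadratically.
\<close>

lemma potential_wiener_bound:
  assumes W: "potential W"
  shows "\<exists>B. wiener_bound (\<lambda>y. of_real (W y)) B"
proof -
  obtain p C where p: "p > 2" and C: "\<And>j x. \<bar>(deriv ^^ j) W x\<bar> \<le> C j * jap x powr (- p - real j)"
     "\<And>j. C j > 0"
    and sm: "smooth W" using W by (auto simp: potential_def)
  let ?D = "\<lambda>j x. complex_of_real ((deriv ^^ j) W x)"
  have d: "(?D j has_vector_derivative ?D (Suc j) x) (at x)" for j x
  proof -
    have "((deriv ^^ j) W has_real_derivative deriv ((deriv ^^ j) W) x) (at x)"
      using sm unfolding smooth_def by (simp add: DERIV_deriv_iff_real_differentiable)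
    then have "((deriv ^^ j) W has_vector_derivative (deriv ^^ Suc j) W x) (at x)"
      by (simp add: has_real_derivative_iff_has_vector_derivative)
    from bounded_linear.has_vector_derivative[OF bounded_linear_of_real this] show ?thesis .
  qed
  have c: "continuous_on UNIV (?D j)" for j
    using has_vector_derivative_continuous[OF d] unfolding continuous_on_eq_continuous_at[OF open_UNIV] by blast
  then have m: "?D j \<in> borel_measurable borel" for j by (rule borel_measurable_continuous_onI)
  have bd: "cmod (?D j x) \<le> C j * jap x powr (- (p + real j))" for j x
    using C(1)[of j x] by (simp add: minus_diff_commute)
  have i: "integrable lborel (?D j)" for j
  proof (rule Bochner_Integration.integrable_bound)
    show "integrable lborel (\<lambda>x. C j * jap x powr (- (p + real j)))"
      using p by (intro integrable_mult_right integrable_jap_powr) auto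
    show "AE x in lborel. cmod (?D j x) \<le> norm (C j * jap x powr (- (p + real j)))"
      by (intro AE_I2 order_trans[OF bd]) simp
  qed (use m in simp)
  have l: "(?D j \<longlongrightarrow> 0) F" if "((\<lambda>x. jap x powr (- (p + real j))) \<longlongrightarrow> 0) F" for j F
  proof (rule Lim_null_comparison)
    show "\<forall>\<^sub>F x in F. cmod (?D j x) \<le> C j * jap x powr (- (p + real j))"
      using bd by (intro always_eventually) auto
    show "((\<lambda>x. C j * jap x powr (- (p + real j))) \<longlongrightarrow> 0) F"
      using tendsto_mult_right_zero[OF that] by simp
  qed
  have F: "fourier (?D (Suc j)) z = \<i> * of_real z * fourier (?D j) z" for j z
    by (rule fourier_vector_derivative[OF d c i i]; rule l, rule jap_powr_tendsto_0; use p in simp)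
  define M where "M = (LINT x|lborel. cmod (?D 0 x)) + (LINT x|lborel. cmod (?D 2 x))"
  have "integrable lborel (fourier (?D 0))"
  proof (rule Bochner_Integration.integrable_bound)
    show "integrable lborel (\<lambda>z. M * jap z powr (- 2))"
      by (intro integrable_mult_right integrable_jap_powr) auto
    show "fourier (?D 0) \<in> borel_measurable lborel" using fourier_measurable[OF i[of 0]] by simp
    show "AE z in lborel. cmod (fourier (?D 0) z) \<le> norm (M * jap z powr (- 2))"
    proof (rule AE_I2)
      fix z :: real
      have "fourier (?D 2) z = - (of_real (z\<^sup>2) * fourier (?D 0) z)"
      proof -
        have ii: "\<i> * a * (\<i> * a * w) = - (a * a * w)" for a w :: complex
        proof -
          have "\<i> * a * (\<i> * a * w) = (\<i> * \<i>) * (a * a * w)" by (simp only: mult_ac)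
          then show ?thesis by simp
        qed
        have "fourier (?D 2) z = \<i> * of_real z * (\<i> * of_real z * fourier (?D 0) z)"
          using F[of 1 z] F[of 0 z] by (simp add: numeral_2_eq_2)
        then show ?thesis unfolding ii by (simp add: power2_eq_square)
      qed
      then have "z\<^sup>2 * cmod (fourier (?D 0) z) = cmod (fourier (?D 2) z)" by (simp add: norm_mult norm_power)
      also have "\<dots> \<le> (LINT x|lborel. cmod (?D 2 x))" by (rule cmod_fourier_le)
      finally have "(jap z)\<^sup>2 * cmod (fourier (?D 0) z) \<le> M"
        using cmod_fourier_le[of "?D 0" z] jap_props(4)[of z] by (simp add: M_def algebra_simps)
      then have "cmod (fourier (?D 0) z) \<le> M / (jap z)\<^sup>2"
        using jap_props(1)[of z] by (simp add: pos_le_divide_eq mult.commute)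
      also have "\<dots> = M * jap z powr (- 2)"
        using jap_props(1)[of z] by (simp add: powr_minus divide_inverse powr_numeral)
      finally have "cmod (fourier (?D 0) z) \<le> M * jap z powr (- 2)" .
      then show "cmod (fourier (?D 0) z) \<le> norm (M * jap z powr (- 2))" by (rule order_trans) simp
    qed
  qed
  then have "fourier_L1_bound (?D 0) (LINT z|lborel. cmod (fourier (?D 0) z))"
    unfolding fourier_L1_bound_def using i[of 0] by auto
  then have "wiener_bound (?D 0) (LINT z|lborel. cmod (fourier (?D 0) z))" by (rule fourier_L1_imp_wiener)
  then show ?thesis by auto
qed

section \<open>Curves with integrable transforms\<close>

lemma fourier_L1_bound_mono: "fourier_L1_bound f B \<Longrightarrow> B \<le> B' \<Longrightarrow> fourier_L1_bound f B'"
  by (auto simp: fourier_L1_bound_def)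

lemma fourier_L1_bound_lincomb:
  assumes f: "fourier_L1_bound f A" and g: "fourier_L1_bound g B"
  shows "fourier_L1_bound (\<lambda>y. c * f y + g y) (cmod c * A + B)"
proof -
  have F: "integrable lborel f" "integrable lborel (fourier f)" "(LINT z|lborel. cmod (fourier f z)) \<le> A"
   and G: "integrable lborel g" "integrable lborel (fourier g)" "(LINT z|lborel. cmod (fourier g z)) \<le> B"
    using f g by (auto simp: fourier_L1_bound_def)
  have cf: "integrable lborel (\<lambda>y. c * f y)" using F by simp
  have eq: "fourier (\<lambda>y. c * f y + g y) = (\<lambda>z. c * fourier f z + fourier g z)"
    by (simp add: fun_eq_iff fourier_add[OF cf G(1)] fourier_cmult)
  have "(LINT z|lborel. cmod (c * fourier f z + fourier g z)) \<le> (LINT z|lborel. cmod c * cmod (fourier f z) + cmod (fourier g z))"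
    using F G by (intro integral_mono) (auto intro: norm_triangle_le simp: norm_mult[symmetric])
  also have "\<dots> = cmod c * (LINT z|lborel. cmod (fourier f z)) + (LINT z|lborel. cmod (fourier g z))"
    using F G by simp
  also have "\<dots> \<le> cmod c * A + B" by (intro add_mono mult_left_mono F G) simp
  finally show ?thesis using F G unfolding fourier_L1_bound_def eq by simp
qed

text \<open>
  The curves along which the Duhamel formula can be transformed.  Continuity in $L^1$ makes the
  transform jointly continuous in time and frequency, hence jointly measurable, although the curve
  itself need not be measurable as a function of time and space: each of its values may be changed
  on a null set.  The bound on the transforms, uniform on bounded time intervals, serves Fubini's
  theorem.
\<close>

definition regular_curve :: "(real \<Rightarrow> real \<Rightarrow> complex) \<Rightarrow> bool" where
  "regular_curve N \<longleftrightarrow> (\<forall>T. \<exists>B. \<forall>s\<in>{1..T}. fourier_L1_bound (N s) B) \<and>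
     (\<forall>t\<ge>1. ((\<lambda>s. LINT y|lborel. cmod (N s y - N t y)) \<longlongrightarrow> 0) (at t within {1..}))"

lemma regular_curve_bound:
  assumes "regular_curve N"
  obtains B where "\<And>s. s \<in> {1..T} \<Longrightarrow> fourier_L1_bound (N s) B"
proof -
  have "\<exists>B. \<forall>s\<in>{1..T}. fourier_L1_bound (N s) B" using assms unfolding regular_curve_def by simp
  then show ?thesis using that by blast
qed

lemma regular_curve_integrable:
  assumes "regular_curve N" "s \<ge> 1"
  shows "integrable lborel (N s)" "integrable lborel (fourier (N s))" "N s \<in> borel_measurable borel"
proof -
  obtain B where B: "\<And>t. t \<in> {1..s} \<Longrightarrow> fourier_L1_bound (N t) B"
    using regular_curve_bound[OF assms(1), of s] by blast
  have "fourier_L1_bound (N s) B" by (rule B) (use assms(2) in auto)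
  then show "integrable lborel (N s)" "integrable lborel (fourier (N s))" by (auto simp: fourier_L1_bound_def)
  then show "N s \<in> borel_measurable borel" by auto
qed

lemma regular_curve_tendsto:
  assumes "regular_curve N" "t \<ge> 1"
  shows "((\<lambda>s. LINT y|lborel. cmod (N s y - N t y)) \<longlongrightarrow> 0) (at t within {1..})"
  using assms by (auto simp: regular_curve_def)

text \<open>
  Nonlinear expressions in \<open>u\<close> inherit continuity in $L^1$ from a pointwise Lipschitz bound.  The
  term with the factor \<open>r s\<close> admits an explicit dependence on time, such as that of the moving
  potential.
\<close>

lemma regular_curve_transfer:
  assumes u: "regular_curve u"
    and b: "\<And>T. \<exists>B. \<forall>s\<in>{1..T}. fourier_L1_bound (N s) B"
    and c: "\<And>t. t \<ge> 1 \<Longrightarrow> \<exists>L r. (r \<longlongrightarrow> 0) (at t within {1..}) \<and>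
        (\<forall>s\<in>{1..t+1}. AE y in lborel. cmod (N s y - N t y) \<le> L * cmod (u s y - u t y) + r s * cmod (u t y))"
  shows "regular_curve N"
  unfolding regular_curve_def
proof (intro conjI allI impI b)
  fix t :: real assume t: "t \<ge> 1"
  obtain L r where r: "(r \<longlongrightarrow> 0) (at t within {1..})" and
    le: "\<And>s. s \<in> {1..t+1} \<Longrightarrow> AE y in lborel. cmod (N s y - N t y) \<le> L * cmod (u s y - u t y) + r s * cmod (u t y)"
    using c[OF t] by blast
  have N: "integrable lborel (N s)" if s: "s \<ge> 1" for s
  proof -
    obtain B where "\<forall>s\<in>{1..s}. fourier_L1_bound (N s) B" using b by blast
    then show ?thesis using s by (auto simp: fourier_L1_bound_def)
  qed
  have U: "integrable lborel (u s)" if "s \<ge> 1" for s using regular_curve_integrable[OF u that] by simp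
  let ?R = "\<lambda>s. L * (LINT y|lborel. cmod (u s y - u t y)) + r s * (LINT y|lborel. cmod (u t y))"
  have "(?R \<longlongrightarrow> L * 0 + 0 * (LINT y|lborel. cmod (u t y))) (at t within {1..})"
    by (intro tendsto_intros r regular_curve_tendsto[OF u t])
  then have R: "(?R \<longlongrightarrow> 0) (at t within {1..})" by simp
  show "((\<lambda>s. LINT y|lborel. cmod (N s y - N t y)) \<longlongrightarrow> 0) (at t within {1..})"
  proof (rule tendsto_sandwich[OF _ _ tendsto_const R])
    show "\<forall>\<^sub>F s in at t within {1..}. 0 \<le> (LINT y|lborel. cmod (N s y - N t y))"
      by (intro always_eventually allI integral_nonneg_AE) simp
    have "\<forall>\<^sub>F s in at t within {1..}. s < t + 1"
      using order_tendstoD(2)[OF tendsto_ident_at, of t "t + 1"] by simp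
    moreover have "\<forall>\<^sub>F s in at t within {1..}. s \<in> {1..}" by (simp add: eventually_at_filter)
    ultimately show "\<forall>\<^sub>F s in at t within {1..}. (LINT y|lborel. cmod (N s y - N t y)) \<le> ?R s"
    proof eventually_elim
      case (elim s)
      then have s: "s \<ge> 1" "s \<in> {1..t+1}" by auto
      have "(LINT y|lborel. cmod (N s y - N t y)) \<le> (LINT y|lborel. L * cmod (u s y - u t y) + r s * cmod (u t y))"
        using N[OF s(1)] N[OF t] U[OF s(1)] U[OF t] by (intro integral_mono_AE le s(2)) auto
      also have "\<dots> = ?R s" using U[OF s(1)] U[OF t] by simp
      finally show ?case .
    qed
  qed
qed

text \<open>
  Multiplication by the squared modulus preserves local Lipschitz bounds; applied once it gives
  the cubic and applied twice the quintic power.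
\<close>

lemma cmod_square_mult_diff_le:
  fixes a b X Y :: complex
  assumes M: "cmod a \<le> M" "cmod b \<le> M" and N: "cmod Y \<le> N" and L: "cmod (X - Y) \<le> L * cmod (a - b)"
  shows "cmod (of_real ((cmod a)\<^sup>2) * X - of_real ((cmod b)\<^sup>2) * Y) \<le> (M\<^sup>2 * L + 2 * M * N) * cmod (a - b)"
proof -
  have M0: "M \<ge> 0" using M(1) norm_ge_zero order_trans by blast
  have "of_real ((cmod a)\<^sup>2) * X - of_real ((cmod b)\<^sup>2) * Y
     = of_real ((cmod a)\<^sup>2) * (X - Y) + of_real ((cmod a)\<^sup>2 - (cmod b)\<^sup>2) * Y"
    by (simp add: algebra_simps)
  then have "cmod (of_real ((cmod a)\<^sup>2) * X - of_real ((cmod b)\<^sup>2) * Y)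
     \<le> (cmod a)\<^sup>2 * cmod (X - Y) + \<bar>(cmod a)\<^sup>2 - (cmod b)\<^sup>2\<bar> * cmod Y"
    using norm_triangle_ineq[of "of_real ((cmod a)\<^sup>2) * (X - Y)" "of_real ((cmod a)\<^sup>2 - (cmod b)\<^sup>2) * Y"]
    by (simp only: norm_mult norm_of_real abs_power2)
  also have "\<dots> \<le> M\<^sup>2 * (L * cmod (a - b)) + (2 * M * cmod (a - b)) * N"
  proof (intro add_mono mult_mono L N)
    have "\<bar>(cmod a)\<^sup>2 - (cmod b)\<^sup>2\<bar> = \<bar>cmod a - cmod b\<bar> * (cmod a + cmod b)"
      by (simp add: power2_eq_square square_diff_square_factored abs_mult mult.commute)
    also have "\<dots> \<le> cmod (a - b) * (2 * M)"
      using M by (intro mult_mono norm_triangle_ineq3) auto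
    finally show "\<bar>(cmod a)\<^sup>2 - (cmod b)\<^sup>2\<bar> \<le> 2 * M * cmod (a - b)" by (simp add: mult_ac)
  qed (use M M0 in \<open>auto intro: power_mono\<close>)
  finally show ?thesis by (simp add: algebra_simps)
qed

definition quintic :: "complex \<Rightarrow> complex" where
  "quintic a = of_real ((cmod a) ^ 4) * a"

lemma quintic_eq: "quintic a = of_real ((cmod a)\<^sup>2) * (of_real ((cmod a)\<^sup>2) * a)"
  by (simp add: quintic_def flip: mult.assoc power_add)

lemma cmod_quintic: "cmod (quintic a) = cmod a ^ 5"
  by (simp add: quintic_def norm_mult norm_power numeral_eq_Suc)

lemma cubic_diff_le:
  assumes "cmod a \<le> M" "cmod b \<le> M"
  shows "cmod (of_real ((cmod a)\<^sup>2) * a - of_real ((cmod b)\<^sup>2) * b) \<le> 3 * M\<^sup>2 * cmod (a - b)"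
  using cmod_square_mult_diff_le[OF assms assms(2), of a 1] by (simp add: power2_eq_square)

lemma quintic_diff_le:
  assumes M: "cmod a \<le> M" "cmod b \<le> M"
  shows "cmod (quintic a - quintic b) \<le> 5 * M ^ 4 * cmod (a - b)"
proof -
  have "cmod (of_real ((cmod b)\<^sup>2) * b) = cmod b ^ 3"
    by (simp add: norm_mult norm_power numeral_eq_Suc)
  also have "\<dots> \<le> M ^ 3" using M by (intro power_mono) auto
  finally have "cmod (of_real ((cmod b)\<^sup>2) * b) \<le> M ^ 3" .
  from cmod_square_mult_diff_le[OF M this cubic_diff_le[OF M]]
  show ?thesis unfolding quintic_eq by (simp add: algebra_simps numeral_eq_Suc)
qed

lemma regular_curve_bounded:
  assumes "regular_curve u"
  obtains M where "\<And>s. s \<in> {1..T} \<Longrightarrow> AE y in lborel. cmod (u s y) \<le> M" "M \<ge> 0"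
proof -
  obtain B where B: "\<And>s. s \<in> {1..T} \<Longrightarrow> fourier_L1_bound (u s) B"
    using regular_curve_bound[OF assms, of T] by blast
  show ?thesis
  proof (rule that[of "\<bar>B\<bar> / (2 * pi)"])
    show "AE y in lborel. cmod (u s y) \<le> \<bar>B\<bar> / (2 * pi)" if "s \<in> {1..T}" for s
      using B[OF that] by (intro wiener_bound_AE fourier_L1_imp_wiener) (auto elim: fourier_L1_bound_mono)
  qed simp
qed

lemma cubic_fourier_L1_bound:
  assumes "fourier_L1_bound f B"
  shows "fourier_L1_bound (cubic f) (B * (B * B / (2 * pi)) / (2 * pi))"
proof -
  have w: "wiener_bound f B" by (rule fourier_L1_imp_wiener[OF assms])
  have "cubic f = (\<lambda>y. f y * (cnj (f y) * f y))"
    unfolding cubic_def fun_eq_iff complex_norm_square by (simp only: mult_ac) simp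
  then show ?thesis
    using fourier_L1_bound_mult[OF w fourier_L1_bound_mult[OF wiener_bound_cnj[OF w] assms]] by simp
qed

lemma quintic_fourier_L1_bound:
  assumes "fourier_L1_bound f B"
  shows "fourier_L1_bound (\<lambda>y. quintic (f y)) (B * (B * (B * (B * B / (2 * pi)) / (2 * pi)) / (2 * pi)) / (2 * pi))"
proof -
  have w: "wiener_bound f B" by (rule fourier_L1_imp_wiener[OF assms])
  have "(\<lambda>y. quintic (f y)) = (\<lambda>y. f y * (cnj (f y) * cubic f y))"
    unfolding quintic_eq cubic_def fun_eq_iff complex_norm_square by (simp only: mult_ac) simp
  then show ?thesis
    using fourier_L1_bound_mult[OF w fourier_L1_bound_mult[OF wiener_bound_cnj[OF w] cubic_fourier_L1_bound[OF assms]]] by simp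
qed

lemma regular_curve_cubic:
  assumes u: "regular_curve u" shows "regular_curve (\<lambda>s. cubic (u s))"
proof (rule regular_curve_transfer[OF u])
  fix T
  obtain B where "\<And>s. s \<in> {1..T} \<Longrightarrow> fourier_L1_bound (u s) B"
    using regular_curve_bound[OF u, of T] by blast
  then show "\<exists>B. \<forall>s\<in>{1..T}. fourier_L1_bound (cubic (u s)) B" using cubic_fourier_L1_bound by blast
next
  fix t :: real assume t: "t \<ge> 1"
  obtain M where M: "\<And>s. s \<in> {1..t + 1} \<Longrightarrow> AE y in lborel. cmod (u s y) \<le> M" "M \<ge> 0"
    using regular_curve_bounded[OF u, of "t + 1"] by blast
  show "\<exists>L r. (r \<longlongrightarrow> 0) (at t within {1..}) \<and>
        (\<forall>s\<in>{1..t+1}. AE y in lborel. cmod (cubic (u s) y - cubic (u t) y) \<le> L * cmod (u s y - u t y) + r s * cmod (u t y))"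
  proof (intro exI[of _ "3 * M\<^sup>2"] exI[of _ "\<lambda>s. 0"] conjI ballI)
    fix s assume s: "s \<in> {1..t+1}"
    have "AE y in lborel. cmod (u t y) \<le> M" using t by (intro M) auto
    with M(1)[OF s] show "AE y in lborel. cmod (cubic (u s) y - cubic (u t) y) \<le> 3 * M\<^sup>2 * cmod (u s y - u t y) + 0 * cmod (u t y)"
      unfolding cubic_def
    proof eventually_elim
      case (elim y)
      from cubic_diff_le[OF elim] show ?case by (simp only: mult_zero_left add_0_right)
    qed
  qed simp
qed

lemma regular_curve_lincomb:
  assumes u: "regular_curve u" and v: "regular_curve v"
  shows "regular_curve (\<lambda>s y. c * u s y + v s y)"
  unfolding regular_curve_def
proof (intro conjI allI impI)
  fix T
  obtain A where A: "\<And>s. s \<in> {1..T} \<Longrightarrow> fourier_L1_bound (u s) A"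
    using regular_curve_bound[OF u, of T] by blast
  obtain B where B: "\<And>s. s \<in> {1..T} \<Longrightarrow> fourier_L1_bound (v s) B"
    using regular_curve_bound[OF v, of T] by blast
  from A B show "\<exists>B. \<forall>s\<in>{1..T}. fourier_L1_bound (\<lambda>y. c * u s y + v s y) B"
    using fourier_L1_bound_lincomb by blast
next
  fix t :: real assume t: "t \<ge> 1"
  let ?R = "\<lambda>s. cmod c * (LINT y|lborel. cmod (u s y - u t y)) + (LINT y|lborel. cmod (v s y - v t y))"
  have "(?R \<longlongrightarrow> cmod c * 0 + 0) (at t within {1..})"
    by (intro tendsto_intros regular_curve_tendsto[OF u t] regular_curve_tendsto[OF v t])
  then have R: "(?R \<longlongrightarrow> 0) (at t within {1..})" by simp
  show "((\<lambda>s. LINT y|lborel. cmod (c * u s y + v s y - (c * u t y + v t y))) \<longlongrightarrow> 0) (at t within {1..})"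
  proof (rule tendsto_sandwich[OF _ _ tendsto_const R])
    show "\<forall>\<^sub>F s in at t within {1..}. 0 \<le> (LINT y|lborel. cmod (c * u s y + v s y - (c * u t y + v t y)))"
      by (intro always_eventually allI integral_nonneg_AE) simp
    have "\<forall>\<^sub>F s in at t within {1..}. s \<in> {1..}" by (simp add: eventually_at_filter)
    then show "\<forall>\<^sub>F s in at t within {1..}. (LINT y|lborel. cmod (c * u s y + v s y - (c * u t y + v t y))) \<le> ?R s"
    proof eventually_elim
      case (elim s)
      then have s: "s \<ge> 1" by auto
      note I = regular_curve_integrable(1)[OF u s] regular_curve_integrable(1)[OF v s]
         regular_curve_integrable(1)[OF u t] regular_curve_integrable(1)[OF v t]
      have "(LINT y|lborel. cmod (c * u s y + v s y - (c * u t y + v t y)))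
          \<le> (LINT y|lborel. cmod c * cmod (u s y - u t y) + cmod (v s y - v t y))"
      proof (rule integral_mono)
        fix y
        have "c * u s y + v s y - (c * u t y + v t y) = c * (u s y - u t y) + (v s y - v t y)"
          by (simp add: algebra_simps)
        from this show "cmod (c * u s y + v s y - (c * u t y + v t y)) \<le> cmod c * cmod (u s y - u t y) + cmod (v s y - v t y)"
          using norm_triangle_ineq[of "c * (u s y - u t y)" "v s y - v t y"] by (simp only: norm_mult)
      qed (use I in auto)
      also have "\<dots> = ?R s" using I by simp
      finally show ?case .
    qed
  qed
qed

text \<open>
  Because the decay exponent exceeds 2, the first moment of \<open>W\<close> is finite.
\<close>

lemma potential_bounds:
  assumes W: "potential W"
  obtains C where "C > 0" "\<And>x. \<bar>W x\<bar> \<le> C" "\<And>x y. \<bar>W x - W y\<bar> \<le> C * \<bar>x - y\<bar>"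
    "continuous_on UNIV W" "integrable lborel (\<lambda>x. \<bar>W x\<bar> * (1 + \<bar>x\<bar>))"
proof -
  obtain p C where p: "p > 2" and C: "\<And>j x. \<bar>(deriv ^^ j) W x\<bar> \<le> C j * jap x powr (- p - real j)"
     "\<And>j. C j > 0"
    and sm: "smooth W" using W by (auto simp: potential_def)
  have d: "(W has_real_derivative deriv W x) (at x)" for x
    using sm[unfolded smooth_def, rule_format, of 0 x] by (simp add: DERIV_deriv_iff_real_differentiable)
  have le1: "jap x powr (- q) \<le> 1" if "q \<ge> 0" for x q
    using powr_mono2'[of "-q" 1 "jap x"] that jap_props(2)[of x] by simp
  have W0: "\<bar>W x\<bar> \<le> C 0 * jap x powr (- p)" for x using C(1)[of 0 x] by simp
  have b0: "\<bar>W x\<bar> \<le> C 0" for x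
    by (rule order_trans[OF W0 mult_left_le]) (use le1[of p x] C(2)[of 0] p in auto)
  have "\<bar>deriv W x\<bar> \<le> C 1 * jap x powr (- (p + 1))" for x
    using C(1)[of 1 x] by (simp add: minus_diff_commute)
  then have b1: "\<bar>deriv W x\<bar> \<le> C 1" for x
    by (rule order_trans[OF _ mult_left_le]) (use le1[of "p + 1" x] C(2)[of 1] p in auto)
  have lip: "\<bar>W x - W y\<bar> \<le> C 1 * \<bar>x - y\<bar>" for x y
  proof -
    have "norm (W x - W y) \<le> C 1 * norm (x - y)"
      by (rule field_differentiable_bound[of UNIV W "deriv W"]) (use d b1 in auto)
    then show ?thesis by simp
  qed
  have cW: "continuous_on UNIV W"
    using d by (auto intro!: continuous_at_imp_continuous_on DERIV_isCont)
  have "integrable lborel (\<lambda>x. \<bar>W x\<bar> * (1 + \<bar>x\<bar>))"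
  proof (rule Bochner_Integration.integrable_bound)
    show "integrable lborel (\<lambda>x. 2 * C 0 * jap x powr (- (p - 1)))"
      using p by (intro integrable_mult_right integrable_jap_powr) simp
    show "(\<lambda>x. \<bar>W x\<bar> * (1 + \<bar>x\<bar>)) \<in> borel_measurable lborel"
      using borel_measurable_continuous_onI[OF cW] by measurable
    show "AE x in lborel. norm (\<bar>W x\<bar> * (1 + \<bar>x\<bar>)) \<le> norm (2 * C 0 * jap x powr (- (p - 1)))"
    proof (rule AE_I2)
      fix x
      have "\<bar>W x\<bar> * (1 + \<bar>x\<bar>) \<le> (C 0 * jap x powr (- p)) * (2 * jap x)"
        using jap_props[of x] C(2)[of 0] by (intro mult_mono W0) auto
      also have "\<dots> = 2 * C 0 * (jap x powr (- p) * jap x powr 1)"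
        using jap_props(1)[of x] by simp
      also have "\<dots> = 2 * C 0 * jap x powr (- (p - 1))" unfolding powr_add[symmetric] by simp
      finally have "\<bar>W x\<bar> * (1 + \<bar>x\<bar>) \<le> 2 * C 0 * jap x powr (- (p - 1))" .
      moreover have "0 \<le> \<bar>W x\<bar> * (1 + \<bar>x\<bar>)" by simp
      ultimately show "norm (\<bar>W x\<bar> * (1 + \<bar>x\<bar>)) \<le> norm (2 * C 0 * jap x powr (- (p - 1)))"
        unfolding real_norm_def by linarith
    qed
  qed
  moreover have "\<bar>W x - W y\<bar> \<le> (C 0 + C 1) * \<bar>x - y\<bar>" for x y
    using lip[of x y] mult_nonneg_nonneg[OF less_imp_le[OF C(2)[of 0]], of "\<bar>x - y\<bar>"] by (simp add: distrib_right)
  moreover have "\<bar>W x\<bar> \<le> C 0 + C 1" for x using b0[of x] C(2)[of 1] by linarith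
  moreover have "C 0 + C 1 > 0" using C(2) by (simp add: add_pos_pos)
  ultimately show ?thesis using cW by (intro that[of "C 0 + C 1"])
qed

definition moving_quintic :: "real \<Rightarrow> (real \<Rightarrow> real) \<Rightarrow> (real \<Rightarrow> real \<Rightarrow> complex) \<Rightarrow> real \<Rightarrow> real \<Rightarrow> complex" where
  "moving_quintic \<gamma> W u s y = of_real (W (y + \<gamma> * s)) * quintic (u s y)"

lemma regular_curve_moving_quintic:
  assumes W: "potential W" and u: "regular_curve u"
  shows "regular_curve (moving_quintic \<gamma> W u)"
proof (rule regular_curve_transfer[OF u])
  fix T
  obtain B where B: "\<And>s. s \<in> {1..T} \<Longrightarrow> fourier_L1_bound (u s) B"
    using regular_curve_bound[OF u, of T] by blast
  obtain B' where B': "wiener_bound (\<lambda>y. of_real (W y)) B'" using potential_wiener_bound[OF W] by blast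
  show "\<exists>B. \<forall>s\<in>{1..T}. fourier_L1_bound (moving_quintic \<gamma> W u s) B"
    using fourier_L1_bound_mult[OF wiener_bound_shift[OF B'] quintic_fourier_L1_bound[OF B]]
    unfolding moving_quintic_def[abs_def] by blast
next
  fix t :: real assume t: "t \<ge> 1"
  obtain M where M: "\<And>s. s \<in> {1..t + 1} \<Longrightarrow> AE y in lborel. cmod (u s y) \<le> M" "M \<ge> 0"
    using regular_curve_bounded[OF u, of "t + 1"] by blast
  obtain C where C: "C > 0" "\<And>x. \<bar>W x\<bar> \<le> C" "\<And>x y. \<bar>W x - W y\<bar> \<le> C * \<bar>x - y\<bar>"
    using potential_bounds[OF W] by metis
  let ?r = "\<lambda>s. C * \<bar>\<gamma> * (s - t)\<bar> * M ^ 4"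
  show "\<exists>L r. (r \<longlongrightarrow> 0) (at t within {1..}) \<and>
        (\<forall>s\<in>{1..t+1}. AE y in lborel. cmod (moving_quintic \<gamma> W u s y - moving_quintic \<gamma> W u t y)
           \<le> L * cmod (u s y - u t y) + r s * cmod (u t y))"
  proof (intro exI[of _ "C * (5 * M ^ 4)"] exI[of _ "?r"] conjI ballI)
    have "(?r \<longlongrightarrow> C * \<bar>\<gamma> * (t - t)\<bar> * M ^ 4) (at t within {1..})" by (intro tendsto_intros)
    then show "(?r \<longlongrightarrow> 0) (at t within {1..})" by simp
    fix s assume s: "s \<in> {1..t+1}"
    have "AE y in lborel. cmod (u t y) \<le> M" using t by (intro M) auto
    with M(1)[OF s] show "AE y in lborel. cmod (moving_quintic \<gamma> W u s y - moving_quintic \<gamma> W u t y)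
           \<le> C * (5 * M ^ 4) * cmod (u s y - u t y) + ?r s * cmod (u t y)"
    proof eventually_elim
      case (elim y)
      let ?w = "\<lambda>s. W (y + \<gamma> * s)"
      have "moving_quintic \<gamma> W u s y - moving_quintic \<gamma> W u t y
        = of_real (?w s) * (quintic (u s y) - quintic (u t y)) + of_real (?w s - ?w t) * quintic (u t y)"
        by (simp add: moving_quintic_def algebra_simps)
      then have "cmod (moving_quintic \<gamma> W u s y - moving_quintic \<gamma> W u t y)
        \<le> \<bar>?w s\<bar> * cmod (quintic (u s y) - quintic (u t y)) + \<bar>?w s - ?w t\<bar> * cmod (quintic (u t y))"
        using norm_triangle_ineq[of "of_real (?w s) * (quintic (u s y) - quintic (u t y))" "of_real (?w s - ?w t) * quintic (u t y)"]
        by (simp only: norm_mult norm_of_real)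
      also have "\<dots> \<le> C * (5 * M ^ 4 * cmod (u s y - u t y)) + (C * \<bar>\<gamma> * (s - t)\<bar>) * (M ^ 4 * cmod (u t y))"
      proof (intro add_mono mult_mono C quintic_diff_le elim)
        have "\<bar>?w s - ?w t\<bar> \<le> C * \<bar>(y + \<gamma> * s) - (y + \<gamma> * t)\<bar>" by (rule C)
        also have "(y + \<gamma> * s) - (y + \<gamma> * t) = \<gamma> * (s - t)" by (simp add: algebra_simps)
        finally show "\<bar>?w s - ?w t\<bar> \<le> C * \<bar>\<gamma> * (s - t)\<bar>" .
        have "cmod (quintic (u t y)) = cmod (u t y) ^ 4 * cmod (u t y)" by (simp add: quintic_def norm_mult norm_power)
        also have "\<dots> \<le> M ^ 4 * cmod (u t y)" by (intro mult_right_mono power_mono elim) auto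
        finally show "cmod (quintic (u t y)) \<le> M ^ 4 * cmod (u t y)" .
      qed (use C(1) M(2) in auto)
      finally show ?case by (simp only: mult_ac)
    qed
  qed
qed

lemma regular_curve_nonlinearity:
  assumes W: "potential W" and u: "regular_curve u"
  shows "regular_curve (\<lambda>s. nonlinearity \<beta> \<gamma> W s (u s))"
proof -
  have "nonlinearity \<beta> \<gamma> W s (u s) = (\<lambda>y. (- of_real \<beta>) * cubic (u s) y + moving_quintic \<gamma> W u s y)" for s
    by (simp add: nonlinearity_def moving_quintic_def quintic_def fun_eq_iff)
  then show ?thesis
    using regular_curve_lincomb[OF regular_curve_cubic[OF u] regular_curve_moving_quintic[OF W u], of "- of_real \<beta>"]
    by simp
qed

section \<open>The Duhamel formula on the Fourier side\<close>

lemma regular_curve_fourier_continuous: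
  assumes N: "regular_curve N"
  shows "continuous_on ({1..} \<times> UNIV) (\<lambda>p. fourier (N (fst p)) (snd p))"
  unfolding continuous_on_sequentially
proof (intro allI ballI impI)
  fix x :: "nat \<Rightarrow> real \<times> real" and a
  assume a: "a \<in> {1..} \<times> UNIV" and x: "(\<forall>n. x n \<in> {1..} \<times> UNIV) \<and> x \<longlonglongrightarrow> a"
  obtain t z where tz: "a = (t, z)" "t \<ge> 1" using a by auto
  have fx: "(\<lambda>n. fst (x n)) \<longlonglongrightarrow> t" "(\<lambda>n. snd (x n)) \<longlonglongrightarrow> z"
    using tendsto_fst[of x a] tendsto_snd[of x a] x tz by auto
  have s1: "fst (x n) \<ge> 1" for n using x by (auto simp: mem_Times_iff)
  let ?g = "\<lambda>s. LINT y|lborel. cmod (N s y - N t y)"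
  have "continuous (at t within {1..}) ?g"
    unfolding continuous_within using regular_curve_tendsto[OF N tz(2)] by simp
  then have "(?g \<circ> (\<lambda>n. fst (x n))) \<longlonglongrightarrow> ?g t"
    unfolding continuous_within_sequentially using fx(1) s1 by auto
  then have g: "(\<lambda>n. ?g (fst (x n))) \<longlonglongrightarrow> 0" by (simp add: o_def)
  have c: "(\<lambda>n. fourier (N t) (snd (x n))) \<longlonglongrightarrow> fourier (N t) z"
    using continuous_on_fourier[OF regular_curve_integrable(1)[OF N tz(2)]] fx(2)
    by (auto simp: continuous_on_sequentially o_def)
  have "(\<lambda>n. fourier (N (fst (x n))) (snd (x n)) - fourier (N t) (snd (x n))) \<longlonglongrightarrow> 0"
  proof (rule Lim_null_comparison[OF _ g], rule always_eventually, rule allI)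
    fix n
    show "norm (fourier (N (fst (x n))) (snd (x n)) - fourier (N t) (snd (x n))) \<le> ?g (fst (x n))"
      unfolding fourier_diff[OF regular_curve_integrable(1)[OF N s1] regular_curve_integrable(1)[OF N tz(2)], symmetric]
      by (rule cmod_fourier_le)
  qed
  from tendsto_add[OF this c]
  show "((\<lambda>p. fourier (N (fst p)) (snd p)) \<circ> x) \<longlonglongrightarrow> fourier (N (fst a)) (snd a)"
    by (simp add: o_def tz)
qed

lemma regular_curve_fourier_continuous_time:
  assumes N: "regular_curve N"
  shows "continuous_on {1..} (\<lambda>s. fourier (N s) z)"
proof -
  have "continuous_on {1..} (\<lambda>s. (\<lambda>p. fourier (N (fst p)) (snd p)) (s, z))"
    by (rule continuous_on_compose2[OF regular_curve_fourier_continuous[OF N]])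
       (auto intro!: continuous_intros)
  then show ?thesis by simp
qed

lemma regular_curve_L1_bounded:
  assumes N: "regular_curve N"
  obtains M where "\<And>s. s \<in> {1..T} \<Longrightarrow> (LINT y|lborel. cmod (N s y)) \<le> M"
proof -
  let ?h = "\<lambda>s. LINT y|lborel. cmod (N s y)"
  have "continuous_on {1..T} ?h"
    unfolding continuous_on_def
  proof
    fix t assume t: "t \<in> {1..T}"
    then have t1: "t \<ge> 1" by simp
    have g: "((\<lambda>s. LINT y|lborel. cmod (N s y - N t y)) \<longlongrightarrow> 0) (at t within {1..T})"
      by (rule tendsto_within_subset[OF regular_curve_tendsto[OF N t1]]) auto
    show "(?h \<longlongrightarrow> ?h t) (at t within {1..T})"
    proof (rule LIM_zero_cancel, rule Lim_null_comparison[OF _ g])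
      have "\<forall>\<^sub>F s in at t within {1..T}. s \<in> {1..T}" by (simp add: eventually_at_filter)
      then show "\<forall>\<^sub>F s in at t within {1..T}. norm (?h s - ?h t) \<le> (LINT y|lborel. cmod (N s y - N t y))"
      proof eventually_elim
        case (elim s)
        then have s1: "s \<ge> 1" by simp
        note I = regular_curve_integrable(1)[OF N s1] regular_curve_integrable(1)[OF N t1]
        have "?h s - ?h t = (LINT y|lborel. cmod (N s y) - cmod (N t y))"
          using I by simp
        then have "norm (?h s - ?h t) \<le> (LINT y|lborel. norm (cmod (N s y) - cmod (N t y)))"
          by (simp only: integral_norm_bound)
        also have "\<dots> \<le> (LINT y|lborel. cmod (N s y - N t y))"
          using I by (intro integral_mono) (auto intro: norm_triangle_ineq3)
        finally show ?case .
      qed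
    qed
  qed
  then have "bounded (?h ` {1..T})"
    by (intro compact_imp_bounded compact_continuous_image compact_Icc)
  then obtain M where M: "\<And>s. s \<in> {1..T} \<Longrightarrow> norm (?h s) \<le> M" unfolding bounded_iff by blast
  show ?thesis
  proof (rule that)
    show "?h s \<le> M" if "s \<in> {1..T}" for s
      using M[OF that] abs_ge_self[of "?h s"] unfolding real_norm_def by linarith
  qed
qed

lemma inv_fourier_lincomb:
  assumes "integrable lborel f" "integrable lborel g"
  shows "inv_fourier (\<lambda>x. f x + c * g x) z = inv_fourier f z + c * inv_fourier g z"
proof -
  have i: "integrable lborel (\<lambda>x. iexp (x * z) * f x)" "integrable lborel (\<lambda>x. iexp (x * z) * g x)"
    by (intro integrable_iexp_mult assms; simp)+
  have "(LINT x|lborel. iexp (x * z) * (f x + c * g x)) =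
     (LINT x|lborel. iexp (x * z) * f x + c * (iexp (x * z) * g x))"
    by (simp only: ring_distribs mult_ac)
  also have "\<dots> = (LINT x|lborel. iexp (x * z) * f x) + c * (LINT x|lborel. iexp (x * z) * g x)"
    by (subst Bochner_Integration.integral_add[OF i(1) integrable_mult_right[OF i(2)]])
       (simp only: integral_mult_right_zero)
  finally show ?thesis by (simp add: inv_fourier_def add_divide_distrib)
qed

context
  fixes N :: "real \<Rightarrow> real \<Rightarrow> complex" and t :: real
  assumes N: "regular_curve N" and t1: "t \<ge> 1"
begin

definition duhamel_kernel :: "real \<Rightarrow> real \<Rightarrow> complex" where
  "duhamel_kernel s z = indicator {1..t} s *\<^sub>R (iexp (- ((t - s) * z\<^sup>2)) * fourier (N s) z)"

lemma duhamel_kernel_measurable: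
  "(\<lambda>p. duhamel_kernel (fst p) (snd p)) \<in> borel_measurable (lborel \<Otimes>\<^sub>M lborel)"
proof -
  let ?A = "{1..t} \<times> (UNIV :: real set)"
  have "continuous_on ?A (\<lambda>p. fourier (N (fst p)) (snd p))"
    by (rule continuous_on_subset[OF regular_curve_fourier_continuous[OF N]]) auto
  then have "continuous_on ?A (\<lambda>p. iexp (- ((t - fst p) * (snd p)\<^sup>2)) * fourier (N (fst p)) (snd p))"
    by (intro continuous_intros)
  then have "(\<lambda>p. indicator ?A p *\<^sub>R (iexp (- ((t - fst p) * (snd p)\<^sup>2)) * fourier (N (fst p)) (snd p))) \<in> borel_measurable borel"
    by (intro borel_measurable_continuous_on_indicator borel_closed closed_Times) auto
  moreover have "indicator ?A p = (indicator {1..t} (fst p) :: real)" for p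
    by (auto simp: indicator_def mem_Times_iff)
  ultimately show ?thesis by (simp add: lborel_prod duhamel_kernel_def)
qed

lemma duhamel_kernel_integrable:
  "integrable (lborel \<Otimes>\<^sub>M lborel) (\<lambda>(s, z). duhamel_kernel s z)"
proof (rule lborel_pair.Fubini_integrable)
  show m: "(\<lambda>(s, z). duhamel_kernel s z) \<in> borel_measurable (lborel \<Otimes>\<^sub>M lborel)"
    using duhamel_kernel_measurable by (simp add: case_prod_unfold)
  have I: "integrable lborel (duhamel_kernel s)" for s
  proof (cases "s \<in> {1..t}")
    case True
    then show ?thesis unfolding duhamel_kernel_def[abs_def]
      using regular_curve_integrable(2)[OF N, of s]
      by (intro integrable_scaleR_right integrable_iexp_mult) auto
  next
    case False
    then have "duhamel_kernel s = (\<lambda>z. 0)" by (auto simp: duhamel_kernel_def fun_eq_iff)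
    then show ?thesis by simp
  qed
  then show "AE s in lborel. integrable lborel (\<lambda>z. case (s, z) of (s, z) \<Rightarrow> duhamel_kernel s z)" by simp
  obtain B where B: "\<And>s. s \<in> {1..t} \<Longrightarrow> fourier_L1_bound (N s) B" using regular_curve_bound[OF N, of t] by blast
  show "integrable lborel (\<lambda>s. LINT z|lborel. norm (case (s, z) of (s, z) \<Rightarrow> duhamel_kernel s z))"
  proof (rule Bochner_Integration.integrable_bound)
    show "integrable lborel (\<lambda>s. indicator {1..t} s * B)" using t1 by (intro integrable_mult_left) auto
    show "(\<lambda>s. LINT z|lborel. norm (case (s, z) of (s, z) \<Rightarrow> duhamel_kernel s z)) \<in> borel_measurable lborel"
      using m by measurable
    show "AE s in lborel. norm (LINT z|lborel. norm (case (s, z) of (s, z) \<Rightarrow> duhamel_kernel s z)) \<le> norm (indicator {1..t} s * B)"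
    proof (rule AE_I2)
      fix s
      show "norm (LINT z|lborel. norm (case (s, z) of (s, z) \<Rightarrow> duhamel_kernel s z)) \<le> norm (indicator {1..t} s * B)"
      proof (cases "s \<in> {1..t}")
        case True
        then have "(LINT z|lborel. norm (duhamel_kernel s z)) = (LINT z|lborel. cmod (fourier (N s) z))"
          by (simp add: duhamel_kernel_def norm_mult)
        also have "\<dots> \<le> B" using B[OF True] by (simp add: fourier_L1_bound_def)
        finally have "(LINT z|lborel. norm (duhamel_kernel s z)) \<le> B" .
        moreover have "0 \<le> (LINT z|lborel. norm (duhamel_kernel s z))" by (intro integral_nonneg_AE) simp
        ultimately show ?thesis using True by simp
      next
        case False
        then show ?thesis by (simp add: duhamel_kernel_def)
      qed
    qed
  qed
qed

text \<open>
  The order of the time and the frequency integral is exchanged; this is where integrability of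
  the transforms of the nonlinearity is needed.
\<close>

lemma inv_fourier_duhamel_kernel:
  "inv_fourier (\<lambda>z. LINT s|lborel. duhamel_kernel s z) y = (LINT s:{1..t}|lborel. propagator (t - s) (N s) y)"
proof -
  let ?f = "\<lambda>s z. iexp (z * y) * duhamel_kernel s z"
  have i: "integrable (lborel \<Otimes>\<^sub>M lborel) (case_prod ?f)"
  proof -
    have "integrable (lborel \<Otimes>\<^sub>M lborel) (\<lambda>p. iexp (snd p * y) * (case p of (s, z) \<Rightarrow> duhamel_kernel s z))"
      by (intro integrable_iexp_mult duhamel_kernel_integrable) measurable
    then show ?thesis by (simp add: case_prod_unfold)
  qed
  have "(LINT z|lborel. iexp (z * y) * (LINT s|lborel. duhamel_kernel s z)) = (LINT z|lborel. LINT s|lborel. ?f s z)"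
    by (simp only: integral_mult_right_zero)
  also have "\<dots> = (LINT s|lborel. LINT z|lborel. ?f s z)"
    by (rule lborel_pair.Fubini_integral[OF i])
  also have "\<dots> = (LINT s|lborel. of_real (2 * pi) * (indicator {1..t} s *\<^sub>R propagator (t - s) (N s) y))"
  proof (intro Bochner_Integration.integral_cong refl)
    fix s
    have "?f s z = complex_of_real (indicator {1..t} s) * (iexp (z * y) * (iexp (- ((t - s) * z\<^sup>2)) * fourier (N s) z))" for z
      by (simp only: duhamel_kernel_def scaleR_conv_of_real mult_ac)
    then have "(LINT z|lborel. ?f s z) = complex_of_real (indicator {1..t} s) * (LINT z|lborel. iexp (z * y) * (iexp (- ((t - s) * z\<^sup>2)) * fourier (N s) z))"
      by (simp only: integral_mult_right_zero)
    also have "\<dots> = of_real (2 * pi) * (indicator {1..t} s *\<^sub>R propagator (t - s) (N s) y)"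
      unfolding propagator_def inv_fourier_def scaleR_conv_of_real by simp
    finally show "(LINT z|lborel. ?f s z) = of_real (2 * pi) * (indicator {1..t} s *\<^sub>R propagator (t - s) (N s) y)" .
  qed
  also have "\<dots> = of_real (2 * pi) * (LINT s:{1..t}|lborel. propagator (t - s) (N s) y)"
    unfolding set_lebesgue_integral_def by (simp only: integral_mult_right_zero)
  finally show ?thesis unfolding inv_fourier_def by simp
qed

lemma duhamel_integral_continuous:
  "continuous_on UNIV (\<lambda>z. LINT s|lborel. duhamel_kernel s z)"
  unfolding continuous_on_sequentially
proof (intro allI ballI impI)
  fix x :: "nat \<Rightarrow> real" and a :: real
  assume "(\<forall>n. x n \<in> UNIV) \<and> x \<longlonglongrightarrow> a"
  then have x: "x \<longlonglongrightarrow> a" by simp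
  obtain M where M: "\<And>s. s \<in> {1..t} \<Longrightarrow> (LINT y|lborel. cmod (N s y)) \<le> M"
    using regular_curve_L1_bounded[OF N, of t] by blast
  have m: "(\<lambda>s. duhamel_kernel s z) \<in> borel_measurable lborel" for z
    using measurable_compose[OF measurable_Pair2'[of z lborel lborel] duhamel_kernel_measurable]
    by simp
  show "((\<lambda>z. LINT s|lborel. duhamel_kernel s z) \<circ> x) \<longlonglongrightarrow> (LINT s|lborel. duhamel_kernel s a)"
    unfolding o_def
  proof (rule integral_dominated_convergence[where w="\<lambda>s. indicator {1..t} s * M"])
    show "integrable lborel (\<lambda>s. indicator {1..t} s * M)" using t1 by (intro integrable_mult_left) auto
    show "AE s in lborel. (\<lambda>n. duhamel_kernel s (x n)) \<longlonglongrightarrow> duhamel_kernel s a"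
    proof (rule AE_I2)
      fix s
      show "(\<lambda>n. duhamel_kernel s (x n)) \<longlonglongrightarrow> duhamel_kernel s a"
      proof (cases "s \<in> {1..t}")
        case True
        then have "(\<lambda>n. fourier (N s) (x n)) \<longlonglongrightarrow> fourier (N s) a"
          using continuous_on_fourier[OF regular_curve_integrable(1)[OF N, of s]] x
          by (auto simp: continuous_on_sequentially o_def)
        then show ?thesis unfolding duhamel_kernel_def by (intro tendsto_intros x)
      next
        case False
        then show ?thesis by (simp add: duhamel_kernel_def)
      qed
    qed
    show "AE s in lborel. norm (duhamel_kernel s (x n)) \<le> indicator {1..t} s * M" for n
    proof (rule AE_I2)
      fix s
      show "norm (duhamel_kernel s (x n)) \<le> indicator {1..t} s * M"
        using order_trans[OF cmod_fourier_le M, of s "x n"]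
        by (cases "s \<in> {1..t}") (auto simp: duhamel_kernel_def norm_mult)
    qed
  qed (use m in auto)
qed

text \<open>
  By inversion and the mild equation both sides have almost everywhere the same inverse
  transform, so they agree almost everywhere by uniqueness.  Both are continuous in the
  frequency, so they agree everywhere.
\<close>

lemma duhamel_fourier:
  assumes u: "regular_curve u"
    and mild: "AE y in lborel. u t y = propagator (t - 1) (u 1) y +
      \<i> * (LINT s:{1..t}|lborel. propagator (t - s) (N s) y)"
  shows "fourier (u t) z = iexp (- ((t - 1) * z\<^sup>2)) * fourier (u 1) z +
      \<i> * (LINT s:{1..t}|lborel. iexp (- ((t - s) * z\<^sup>2)) * fourier (N s) z)"
proof -
  let ?G1 = "\<lambda>z. iexp (- ((t - 1) * z\<^sup>2)) * fourier (u 1) z"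
  let ?G2 = "\<lambda>z. LINT s|lborel. duhamel_kernel s z"
  have i1: "integrable lborel ?G1"
    by (intro integrable_iexp_mult regular_curve_integrable(2)[OF u order_refl]) measurable
  have i2: "integrable lborel ?G2" by (rule lborel_pair.integrable_snd[OF duhamel_kernel_integrable])
  have i: "integrable lborel (\<lambda>z. ?G1 z + \<i> * ?G2 z)" using i1 i2 by simp
  note ut = regular_curve_integrable[OF u t1]
  have "AE z in lborel. fourier (u t) z = ?G1 z + \<i> * ?G2 z"
  proof (rule inv_fourier_unique[OF ut(2) i])
    show "AE y in lborel. inv_fourier (fourier (u t)) y = inv_fourier (\<lambda>z. ?G1 z + \<i> * ?G2 z) y"
      using fourier_inversion_L1[OF ut(1,2)] mild
    proof eventually_elim
      case (elim y)
      have "inv_fourier (\<lambda>z. ?G1 z + \<i> * ?G2 z) y = inv_fourier ?G1 y + \<i> * inv_fourier ?G2 y"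
        by (rule inv_fourier_lincomb[OF i1 i2])
      also have "\<dots> = u t y"
        unfolding inv_fourier_duhamel_kernel elim(2) propagator_def ..
      finally show ?case using elim(1) by simp
    qed
  qed
  moreover have "continuous_on UNIV (\<lambda>z. ?G1 z + \<i> * ?G2 z)"
    using continuous_on_fourier[OF regular_curve_integrable(1)[OF u order_refl]] duhamel_integral_continuous
    by (intro continuous_intros)
  ultimately have "fourier (u t) z = ?G1 z + \<i> * ?G2 z"
    using continuous_on_fourier[OF ut(1)] by (intro AE_eq_continuous)
  then show ?thesis by (simp add: set_lebesgue_integral_def duhamel_kernel_def)
qed

end

lemma duhamel_profile:
  assumes N: "regular_curve N" and u: "regular_curve u" and t: "t \<ge> 1"
    and mild: "AE y in lborel. u t y = propagator (t - 1) (u 1) y +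
      \<i> * (LINT s:{1..t}|lborel. propagator (t - s) (N s) y)"
  shows "iexp (t * z\<^sup>2) * fourier (u t) z = iexp (z\<^sup>2) * fourier (u 1) z +
      \<i> * (LINT s:{1..t}|lborel. iexp (s * z\<^sup>2) * fourier (N s) z)"
proof -
  have e: "iexp (t * z\<^sup>2) * iexp (- ((t - s) * z\<^sup>2)) = iexp (s * z\<^sup>2)" for s
    by (simp add: algebra_simps flip: exp_add)
  have e2: "indicator {1..t} s *\<^sub>R (iexp (s * z\<^sup>2) * fourier (N s) z)
    = iexp (t * z\<^sup>2) * (indicator {1..t} s *\<^sub>R (iexp (- ((t - s) * z\<^sup>2)) * fourier (N s) z))" for s
    unfolding e[symmetric, of s] by (simp only: mult_scaleR_right mult.assoc)
  have "iexp (t * z\<^sup>2) * fourier (u t) z = (iexp (t * z\<^sup>2) * iexp (- ((t - 1) * z\<^sup>2))) * fourier (u 1) z +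
      \<i> * (iexp (t * z\<^sup>2) * (LINT s:{1..t}|lborel. iexp (- ((t - s) * z\<^sup>2)) * fourier (N s) z))"
    unfolding duhamel_fourier[OF N t u mild] by (simp only: distrib_left mult_ac)
  also have "iexp (t * z\<^sup>2) * (LINT s:{1..t}|lborel. iexp (- ((t - s) * z\<^sup>2)) * fourier (N s) z)
    = (LINT s:{1..t}|lborel. iexp (s * z\<^sup>2) * fourier (N s) z)"
    unfolding set_lebesgue_integral_def e2 by (simp only: integral_mult_right_zero)
  finally show ?thesis unfolding e by simp
qed

section \<open>Pointwise approximation of the quintic integrand\<close>

lemma iexp_diff_le: "cmod (iexp a - iexp b) \<le> \<bar>a - b\<bar>"
proof -
  have "iexp a - iexp b = iexp b * (iexp (a - b) - 1)"
    by (simp add: algebra_simps flip: exp_add)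
  then have "cmod (iexp a - iexp b) = cmod (iexp (a - b) - 1)" by (simp add: norm_mult)
  also have "\<dots> \<le> \<bar>a - b\<bar>" using iexp_approx1[of "a - b" 0] by simp
  finally show ?thesis .
qed

lemma iexp_diff_le_2: "cmod (iexp a - iexp b) \<le> 2"
  using norm_triangle_ineq4[of "iexp a" "iexp b"] by simp

lemma iexp_diff_le_powr:
  assumes h: "0 < h" "h \<le> 1"
  shows "cmod (iexp a - iexp b) \<le> 2 * \<bar>a - b\<bar> powr h"
proof (cases "\<bar>a - b\<bar> \<le> 1")
  case True
  have "\<bar>a - b\<bar> \<le> \<bar>a - b\<bar> powr h"
  proof (cases "a = b")
    case False
    then have "\<bar>a - b\<bar> powr 1 \<le> \<bar>a - b\<bar> powr h" using True h by (intro powr_mono') auto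
    then show ?thesis using False by simp
  qed simp
  moreover have "0 \<le> \<bar>a - b\<bar> powr h" by simp
  ultimately show ?thesis using iexp_diff_le[of a b] by linarith
next
  case False
  then have "1 \<le> \<bar>a - b\<bar> powr h" using h by (intro ge_one_powr_ge_zero) auto
  then show ?thesis using iexp_diff_le_2[of a b] by linarith
qed

text \<open>
  For large arguments the trivial bound 2 is better than the quadratic one.  Only the first power
  of \<open>|x|\<close> may appear, since the second moment of the potential can be infinite.
\<close>

lemma iexp_diff_le_sqrt:
  assumes s: "s > 0"
  shows "cmod (iexp (b + x\<^sup>2 / (4 * s)) - iexp b) \<le> \<bar>x\<bar> / sqrt s"
proof -
  define r where "r = \<bar>x\<bar> / sqrt s"
  have r: "x\<^sup>2 / (4 * s) = r * r / 4" using s by (simp add: r_def power2_eq_square)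
  have r0: "r \<ge> 0" using s by (simp add: r_def)
  have "cmod (iexp (b + x\<^sup>2 / (4 * s)) - iexp b) \<le> r"
  proof (cases "r \<le> 4")
    case True
    have "cmod (iexp (b + x\<^sup>2 / (4 * s)) - iexp b) \<le> \<bar>r * r / 4\<bar>"
      using iexp_diff_le[of "b + x\<^sup>2 / (4 * s)" b] unfolding r by simp
    also have "\<dots> = r * r / 4" using r0 by simp
    also have "\<dots> \<le> r" using mult_left_mono[OF True r0] by simp
    finally show ?thesis .
  next
    case False
    then show ?thesis using iexp_diff_le_2[of "b + x\<^sup>2 / (4 * s)" b] by linarith
  qed
  then show ?thesis by (simp only: r_def)
qed

lemma Linf_AE:
  assumes "Linf f" "Linf_norm f \<le> B"
  shows "AE x in lborel. cmod (f x) \<le> B"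
proof -
  let ?E = "esssup lborel (\<lambda>x. ereal (cmod (f x)))"
  have fin: "?E < \<infinity>" using assms(1) by (simp add: Linf_def)
  have ae: "AE x in lborel. ereal (cmod (f x)) \<le> ?E" by (rule esssup_AE)
  show ?thesis
  proof (cases ?E)
    case (real r)
    then have "r \<le> B" using assms(2) by (simp add: Linf_norm_def)
    with ae show ?thesis unfolding real by (auto elim: eventually_mono)
  next
    case PInf
    then show ?thesis using fin by simp
  next
    case MInf
    from ae show ?thesis unfolding MInf by (auto elim: eventually_mono)
  qed
qed

lemma AE_le_continuous:
  fixes f :: "real \<Rightarrow> complex"
  assumes c: "continuous_on UNIV f" and ae: "AE x in lborel. cmod (f x) \<le> B"
  shows "cmod (f x) \<le> B"
proof -
  have "complex_of_real (max (cmod (f x)) B - B) = 0"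
  proof (rule AE_zero_continuous[of "\<lambda>x. complex_of_real (max (cmod (f x)) B - B)" x])
    show "continuous_on UNIV (\<lambda>x. complex_of_real (max (cmod (f x)) B - B))"
      by (intro continuous_intros c)
    show "AE x in lborel. complex_of_real (max (cmod (f x)) B - B) = 0"
      using ae by eventually_elim simp
  qed
  then show ?thesis by (simp add: max_def split: if_splits)
qed

text \<open>
  The transform \<open>g\<close> of \<open>B\<close> is integrable against \<open>jap\<close> to the power \<open>h\<close>.  By inversion
  \<open>A\<close> is an integral of exponentials with amplitudes \<open>g\<close>, and \<open>iexp_diff_le_powr\<close> extracts the factor
  \<open>|x - y|\<close> to the power \<open>h\<close> from their increments.
\<close>

lemma Hs_Hoelder:
  assumes H: "Hs \<sigma> B" and A: "continuous_on UNIV A" and AB: "AE x in lborel. A x = B x"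
    and h: "0 < h" "h \<le> 1" "h + 1 / 2 < \<sigma>"
  obtains K where "K \<ge> 0" "\<And>x y. cmod (A x - A y) \<le> K * \<bar>x - y\<bar> powr h"
proof -
  obtain g where g: "has_L2_fourier B g" "L2 (\<lambda>\<zeta>. of_real (jap \<zeta> powr \<sigma>) * g \<zeta>)"
    using H by (auto simp: Hs_def)
  have gh: "integrable lborel (\<lambda>\<zeta>. of_real (jap \<zeta> powr h) * g \<zeta>)"
    by (rule weighted_L2_imp_L1(1)[OF g(2)]) (use h in simp)
  have g1: "integrable lborel g"
    using weighted_L2_imp_L1(1)[OF g(2), of 0] h jap_props(1) by (simp add: less_imp_neq[symmetric])
  have "AE x in lborel. A x = inv_fourier g x"
    using AB has_L2_fourier_inversion[OF g(1) g1] by eventually_elim simp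
  then have Ag: "A x = inv_fourier g x" for x
    by (rule AE_eq_continuous[OF A continuous_on_inv_fourier[OF g1]])
  define K where "K = (LINT \<zeta>|lborel. cmod (of_real (jap \<zeta> powr h) * g \<zeta>)) / pi"
  have "cmod (A x - A y) \<le> K * \<bar>x - y\<bar> powr h" for x y
  proof -
    have i: "integrable lborel (\<lambda>\<zeta>. iexp (\<zeta> * x) * g \<zeta>)" "integrable lborel (\<lambda>\<zeta>. iexp (\<zeta> * y) * g \<zeta>)"
      by (intro integrable_iexp_mult g1; simp)+
    have "A x - A y = (LINT \<zeta>|lborel. iexp (\<zeta> * x) * g \<zeta> - iexp (\<zeta> * y) * g \<zeta>) / of_real (2 * pi)"
      unfolding Ag inv_fourier_def using i by (simp add: diff_divide_distrib)
    then have "cmod (A x - A y) = cmod (LINT \<zeta>|lborel. iexp (\<zeta> * x) * g \<zeta> - iexp (\<zeta> * y) * g \<zeta>) / (2 * pi)"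
      by (simp add: norm_divide norm_mult)
    also have "\<dots> \<le> (LINT \<zeta>|lborel. cmod (iexp (\<zeta> * x) * g \<zeta> - iexp (\<zeta> * y) * g \<zeta>)) / (2 * pi)"
      by (intro divide_right_mono integral_norm_bound) simp
    also have "\<dots> \<le> (LINT \<zeta>|lborel. 2 * \<bar>x - y\<bar> powr h * cmod (of_real (jap \<zeta> powr h) * g \<zeta>)) / (2 * pi)"
    proof (intro divide_right_mono integral_mono)
      fix \<zeta>
      have "iexp (\<zeta> * x) * g \<zeta> - iexp (\<zeta> * y) * g \<zeta> = (iexp (\<zeta> * x) - iexp (\<zeta> * y)) * g \<zeta>"
        by (simp only: left_diff_distrib)
      then have "cmod (iexp (\<zeta> * x) * g \<zeta> - iexp (\<zeta> * y) * g \<zeta>) = cmod (iexp (\<zeta> * x) - iexp (\<zeta> * y)) * cmod (g \<zeta>)"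
        by (simp only: norm_mult)
      also have "\<dots> \<le> (2 * \<bar>\<zeta> * x - \<zeta> * y\<bar> powr h) * cmod (g \<zeta>)"
        by (intro mult_right_mono iexp_diff_le_powr h) simp
      also have "\<zeta> * x - \<zeta> * y = \<zeta> * (x - y)" by (simp add: algebra_simps)
      also have "\<bar>\<zeta> * (x - y)\<bar> powr h = \<bar>\<zeta>\<bar> powr h * \<bar>x - y\<bar> powr h" by (simp add: abs_mult powr_mult)
      also have "(2 * (\<bar>\<zeta>\<bar> powr h * \<bar>x - y\<bar> powr h)) * cmod (g \<zeta>) \<le> (2 * (jap \<zeta> powr h * \<bar>x - y\<bar> powr h)) * cmod (g \<zeta>)"
        using h jap_props(3) by (intro mult_right_mono mult_left_mono powr_mono2) auto
      finally show "cmod (iexp (\<zeta> * x) * g \<zeta> - iexp (\<zeta> * y) * g \<zeta>) \<le> 2 * \<bar>x - y\<bar> powr h * cmod (of_real (jap \<zeta> powr h) * g \<zeta>)"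
        by (simp add: norm_mult mult_ac)
    qed (use i gh in auto)
    also have "\<dots> = K * \<bar>x - y\<bar> powr h" unfolding K_def by simp
    finally show ?thesis .
  qed
  moreover have "K \<ge> 0" unfolding K_def by (intro divide_nonneg_pos integral_nonneg_AE) auto
  ultimately show ?thesis using that by blast
qed

lemma log_absorb:
  fixes s :: real
  assumes "s \<ge> 1" shows "1 + ln s \<le> 9 * s powr (1 / 8)"
proof -
  have "ln (s powr (1 / 8)) \<le> s powr (1 / 8) - 1" using assms by (intro ln_le_minus_one) simp
  then have "ln s \<le> 8 * (s powr (1 / 8) - 1)" using assms by (simp add: ln_powr)
  moreover have "1 \<le> s powr (1 / 8)" using assms by (intro ge_one_powr_ge_zero) auto
  ultimately show ?thesis by simp
qed

lemma quintic_scale: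
  assumes "r \<ge> 0" "cmod e = 1"
  shows "quintic (of_real r * w * e) = of_real (r ^ 5) * (quintic w * e)"
  using assms by (simp add: quintic_def norm_mult power_mult_distrib numeral_eq_Suc)

text \<open>
  The modulus of \<open>w\<close> also enters the phase, with a factor \<open>l\<close> that stands for the logarithm of the
  time; differentiating the phase costs this factor.
\<close>

lemma phased_quintic_diff_le:
  fixes w A0 :: complex and l \<beta> M :: real
  assumes M: "cmod w \<le> M" "cmod A0 \<le> M" and l: "l \<ge> 0"
  shows "cmod (quintic w * iexp (- (\<beta> * (cmod w)\<^sup>2 * l)) - quintic A0 * iexp (- (\<beta> * (cmod A0)\<^sup>2 * l)))
     \<le> (5 * M ^ 4 + 2 * M ^ 6 * \<bar>\<beta>\<bar>) * (1 + l) * cmod (w - A0)"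
proof -
  have M0: "M \<ge> 0" using M(1) norm_ge_zero order_trans by blast
  let ?e = "\<lambda>w. iexp (- (\<beta> * (cmod w)\<^sup>2 * l))"
  have "quintic w * ?e w - quintic A0 * ?e A0 = (quintic w - quintic A0) * ?e w + quintic A0 * (?e w - ?e A0)"
    by (simp add: algebra_simps)
  then have "cmod (quintic w * ?e w - quintic A0 * ?e A0)
    \<le> cmod (quintic w - quintic A0) * cmod (?e w) + cmod (quintic A0) * cmod (?e w - ?e A0)"
    using norm_triangle_ineq[of "(quintic w - quintic A0) * ?e w" "quintic A0 * (?e w - ?e A0)"]
    by (simp only: norm_mult)
  also have "\<dots> \<le> (5 * M ^ 4 * cmod (w - A0)) * 1 + M ^ 5 * (\<bar>\<beta>\<bar> * l * (2 * M * cmod (w - A0)))"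
  proof (intro add_mono mult_mono quintic_diff_le M)
    show "cmod (quintic A0) \<le> M ^ 5" unfolding cmod_quintic by (intro power_mono M) simp
    have "cmod (?e w - ?e A0) \<le> \<bar>- (\<beta> * (cmod w)\<^sup>2 * l) - - (\<beta> * (cmod A0)\<^sup>2 * l)\<bar>" by (rule iexp_diff_le)
    also have "- (\<beta> * (cmod w)\<^sup>2 * l) - - (\<beta> * (cmod A0)\<^sup>2 * l) = - (\<beta> * l * ((cmod w - cmod A0) * (cmod w + cmod A0)))"
      by (simp add: algebra_simps power2_eq_square)
    also have "\<bar>\<dots>\<bar> = \<bar>\<beta>\<bar> * l * (\<bar>cmod w - cmod A0\<bar> * (cmod w + cmod A0))"
      using l by (simp add: abs_mult)
    also have "\<dots> \<le> \<bar>\<beta>\<bar> * l * (cmod (w - A0) * (2 * M))"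
      using l M by (intro mult_left_mono mult_mono norm_triangle_ineq3) auto
    finally show "cmod (?e w - ?e A0) \<le> \<bar>\<beta>\<bar> * l * (2 * M * cmod (w - A0))" by (simp only: mult_ac)
  qed (use M0 in auto)
  also have "\<dots> = (5 * M ^ 4 + 2 * M ^ 6 * \<bar>\<beta>\<bar> * l) * cmod (w - A0)"
    by (simp add: algebra_simps numeral_eq_Suc)
  also have "\<dots> \<le> ((5 * M ^ 4 + 2 * M ^ 6 * \<bar>\<beta>\<bar>) * (1 + l)) * cmod (w - A0)"
  proof (rule mult_right_mono)
    have "0 \<le> 5 * M ^ 4 * l + 2 * M ^ 6 * \<bar>\<beta>\<bar>" using l M0 by auto
    then show "5 * M ^ 4 + 2 * M ^ 6 * \<bar>\<beta>\<bar> * l \<le> (5 * M ^ 4 + 2 * M ^ 6 * \<bar>\<beta>\<bar>) * (1 + l)"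
      by (simp add: algebra_simps)
  qed simp
  finally show ?thesis .
qed

lemma abs_divide_powr:
  fixes s :: real
  assumes "s > 0" shows "\<bar>x / s\<bar> powr h = \<bar>x\<bar> powr h * s powr (- h)"
proof -
  have "\<bar>x / s\<bar> = \<bar>x\<bar> / s" using assms by simp
  moreover have "(\<bar>x\<bar> / s) powr h = \<bar>x\<bar> powr h / s powr h" by (rule powr_divide)
  ultimately show ?thesis by (simp only: powr_minus divide_inverse)
qed

lemma three_term_split:
  fixes x r t p q e b v :: complex
  assumes "x = r * (t * p)"
  shows "v - r * e * q * b = v - x + r * (t * (p - q * e)) + r * ((t - b) * (q * e))"
  unfolding assms by (simp add: algebra_simps)

text \<open>
  The pointwise form of the main approximation.  Here \<open>v\<close> is the value of the solution and \<open>w\<close> the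
  value of the profile at the same point of the moving frame, \<open>\<phi>\<close> the phase of the asymptotics of the
  solution and \<open>\<psi>\<close> the phase of the Fourier kernel.  Three errors are added: solution against
  asymptotics, \<open>w\<close> against its limit \<open>A0\<close>, and the phase against \<open>s x0\<^sup>2\<close>.  The Hoelder exponent
  exceeds \<open>a\<close> by \<open>1/8\<close>, which pays for the logarithm.
\<close>

lemma quintic_integrand_estimate:
  fixes v w A0 :: complex and s x x0 \<phi> \<psi> \<beta> M H a :: real
  assumes s: "s \<ge> 1" and M0: "M \<ge> 0" and H: "H \<ge> 0" and a: "a \<ge> 0"  "a \<le> 1 / 4"
    and v: "cmod v \<le> M * s powr (- 1 / 2)"
    and vd: "cmod (v - of_real (s powr (- 1 / 2)) * iexp \<phi> * w * iexp (- (\<beta> * (cmod w)\<^sup>2 * ln s)))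
       \<le> M * s powr (- 1 / 2 - a)"
    and M: "cmod w \<le> M" "cmod A0 \<le> M" and w: "cmod (w - A0) \<le> H * \<bar>x / s\<bar> powr (a + 1 / 8)"
    and ph: "\<psi> + \<phi> = s * x0\<^sup>2 - x * x0 + x\<^sup>2 / (4 * s)"
  shows "cmod (iexp \<psi> * quintic v -
       of_real (s powr (- 5 / 2)) * iexp (- (\<beta> * (cmod A0)\<^sup>2 * ln s)) * quintic A0 * iexp (s * x0\<^sup>2))
    \<le> (1 + \<bar>x\<bar>) * ((5 * M ^ 5 + 9 * H * (5 * M ^ 4 + 2 * M ^ 6 * \<bar>\<beta>\<bar>)) * s powr (- 5 / 2 - a)
        + M ^ 5 * (s powr (- 5 / 2) * \<bar>x0\<bar> + s powr (- 3)))"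
proof -
  let ?e = "\<lambda>w. iexp (- (\<beta> * (cmod w)\<^sup>2 * ln s))"
  let ?a0 = "of_real (s powr (- 1 / 2)) * iexp \<phi> * w * ?e w"
  let ?K = "5 * M ^ 4 + 2 * M ^ 6 * \<bar>\<beta>\<bar>"
  have s0: "s > 0" using s by simp
  have pw: "(s powr r) ^ n = s powr (r * real n)" for r n
    using s0 by (simp add: powr_realpow[symmetric] powr_powr)
  have p5: "(s powr (- 1 / 2)) ^ 5 = s powr (- 5 / 2)" and p4: "(s powr (- 1 / 2)) ^ 4 = s powr (- 2)"
    using pw[of "- 1 / 2" 5] pw[of "- 1 / 2" 4] by simp_all
  have c0: "cmod ?a0 \<le> M * s powr (- 1 / 2)"
    using mult_left_mono[OF M(1), of "s powr (- 1 / 2)"] by (simp add: norm_mult mult.commute)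
  have q0: "quintic ?a0 = of_real (s powr (- 5 / 2)) * (quintic w * (iexp \<phi> * ?e w))"
  proof -
    have e: "?a0 = of_real (s powr (- 1 / 2)) * w * (iexp \<phi> * ?e w)" by (simp only: mult_ac)
    have "cmod (iexp \<phi> * ?e w) = 1" by (simp only: norm_mult norm_exp_i_times mult_1_left)
    from quintic_scale[OF powr_ge_zero this, of s "- 1 / 2" w] show ?thesis unfolding e p5 .
  qed
  let ?\<theta> = "s * x0\<^sup>2 - x * x0 + x\<^sup>2 / (4 * s)"
  have split: "iexp \<psi> * quintic v - of_real (s powr (- 5 / 2)) * ?e A0 * quintic A0 * iexp (s * x0\<^sup>2)
    = iexp \<psi> * (quintic v - quintic ?a0)
      + of_real (s powr (- 5 / 2)) * (iexp ?\<theta> * (quintic w * ?e w - quintic A0 * ?e A0))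
      + of_real (s powr (- 5 / 2)) * ((iexp ?\<theta> - iexp (s * x0\<^sup>2)) * (quintic A0 * ?e A0))"
  proof -
    have e: "iexp \<psi> * iexp \<phi> = iexp ?\<theta>" unfolding ph[symmetric] by (simp add: distrib_left exp_add)
    have "iexp \<psi> * quintic ?a0 = of_real (s powr (- 5 / 2)) * ((iexp \<psi> * iexp \<phi>) * (quintic w * ?e w))"
      unfolding q0 by (simp only: mult_ac)
    also note e
    finally have q1: "iexp \<psi> * quintic ?a0 = of_real (s powr (- 5 / 2)) * (iexp ?\<theta> * (quintic w * ?e w))" .
    show ?thesis unfolding right_diff_distrib[of "iexp \<psi>"] by (rule three_term_split[OF q1])
  qed
  have t1: "cmod (iexp \<psi> * (quintic v - quintic ?a0)) \<le> 5 * M ^ 5 * s powr (- 5 / 2 - a)"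
  proof -
    have "cmod (iexp \<psi> * (quintic v - quintic ?a0)) = cmod (quintic v - quintic ?a0)" by (simp add: norm_mult)
    also have "\<dots> \<le> 5 * (M * s powr (- 1 / 2)) ^ 4 * cmod (v - ?a0)" by (rule quintic_diff_le[OF v c0])
    also have "\<dots> \<le> 5 * (M * s powr (- 1 / 2)) ^ 4 * (M * s powr (- 1 / 2 - a))"
      using M0 by (intro mult_left_mono vd) auto
    also have "\<dots> = 5 * M ^ 5 * (s powr (- 2) * s powr (- 1 / 2 - a))"
      unfolding power_mult_distrib p4 by (simp add: numeral_eq_Suc)
    also have "s powr (- 2) * s powr (- 1 / 2 - a) = s powr (- 5 / 2 - a)"
      unfolding powr_add[symmetric] by simp
    finally show ?thesis .
  qed
  \<comment> \<open>The Hoelder increment is absorbed by the first moment of the potential.\<close>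
  have xh: "\<bar>x\<bar> powr (a + 1 / 8) \<le> 1 + \<bar>x\<bar>"
  proof (cases "\<bar>x\<bar> \<le> 1")
    case True
    then have "\<bar>x\<bar> powr (a + 1 / 8) \<le> 1" using a by (intro powr_le1) auto
    then show ?thesis by linarith
  next
    case False
    then have "\<bar>x\<bar> powr (a + 1 / 8) \<le> \<bar>x\<bar> powr 1" using a by (intro powr_mono) auto
    then show ?thesis using False by simp
  qed
  have K0: "?K \<ge> 0" using M0 by auto
  have t2: "cmod (of_real (s powr (- 5 / 2)) * (iexp ?\<theta> * (quintic w * ?e w - quintic A0 * ?e A0)))
     \<le> (1 + \<bar>x\<bar>) * (9 * H * ?K * s powr (- 5 / 2 - a))"
  proof -
    have "cmod (quintic w * ?e w - quintic A0 * ?e A0) \<le> ?K * (1 + ln s) * cmod (w - A0)"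
      using s by (intro phased_quintic_diff_le M) simp
    also have "\<dots> \<le> ?K * (9 * s powr (1 / 8)) * (H * (\<bar>x\<bar> powr (a + 1 / 8) * s powr (- (a + 1 / 8))))"
    proof (intro mult_mono mult_left_mono log_absorb s K0)
      have "\<bar>x / s\<bar> powr (a + 1 / 8) = \<bar>x\<bar> powr (a + 1 / 8) * s powr (- (a + 1 / 8))"
        by (rule abs_divide_powr[OF s0])
      then show "cmod (w - A0) \<le> H * (\<bar>x\<bar> powr (a + 1 / 8) * s powr (- (a + 1 / 8)))" using w by simp
    qed (use K0 ln_ge_zero[OF s] in auto)
    also have "\<dots> \<le> ?K * (9 * s powr (1 / 8)) * (H * ((1 + \<bar>x\<bar>) * s powr (- (a + 1 / 8))))"
      using K0 H by (intro mult_left_mono mult_right_mono xh) auto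
    also have "\<dots> = (1 + \<bar>x\<bar>) * (9 * H * ?K * (s powr (1 / 8) * s powr (- (a + 1 / 8))))"
      by (simp only: mult_ac)
    also have "s powr (1 / 8) * s powr (- (a + 1 / 8)) = s powr (- a)" unfolding powr_add[symmetric] by simp
    finally have "cmod (quintic w * ?e w - quintic A0 * ?e A0) \<le> (1 + \<bar>x\<bar>) * (9 * H * ?K * s powr (- a))" .
    from mult_left_mono[OF this, of "s powr (- 5 / 2)"]
    have "cmod (of_real (s powr (- 5 / 2)) * (iexp ?\<theta> * (quintic w * ?e w - quintic A0 * ?e A0)))
      \<le> s powr (- 5 / 2) * ((1 + \<bar>x\<bar>) * (9 * H * ?K * s powr (- a)))"
      by (simp only: norm_mult norm_exp_i_times norm_of_real abs_of_nonneg powr_ge_zero mult_1_left)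
    also have "\<dots> = (1 + \<bar>x\<bar>) * (9 * H * ?K * (s powr (- 5 / 2) * s powr (- a)))" by (simp only: mult_ac)
    also have "s powr (- 5 / 2) * s powr (- a) = s powr (- 5 / 2 - a)" unfolding powr_add[symmetric] by simp
    finally show ?thesis .
  qed
  have t3: "cmod (of_real (s powr (- 5 / 2)) * ((iexp ?\<theta> - iexp (s * x0\<^sup>2)) * (quintic A0 * ?e A0)))
     \<le> (1 + \<bar>x\<bar>) * (M ^ 5 * (s powr (- 5 / 2) * \<bar>x0\<bar> + s powr (- 3)))"
  proof -
    have "cmod (iexp ?\<theta> - iexp (s * x0\<^sup>2)) \<le> cmod (iexp ?\<theta> - iexp (s * x0\<^sup>2 - x * x0)) + cmod (iexp (s * x0\<^sup>2 - x * x0) - iexp (s * x0\<^sup>2))"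
      using norm_triangle_ineq[of "iexp ?\<theta> - iexp (s * x0\<^sup>2 - x * x0)" "iexp (s * x0\<^sup>2 - x * x0) - iexp (s * x0\<^sup>2)"] by simp
    also have "\<dots> \<le> \<bar>x\<bar> / sqrt s + \<bar>x * x0\<bar>"
      using iexp_diff_le_sqrt[OF s0, of "s * x0\<^sup>2 - x * x0" x] iexp_diff_le[of "s * x0\<^sup>2 - x * x0" "s * x0\<^sup>2"]
      by (intro add_mono) auto
    also have "\<dots> = \<bar>x\<bar> * (\<bar>x0\<bar> + s powr (- 1 / 2))"
    proof -
      have "s powr (- 1 / 2) = 1 / sqrt s"
        using powr_minus_divide[of s "1 / 2"] powr_half_sqrt[of s] s0 by simp
      then show ?thesis unfolding abs_mult by (simp only: distrib_left) simp
    qed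
    also have "\<dots> \<le> (1 + \<bar>x\<bar>) * (\<bar>x0\<bar> + s powr (- 1 / 2))" by (intro mult_right_mono) auto
    finally have 1: "cmod (iexp ?\<theta> - iexp (s * x0\<^sup>2)) \<le> (1 + \<bar>x\<bar>) * (\<bar>x0\<bar> + s powr (- 1 / 2))" .
    have 2: "cmod (quintic A0 * ?e A0) \<le> M ^ 5"
      using power_mono[OF M(2), of 5] by (simp add: norm_mult cmod_quintic)
    have "cmod (of_real (s powr (- 5 / 2)) * ((iexp ?\<theta> - iexp (s * x0\<^sup>2)) * (quintic A0 * ?e A0)))
      = s powr (- 5 / 2) * (cmod (iexp ?\<theta> - iexp (s * x0\<^sup>2)) * cmod (quintic A0 * ?e A0))"
      by (simp only: norm_mult norm_of_real abs_of_nonneg powr_ge_zero)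
    also have "\<dots> \<le> s powr (- 5 / 2) * ((1 + \<bar>x\<bar>) * (\<bar>x0\<bar> + s powr (- 1 / 2)) * M ^ 5)"
      by (intro mult_left_mono mult_mono 1 2) auto
    also have "\<dots> = (1 + \<bar>x\<bar>) * (M ^ 5 * (s powr (- 5 / 2) * \<bar>x0\<bar> + s powr (- 5 / 2) * s powr (- 1 / 2)))"
      by (simp only: distrib_left distrib_right mult_ac add_ac mult_1_left mult_1_right)
    also have "s powr (- 5 / 2) * s powr (- 1 / 2) = s powr (- 3)" unfolding powr_add[symmetric] by simp
    finally show ?thesis .
  qed
  have t1': "cmod (iexp \<psi> * (quintic v - quintic ?a0)) \<le> (1 + \<bar>x\<bar>) * (5 * M ^ 5 * s powr (- 5 / 2 - a))"
    using t1 mult_right_mono[of 1 "1 + \<bar>x\<bar>" "5 * M ^ 5 * s powr (- 5 / 2 - a)"] M0 by simp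
  have "cmod (iexp \<psi> * quintic v - of_real (s powr (- 5 / 2)) * ?e A0 * quintic A0 * iexp (s * x0\<^sup>2))
    \<le> (1 + \<bar>x\<bar>) * (5 * M ^ 5 * s powr (- 5 / 2 - a)) + (1 + \<bar>x\<bar>) * (9 * H * ?K * s powr (- 5 / 2 - a))
      + (1 + \<bar>x\<bar>) * (M ^ 5 * (s powr (- 5 / 2) * \<bar>x0\<bar> + s powr (- 3)))"
    unfolding split by (intro norm_triangle_mono t1' t2 t3)
  also have "\<dots> = (1 + \<bar>x\<bar>) * ((5 * M ^ 5 + 9 * H * ?K) * s powr (- 5 / 2 - a)
        + M ^ 5 * (s powr (- 5 / 2) * \<bar>x0\<bar> + s powr (- 3)))"
    by (simp only: distrib_left distrib_right add.assoc mult.assoc)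
  finally show ?thesis .
qed

section \<open>The tail of the renormalized profile\<close>

text \<open>
  The uniform bound on the transforms comes from the growth estimate of the $H^1$-norm, continuity in
  $L^1$ from continuity in \<open>Sigma_space\<close>.
\<close>

lemma solution_regular_curve:
  assumes c: "continuous_in_Sigma u" and b: "small_data_bounds C \<epsilon> \<delta> u"
    and C: "C * \<epsilon> \<ge> 0" and d: "\<delta> \<ge> 0"
  shows "regular_curve u"
  unfolding regular_curve_def
proof (intro conjI allI impI)
  have S: "Sigma_space (u s)" if "s \<ge> 1" for s using c that by (simp add: continuous_in_Sigma_def)
  fix T :: real
  obtain K where K: "K > 0" "\<And>f. Sigma_space f \<Longrightarrow> fourier_L1_bound f (K * Hs_norm 1 f)"
    using Sigma_fourier_L1_bound by blast
  have "fourier_L1_bound (u s) (K * (C * \<epsilon> * T powr \<delta>))" if s: "s \<in> {1..T}" for s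
  proof (rule fourier_L1_bound_mono)
    show "fourier_L1_bound (u s) (K * Hs_norm 1 (u s))" using S s by (intro K) auto
    have "Hs_norm 1 (u s) + L2_norm (galilei s (u s)) \<le> C * \<epsilon> * s powr \<delta>"
      using b s by (auto simp: small_data_bounds_def)
    then have "Hs_norm 1 (u s) \<le> C * \<epsilon> * s powr \<delta>"
      using L2_norm_nonneg[of "galilei s (u s)"] by linarith
    also have "\<dots> \<le> C * \<epsilon> * T powr \<delta>" using s d by (intro mult_left_mono powr_mono2 C) auto
    finally show "K * Hs_norm 1 (u s) \<le> K * (C * \<epsilon> * T powr \<delta>)" using K(1) by (intro mult_left_mono) auto
  qed
  then show "\<exists>B. \<forall>s\<in>{1..T}. fourier_L1_bound (u s) B" by blast
next
  have S: "Sigma_space (u s)" if "s \<ge> 1" for s using c that by (simp add: continuous_in_Sigma_def)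
  obtain K where K: "K > 0" "\<And>f. Sigma_space f \<Longrightarrow> (LINT x|lborel. cmod (f x)) \<le> K * Sigma_norm f"
    using Sigma_L1_norm_le by blast
  fix t :: real assume t: "t \<ge> 1"
  have "((\<lambda>s. Sigma_norm (\<lambda>y. u s y - u t y)) \<longlongrightarrow> 0) (at t within {1..})"
    using c t by (simp add: continuous_in_Sigma_def)
  then have R: "((\<lambda>s. K * Sigma_norm (\<lambda>y. u s y - u t y)) \<longlongrightarrow> 0) (at t within {1..})"
    by (rule tendsto_mult_right_zero)
  show "((\<lambda>s. LINT y|lborel. cmod (u s y - u t y)) \<longlongrightarrow> 0) (at t within {1..})"
  proof (rule tendsto_sandwich[OF _ _ tendsto_const R])
    show "\<forall>\<^sub>F s in at t within {1..}. 0 \<le> (LINT y|lborel. cmod (u s y - u t y))"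
      by (intro always_eventually allI integral_nonneg_AE) simp
    have "\<forall>\<^sub>F s in at t within {1..}. s \<in> {1..}" by (simp add: eventually_at_filter)
    then show "\<forall>\<^sub>F s in at t within {1..}. (LINT y|lborel. cmod (u s y - u t y)) \<le> K * Sigma_norm (\<lambda>y. u s y - u t y)"
      by eventually_elim (intro K Sigma_diff S t, simp)
  qed
qed

lemma regular_curve_phase_continuous:
  assumes N: "regular_curve N"
  shows "continuous_on {1..} (\<lambda>s. iexp (s * z\<^sup>2) * fourier (N s) z)"
  by (intro continuous_intros regular_curve_fourier_continuous_time[OF N])

lemma regular_curve_phase_set_integrable:
  assumes N: "regular_curve N"
  shows "set_integrable lborel {1..t} (\<lambda>s. iexp (s * z\<^sup>2) * fourier (N s) z)"
  by (intro borel_integrable_atLeastAtMost' continuous_on_subset[OF regular_curve_phase_continuous[OF N]]) auto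

text \<open>
  The cubic part of the Duhamel integral is what the definition of the renormalized profile adds
  with the opposite sign.
\<close>

lemma renormalized_profile_eq:
  assumes W: "potential W" and u: "regular_curve u" and mild: "mild_solution \<beta> \<gamma> W u" and t: "t \<ge> 1"
  shows "renormalized_profile \<beta> u t z = iexp (z\<^sup>2) * fourier (u 1) z +
      \<i> * (LINT s:{1..t}|lborel. iexp (s * z\<^sup>2) * fourier (moving_quintic \<gamma> W u s) z)"
proof -
  let ?c = "\<lambda>s. iexp (s * z\<^sup>2) * fourier (cubic (u s)) z"
  let ?q = "\<lambda>s. iexp (s * z\<^sup>2) * fourier (moving_quintic \<gamma> W u s) z"
  note C = regular_curve_cubic[OF u] and Q = regular_curve_moving_quintic[OF W u, of \<gamma>]
  have "iexp (t * z\<^sup>2) * fourier (u t) z = iexp (z\<^sup>2) * fourier (u 1) z +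
      \<i> * (LINT s:{1..t}|lborel. iexp (s * z\<^sup>2) * fourier (nonlinearity \<beta> \<gamma> W s (u s)) z)"
    by (rule duhamel_profile[OF regular_curve_nonlinearity[OF W u] u t])
       (use mild t in \<open>simp add: mild_solution_def\<close>)
  also have "(LINT s:{1..t}|lborel. iexp (s * z\<^sup>2) * fourier (nonlinearity \<beta> \<gamma> W s (u s)) z)
     = (LINT s:{1..t}|lborel. (- of_real \<beta>) * ?c s + ?q s)"
  proof (rule set_lebesgue_integral_cong)
    show "\<forall>s. s \<in> {1..t} \<longrightarrow> iexp (s * z\<^sup>2) * fourier (nonlinearity \<beta> \<gamma> W s (u s)) z = (- of_real \<beta>) * ?c s + ?q s"
    proof (intro allI impI)
      fix s assume "s \<in> {1..t}"
      then have s: "s \<ge> 1" by simp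
      have n: "nonlinearity \<beta> \<gamma> W s (u s) = (\<lambda>y. (- of_real \<beta>) * cubic (u s) y + moving_quintic \<gamma> W u s y)"
        by (simp add: nonlinearity_def moving_quintic_def quintic_def fun_eq_iff)
      have "fourier (nonlinearity \<beta> \<gamma> W s (u s)) z
         = (- of_real \<beta>) * fourier (cubic (u s)) z + fourier (moving_quintic \<gamma> W u s) z"
        unfolding n
        by (subst fourier_add[OF integrable_mult_right[OF regular_curve_integrable(1)[OF C s]] regular_curve_integrable(1)[OF Q s]])
           (simp only: fourier_cmult)
      then show "iexp (s * z\<^sup>2) * fourier (nonlinearity \<beta> \<gamma> W s (u s)) z = (- of_real \<beta>) * ?c s + ?q s"
        by (simp only: distrib_left mult_ac)
    qed
  qed simp
  also have "\<dots> = (- of_real \<beta>) * (LINT s:{1..t}|lborel. ?c s) + (LINT s:{1..t}|lborel. ?q s)"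
    using regular_curve_phase_set_integrable[OF C, of t z] regular_curve_phase_set_integrable[OF Q, of t z]
    by (subst set_integral_add) (simp_all only: set_integral_mult_right set_integrable_mult_right simp_thms)
  finally show ?thesis unfolding renormalized_profile_def by (simp add: algebra_simps)
qed

text \<open>
  The integrand is dominated by the integrable function \<open>|m| + e\<close>, so the increments of the profile
  converge to the integral over all later times, and the main term may be subtracted
  inside it.
\<close>

lemma profile_tail:
  fixes m :: "real \<Rightarrow> complex" and e :: "real \<Rightarrow> real"
  assumes W: "potential W" and u: "regular_curve u" and mild: "mild_solution \<beta> \<gamma> W u" and T: "T \<ge> 1"
    and P: "uniform_limit UNIV (renormalized_profile \<beta> u) P at_top"
    and m: "set_integrable lborel {T..} m" and e: "set_integrable lborel {T..} e"
    and le: "\<And>s. s \<ge> T \<Longrightarrow> cmod (iexp (s * z\<^sup>2) * fourier (moving_quintic \<gamma> W u s) z - m s) \<le> e s"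
  shows "cmod (P z - renormalized_profile \<beta> u T z - \<i> * (LINT s:{T..}|lborel. m s)) \<le> (LINT s:{T..}|lborel. e s)"
proof -
  let ?q = "\<lambda>s. iexp (s * z\<^sup>2) * fourier (moving_quintic \<gamma> W u s) z"
  note Q = regular_curve_moving_quintic[OF W u, of \<gamma>]
  have cq: "continuous_on {1..} ?q" by (rule regular_curve_phase_continuous[OF Q])
  have qm: "(\<lambda>s. indicator {a..} s *\<^sub>R ?q s) \<in> borel_measurable borel"
    "(\<lambda>s. indicator {a..b} s *\<^sub>R ?q s) \<in> borel_measurable borel" if "a \<ge> 1" for a b
  proof -
    have c: "continuous_on {a..} ?q" "continuous_on {a..b} ?q"
      by (rule continuous_on_subset[OF cq]; use that in auto)+
    show "(\<lambda>s. indicator {a..} s *\<^sub>R ?q s) \<in> borel_measurable borel"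
      by (rule borel_measurable_continuous_on_indicator[OF _ c(1)]) simp
    show "(\<lambda>s. indicator {a..b} s *\<^sub>R ?q s) \<in> borel_measurable borel"
      by (rule borel_measurable_continuous_on_indicator[OF _ c(2)]) simp
  qed
  \<comment> \<open>Measurability in time comes from continuity of the transform, integrability from the comparison with \<open>m\<close>.\<close>
  have qi: "set_integrable lborel {T..} ?q"
    unfolding set_integrable_def
  proof (rule Bochner_Integration.integrable_bound)
    show "integrable lborel (\<lambda>s. norm (indicator {T..} s *\<^sub>R m s) + indicator {T..} s *\<^sub>R e s)"
      using m e unfolding set_integrable_def by (intro Bochner_Integration.integrable_add integrable_norm)
    show "(\<lambda>s. indicator {T..} s *\<^sub>R ?q s) \<in> borel_measurable lborel" using qm(1)[OF T] by simp
    show "AE s in lborel. norm (indicator {T..} s *\<^sub>R ?q s)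
        \<le> norm (norm (indicator {T..} s *\<^sub>R m s) + indicator {T..} s *\<^sub>R e s)"
    proof (rule AE_I2)
      fix s
      show "norm (indicator {T..} s *\<^sub>R ?q s)
        \<le> norm (norm (indicator {T..} s *\<^sub>R m s) + indicator {T..} s *\<^sub>R e s)"
      proof (cases "s \<ge> T")
        case True
        have "cmod (?q s) \<le> cmod (m s) + cmod (?q s - m s)" using norm_triangle_sub by blast
        also have "\<dots> \<le> cmod (m s) + e s" using le[OF True] by simp
        finally have "cmod (?q s) \<le> \<bar>cmod (m s) + e s\<bar>" by linarith
        then show ?thesis using True by simp
      next
        case False
        then show ?thesis by simp
      qed
    qed
  qed
  have diff: "renormalized_profile \<beta> u t z - renormalized_profile \<beta> u T z = \<i> * (LINT s:{T..t}|lborel. ?q s)" if t: "t \<ge> T" for t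
  proof -
    have "(LINT s:{1..t}|lborel. ?q s) = (LINT s|lborel. indicator {1..T} s *\<^sub>R ?q s + indicator {T..t} s *\<^sub>R ?q s)"
      unfolding set_lebesgue_integral_def
    proof (rule integral_cong_AE)
      show "AE s in lborel. indicator {1..t} s *\<^sub>R ?q s = indicator {1..T} s *\<^sub>R ?q s + indicator {T..t} s *\<^sub>R ?q s"
        using AE_lborel_singleton[of T] by eventually_elim (use t T in \<open>auto simp: indicator_def\<close>)
    qed (use qm(2)[of 1] qm(2)[OF T] in auto)
    also have "\<dots> = (LINT s:{1..T}|lborel. ?q s) + (LINT s:{T..t}|lborel. ?q s)"
      unfolding set_lebesgue_integral_def
    proof (rule Bochner_Integration.integral_add)
      show "integrable lborel (\<lambda>s. indicator {1..T} s *\<^sub>R ?q s)"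
        using regular_curve_phase_set_integrable[OF Q, of T z] unfolding set_integrable_def .
      have "set_integrable lborel {T..t} ?q" by (rule set_integrable_subset[OF qi]) auto
      then show "integrable lborel (\<lambda>s. indicator {T..t} s *\<^sub>R ?q s)" unfolding set_integrable_def .
    qed
    finally show ?thesis
      using renormalized_profile_eq[OF W u mild, of t z] renormalized_profile_eq[OF W u mild T, of z] t T
      by (simp add: distrib_left)
  qed
  have lim1: "((\<lambda>t. LINT s:{T..t}|lborel. ?q s) \<longlongrightarrow> (LINT s:{T..}|lborel. ?q s)) at_top"
    unfolding set_lebesgue_integral_def
  proof (rule integral_dominated_convergence_at_top)
    show "(\<lambda>s. indicator {T..} s *\<^sub>R ?q s) \<in> borel_measurable lborel"
      "(\<lambda>s. indicator {T..t} s *\<^sub>R ?q s) \<in> borel_measurable lborel" for t using qm[OF T] by auto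
    show "integrable lborel (\<lambda>s. norm (indicator {T..} s *\<^sub>R ?q s))"
      using qi unfolding set_integrable_def by (rule integrable_norm)
    show "\<forall>\<^sub>F t in at_top. AE s in lborel. norm (indicator {T..t} s *\<^sub>R ?q s) \<le> norm (indicator {T..} s *\<^sub>R ?q s)"
      by (intro always_eventually allI AE_I2) (auto simp: indicator_def)
    show "AE s in lborel. ((\<lambda>t. indicator {T..t} s *\<^sub>R ?q s) \<longlongrightarrow> indicator {T..} s *\<^sub>R ?q s) at_top"
    proof (rule AE_I2)
      fix s
      have "\<forall>\<^sub>F t in at_top. indicator {T..t} s *\<^sub>R ?q s = indicator {T..} s *\<^sub>R ?q s"
        using eventually_ge_at_top[of s] by eventually_elim (auto simp: indicator_def)
      then show "((\<lambda>t. indicator {T..t} s *\<^sub>R ?q s) \<longlongrightarrow> indicator {T..} s *\<^sub>R ?q s) at_top"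
        by (rule tendsto_eventually)
    qed
  qed
  have "((\<lambda>t. renormalized_profile \<beta> u t z) \<longlongrightarrow> P z) at_top" by (rule tendsto_uniform_limitI[OF P]) simp
  then have "((\<lambda>t. renormalized_profile \<beta> u t z - renormalized_profile \<beta> u T z) \<longlongrightarrow> P z - renormalized_profile \<beta> u T z) at_top"
    by (intro tendsto_intros)
  moreover have "\<forall>\<^sub>F t in at_top. renormalized_profile \<beta> u t z - renormalized_profile \<beta> u T z = \<i> * (LINT s:{T..t}|lborel. ?q s)"
    using eventually_ge_at_top[of T] by eventually_elim (rule diff)
  ultimately have "((\<lambda>t. \<i> * (LINT s:{T..t}|lborel. ?q s)) \<longlongrightarrow> P z - renormalized_profile \<beta> u T z) at_top"
    by (rule Lim_transform_eventually)
  from tendsto_unique[OF trivial_limit_at_top_linorder this tendsto_mult_left[OF lim1]]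
  have "P z - renormalized_profile \<beta> u T z = \<i> * (LINT s:{T..}|lborel. ?q s)" .
  then have "P z - renormalized_profile \<beta> u T z - \<i> * (LINT s:{T..}|lborel. m s)
     = \<i> * ((LINT s:{T..}|lborel. ?q s) - (LINT s:{T..}|lborel. m s))"
    by (simp only: right_diff_distrib)
  then have "cmod (P z - renormalized_profile \<beta> u T z - \<i> * (LINT s:{T..}|lborel. m s))
     = cmod ((LINT s:{T..}|lborel. ?q s) - (LINT s:{T..}|lborel. m s))" by (simp add: norm_mult)
  also have "\<dots> = cmod (LINT s:{T..}|lborel. ?q s - m s)"
    by (simp only: set_integral_diff(2)[OF qi m])
  also have "\<dots> \<le> (LINT s:{T..}|lborel. cmod (?q s - m s))"
    by (intro set_integral_norm_bound set_integral_diff(1) qi m)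
  also have "\<dots> \<le> (LINT s:{T..}|lborel. e s)"
  proof (rule set_integral_mono[OF _ e])
    show "set_integrable lborel {T..} (\<lambda>s. cmod (?q s - m s))"
      by (intro set_integrable_norm set_integral_diff(1) qi m)
    show "cmod (?q s - m s) \<le> e s" if "s \<in> {T..}" for s by (rule le) (use that in simp)
  qed
  finally show ?thesis .
qed

text \<open>
  The translation \<open>y = x - \<gamma>s\<close> freezes the potential.  At the frequency \<open>-\<gamma>/2 + x0\<close> the sum of the
  kernel phase and of the asymptotic phase \<open>y\<^sup>2/(4s)\<close> is \<open>s x0\<^sup>2 - x x0 + x\<^sup>2/(4s)\<close>, so that
  \<open>quintic_integrand_estimate\<close> applies for almost every \<open>x\<close>.
\<close>

lemma moving_quintic_fourier_estimate:
  fixes A :: "real \<Rightarrow> complex"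
  assumes W: "potential W" and u: "regular_curve u" and s: "s \<ge> 1" and M: "M \<ge> 0" and H: "H \<ge> 0"
    and a: "a \<ge> 0" "a \<le> 1 / 4"
    and v: "AE y in lborel. cmod (u s y) \<le> M * s powr (- 1 / 2)"
    and vd: "AE y in lborel. cmod (u s y - scattering_ansatz \<beta> A s y) \<le> M * s powr (- 1 / 2 - a)"
    and A: "continuous_on UNIV A" "\<And>x. cmod (A x) \<le> M"
    and AH: "\<And>x y. cmod (A x - A y) \<le> H * \<bar>x - y\<bar> powr (a + 1 / 8)"
  shows "cmod (iexp (s * (- \<gamma> / 2 + x0)\<^sup>2) * fourier (moving_quintic \<gamma> W u s) (- \<gamma> / 2 + x0) -
       of_real (LINT x|lborel. W x) *
       (of_real (s powr (- 5 / 2)) * iexp (- (\<beta> * (cmod (A (- \<gamma>)))\<^sup>2 * ln s)) * quintic (A (- \<gamma>)) * iexp (s * x0\<^sup>2)))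
    \<le> (LINT x|lborel. \<bar>W x\<bar> * (1 + \<bar>x\<bar>)) * ((5 * M ^ 5 + 9 * H * (5 * M ^ 4 + 2 * M ^ 6 * \<bar>\<beta>\<bar>)) * s powr (- 5 / 2 - a)
        + M ^ 5 * (s powr (- 5 / 2) * \<bar>x0\<bar> + s powr (- 3)))"
proof -
  let ?z = "- \<gamma> / 2 + x0"
  define m where "m = of_real (s powr (- 5 / 2)) * iexp (- (\<beta> * (cmod (A (- \<gamma>)))\<^sup>2 * ln s)) * quintic (A (- \<gamma>)) * iexp (s * x0\<^sup>2)"
  define E where "E = (5 * M ^ 5 + 9 * H * (5 * M ^ 4 + 2 * M ^ 6 * \<bar>\<beta>\<bar>)) * s powr (- 5 / 2 - a)
        + M ^ 5 * (s powr (- 5 / 2) * \<bar>x0\<bar> + s powr (- 3))"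
  let ?\<psi> = "\<lambda>y. s * ?z\<^sup>2 - ?z * y"
  let ?f = "\<lambda>x. iexp (?\<psi> (x - \<gamma> * s)) * (of_real (W x) * quintic (u s (x - \<gamma> * s)))"
  note Q = regular_curve_moving_quintic[OF W u, of \<gamma>]
  have cW: "continuous_on UNIV W" and iW: "integrable lborel (\<lambda>x. \<bar>W x\<bar> * (1 + \<bar>x\<bar>))"
    using potential_bounds[OF W] by blast+
  have [measurable]: "W \<in> borel_measurable borel" "A \<in> borel_measurable borel" "u s \<in> borel_measurable borel"
    using cW A(1) regular_curve_integrable(3)[OF u s] by (auto intro: borel_measurable_continuous_onI)
  have Wi: "integrable lborel W"
  proof (rule Bochner_Integration.integrable_bound[OF iW])
    show "AE x in lborel. norm (W x) \<le> norm (\<bar>W x\<bar> * (1 + \<bar>x\<bar>))"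
      by (intro AE_I2) (simp add: abs_mult distrib_left)
  qed simp
  have Wm: "integrable lborel (\<lambda>x. of_real (W x) * m)"
    by (intro integrable_mult_left integrable_of_real Wi)
  have q: "iexp (?\<psi> y) * moving_quintic \<gamma> W u s y = iexp (s * ?z\<^sup>2) * (iexp (- (?z * y)) * moving_quintic \<gamma> W u s y)" for y
  proof -
    have "iexp (?\<psi> y) = iexp (s * ?z\<^sup>2) * iexp (- (?z * y))" by (simp only: exp_add[symmetric] of_real_add[symmetric] distrib_left[symmetric] diff_conv_add_uminus)
    then show ?thesis by (simp only: mult.assoc)
  qed
  have iq: "integrable lborel (\<lambda>y. iexp (?\<psi> y) * moving_quintic \<gamma> W u s y)"
    by (intro integrable_iexp_mult regular_curve_integrable(1)[OF Q s]) measurable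
  have aff: "iexp (?\<psi> (- \<gamma> * s + 1 * x)) * moving_quintic \<gamma> W u s (- \<gamma> * s + 1 * x) = ?f x" for x
    by (simp add: moving_quintic_def)
  have fi: "integrable lborel ?f"
    using lborel_integrable_real_affine[OF iq, of 1 "- \<gamma> * s"] unfolding aff by simp
  have "iexp (s * ?z\<^sup>2) * fourier (moving_quintic \<gamma> W u s) ?z = (LINT y|lborel. iexp (?\<psi> y) * moving_quintic \<gamma> W u s y)"
    unfolding fourier_def q by (simp only: integral_mult_right_zero)
  also have "\<dots> = (LINT x|lborel. ?f x)"
    using lborel_integral_real_affine[of 1 "\<lambda>y. iexp (?\<psi> y) * moving_quintic \<gamma> W u s y" "- \<gamma> * s"] unfolding aff by simp
  finally have 1: "iexp (s * ?z\<^sup>2) * fourier (moving_quintic \<gamma> W u s) ?z = (LINT x|lborel. ?f x)" .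
  have 2: "of_real (LINT x|lborel. W x) * m = (LINT x|lborel. of_real (W x) * m)" by simp
  let ?P = "\<lambda>y. cmod (u s y) \<le> M * s powr (- 1 / 2) \<and> cmod (u s y - scattering_ansatz \<beta> A s y) \<le> M * s powr (- 1 / 2 - a)"
  have "AE x in lborel. ?P (- \<gamma> * s + 1 * x)"
  proof (rule AE_borel_affine)
    show "AE y in lborel. ?P y" using v vd by eventually_elim simp
    show "Measurable.pred borel ?P" unfolding scattering_ansatz_def by measurable
  qed simp
  then have ae: "AE x in lborel. cmod (?f x - of_real (W x) * m) \<le> \<bar>W x\<bar> * (1 + \<bar>x\<bar>) * E"
  proof eventually_elim
    case (elim x)
    let ?y = "x - \<gamma> * s"
    have y: "- \<gamma> * s + 1 * x = ?y" by simp
    have s0: "s > 0" using s by simp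
    have yw: "?y / s - (- \<gamma>) = x / s" using s0 by (simp add: field_simps)
    have ph: "?\<psi> ?y + ?y\<^sup>2 / (4 * s) = s * x0\<^sup>2 - x * x0 + x\<^sup>2 / (4 * s)"
      using s0 by (simp add: field_simps power2_eq_square)
    have "cmod (iexp (?\<psi> ?y) * quintic (u s ?y) - m) \<le> (1 + \<bar>x\<bar>) * E"
      unfolding m_def E_def
    proof (rule quintic_integrand_estimate[OF s M H a _ _ A(2) A(2) _ ph])
      show "cmod (u s ?y) \<le> M * s powr (- 1 / 2)" using elim unfolding y by simp
      show "cmod (u s ?y - of_real (s powr (- 1 / 2)) * iexp (?y\<^sup>2 / (4 * s)) * A (?y / s) * iexp (- (\<beta> * (cmod (A (?y / s)))\<^sup>2 * ln s)))
         \<le> M * s powr (- 1 / 2 - a)"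
        using elim unfolding y scattering_ansatz_def by blast
      show "cmod (A (?y / s) - A (- \<gamma>)) \<le> H * \<bar>x / s\<bar> powr (a + 1 / 8)"
        using AH[of "?y / s" "- \<gamma>"] unfolding yw .
    qed
    from mult_left_mono[OF this, of "\<bar>W x\<bar>"]
    have "cmod (of_real (W x) * (iexp (?\<psi> ?y) * quintic (u s ?y) - m)) \<le> \<bar>W x\<bar> * ((1 + \<bar>x\<bar>) * E)"
      by (simp only: norm_mult norm_of_real abs_ge_zero simp_thms)
    moreover have "of_real (W x) * (iexp (?\<psi> ?y) * quintic (u s ?y) - m) = ?f x - of_real (W x) * m"
      by (simp only: right_diff_distrib mult_ac)
    ultimately show ?case by (simp only: mult.assoc)
  qed
  have "cmod ((LINT x|lborel. ?f x) - (LINT x|lborel. of_real (W x) * m)) = cmod (LINT x|lborel. ?f x - of_real (W x) * m)"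
    by (simp only: Bochner_Integration.integral_diff[OF fi Wm])
  also have "\<dots> \<le> (LINT x|lborel. cmod (?f x - of_real (W x) * m))" by (rule integral_norm_bound)
  also have "\<dots> \<le> (LINT x|lborel. \<bar>W x\<bar> * (1 + \<bar>x\<bar>) * E)"
    by (rule integral_mono_AE[OF integrable_norm[OF Bochner_Integration.integrable_diff[OF fi Wm]] integrable_mult_left[OF iW] ae])
  also have "\<dots> = (LINT x|lborel. \<bar>W x\<bar> * (1 + \<bar>x\<bar>)) * E" by (rule integral_mult_left_zero)
  finally show ?thesis unfolding 1 2[symmetric] m_def[symmetric] E_def[symmetric] .
qed

section \<open>The edge integral\<close>

text \<open>
  The integrand of the edge integral with exponent \<open>q\<close> in place of \<open>5/2\<close>.  Written as one
  exponential it can be differentiated by the chain rule.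
\<close>

definition oscillating_power :: "real \<Rightarrow> real \<Rightarrow> real \<Rightarrow> real \<Rightarrow> complex" where
  "oscillating_power q \<alpha> \<eta> \<tau> = exp (of_real (ln \<tau>) * - (of_real q + \<i> * of_real \<alpha>) + of_real \<tau> * (\<i> * of_real (\<eta>\<^sup>2)))"

lemma cmod_oscillating_power: "\<tau> > 0 \<Longrightarrow> cmod (oscillating_power q \<alpha> \<eta> \<tau>) = \<tau> powr (- q)"
  by (simp add: oscillating_power_def powr_def mult.commute)

lemma oscillating_power_eq:
  assumes "\<tau> > 0"
  shows "oscillating_power q \<alpha> \<eta> \<tau> = of_real (\<tau> powr (- q)) * iexp (- (\<alpha> * ln \<tau>)) * iexp (\<eta>\<^sup>2 * \<tau>)"
proof -
  have "of_real (ln \<tau>) * - (of_real q + \<i> * of_real \<alpha>) + of_real \<tau> * (\<i> * of_real (\<eta>\<^sup>2))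
    = of_real (- q * ln \<tau>) + \<i> * of_real (- (\<alpha> * ln \<tau>)) + \<i> * of_real (\<eta>\<^sup>2 * \<tau>)"
    by (simp add: algebra_simps)
  then show ?thesis using assms unfolding oscillating_power_def by (simp only: exp_add exp_of_real powr_def) simp
qed

lemma oscillating_power_measurable [measurable]: "oscillating_power q \<alpha> \<eta> \<in> borel_measurable borel"
  unfolding oscillating_power_def[abs_def] by measurable

lemma oscillating_power_integrable:
  assumes "q > 1"
  shows "set_integrable lborel {1..} (oscillating_power q \<alpha> \<eta>)"
    and "cmod (LINT \<tau>:{1..}|lborel. oscillating_power q \<alpha> \<eta> \<tau>) \<le> 1 / (q - 1)"
proof -
  have p: "has_bochner_integral lborel (\<lambda>s. indicator {1..} s * s powr (- q)) (1 / (q - 1))"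
    using powr_tail[OF assms, of 1] by simp
  then have i: "integrable lborel (\<lambda>s. indicator {1..} s * s powr (- q))" by (rule integrable.intros)
  show 1: "set_integrable lborel {1..} (oscillating_power q \<alpha> \<eta>)"
    unfolding set_integrable_def
    by (rule Bochner_Integration.integrable_bound[OF i])
       (auto simp: indicator_def cmod_oscillating_power)
  have "cmod (LINT \<tau>:{1..}|lborel. oscillating_power q \<alpha> \<eta> \<tau>) \<le> (LINT \<tau>:{1..}|lborel. cmod (oscillating_power q \<alpha> \<eta> \<tau>))"
    by (rule set_integral_norm_bound[OF 1])
  also have "\<dots> = (LINT s|lborel. indicator {1..} s * s powr (- q))"
    unfolding set_lebesgue_integral_def
    by (intro Bochner_Integration.integral_cong refl) (auto simp: indicator_def cmod_oscillating_power)
  also have "\<dots> = 1 / (q - 1)" using p by (rule has_bochner_integral_integral_eq)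
  finally show "cmod (LINT \<tau>:{1..}|lborel. oscillating_power q \<alpha> \<eta> \<tau>) \<le> 1 / (q - 1)" .
qed

lemma edge_integral_eq: "edge_integral \<alpha> \<eta> = (LINT \<tau>:{1..}|lborel. oscillating_power (5 / 2) \<alpha> \<eta> \<tau>)"
  unfolding edge_integral_def
proof (rule set_lebesgue_integral_cong)
  show "\<forall>\<tau>. \<tau> \<in> {1..} \<longrightarrow> of_real \<tau> powr (- 5 / 2 - \<i> * of_real \<alpha>) * iexp (\<eta>\<^sup>2 * \<tau>) = oscillating_power (5 / 2) \<alpha> \<eta> \<tau>"
  proof (intro allI impI)
    fix \<tau> :: real assume "\<tau> \<in> {1..}"
    then have \<tau>: "\<tau> > 0" by simp
    have "complex_of_real \<tau> powr (- 5 / 2 - \<i> * of_real \<alpha>) = exp (of_real (ln \<tau>) * - (of_real (5 / 2) + \<i> * of_real \<alpha>))"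
    proof -
      have "(- 5 / 2 - \<i> * of_real \<alpha>) * of_real (ln \<tau>) = of_real (ln \<tau>) * - (of_real (5 / 2) + \<i> * of_real \<alpha>)"
        by (simp add: algebra_simps)
      moreover have "complex_of_real \<tau> powr w = exp (w * of_real (ln \<tau>))" for w
        using \<tau> by (simp add: powr_def Ln_of_real)
      ultimately show ?thesis by (simp only:)
    qed
    moreover have "iexp (\<eta>\<^sup>2 * \<tau>) = exp (of_real \<tau> * (\<i> * of_real (\<eta>\<^sup>2)))" by (simp add: mult_ac)
    ultimately show "of_real \<tau> powr (- 5 / 2 - \<i> * of_real \<alpha>) * iexp (\<eta>\<^sup>2 * \<tau>) = oscillating_power (5 / 2) \<alpha> \<eta> \<tau>"
      unfolding oscillating_power_def by (simp only: exp_add)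
  qed
qed simp

text \<open>
  The derivative of the integrand is \<open>\<i>\<eta>\<^sup>2\<close> times itself minus \<open>q + \<i>\<alpha>\<close> times the integrand with
  exponent \<open>q + 1\<close>.
\<close>

lemma oscillating_power_by_parts:
  assumes q: "q > 1"
  shows "\<i> * of_real (\<eta>\<^sup>2) * (LINT \<tau>:{1..}|lborel. oscillating_power q \<alpha> \<eta> \<tau>)
    = - iexp (\<eta>\<^sup>2) + (of_real q + \<i> * of_real \<alpha>) * (LINT \<tau>:{1..}|lborel. oscillating_power (q + 1) \<alpha> \<eta> \<tau>)"
proof -
  let ?F = "oscillating_power q \<alpha> \<eta>"
  let ?c = "of_real q + \<i> * of_real \<alpha> :: complex"
  let ?G = "\<lambda>\<tau>. \<i> * of_real (\<eta>\<^sup>2) * ?F \<tau> - ?c * oscillating_power (q + 1) \<alpha> \<eta> \<tau>"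
  have sh: "oscillating_power (q + 1) \<alpha> \<eta> \<tau> = of_real (1 / \<tau>) * ?F \<tau>" if "\<tau> > 0" for \<tau>
    using that unfolding oscillating_power_eq[OF that]
    by (simp add: powr_diff powr_minus divide_inverse powr_add)
  have d: "(?F has_vector_derivative ?G x) (at x)" if x: "x > 1" for x
  proof -
    let ?h = "\<lambda>\<tau>. of_real (ln \<tau>) * - ?c + of_real \<tau> * (\<i> * of_real (\<eta>\<^sup>2))"
    have "(ln has_real_derivative 1 / x) (at x)" using x by (intro DERIV_ln_divide) simp
    then have l: "((\<lambda>\<tau>. complex_of_real (ln \<tau>)) has_vector_derivative of_real (1 / x)) (at x)"
      by (intro bounded_linear.has_vector_derivative[OF bounded_linear_of_real])
         (simp add: has_real_derivative_iff_has_vector_derivative)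
    have i: "((\<lambda>\<tau>. complex_of_real \<tau>) has_vector_derivative of_real 1) (at x)"
      by (intro bounded_linear.has_vector_derivative[OF bounded_linear_of_real] has_vector_derivative_id)
    have "(?h has_vector_derivative of_real (1 / x) * - ?c + of_real 1 * (\<i> * of_real (\<eta>\<^sup>2))) (at x)"
      by (intro has_vector_derivative_add has_vector_derivative_mult_left l i)
    from field_vector_diff_chain_at[OF this DERIV_exp]
    have "(?F has_vector_derivative (of_real (1 / x) * - ?c + of_real 1 * (\<i> * of_real (\<eta>\<^sup>2))) * exp (?h x)) (at x)"
      by (simp add: o_def oscillating_power_def[abs_def])
    moreover have "(of_real (1 / x) * - ?c + of_real 1 * (\<i> * of_real (\<eta>\<^sup>2))) * exp (?h x) = ?G x"
      using sh[of x] x unfolding oscillating_power_def[of q, symmetric] by (simp add: algebra_simps add_divide_distrib)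
    ultimately show ?thesis by (rule has_vector_derivative_eq_rhs)
  qed
  have cF: "isCont (oscillating_power r \<alpha> \<eta>) x" if "x > 0" for r x
    unfolding oscillating_power_def[abs_def] using that by (intro continuous_intros) auto
  note I = oscillating_power_integrable(1)[OF q, of \<alpha> \<eta>] oscillating_power_integrable(1)[of "q + 1" \<alpha> \<eta>]
  have I2: "set_integrable lborel {1..} (oscillating_power (q + 1) \<alpha> \<eta>)" using I(2) q by simp
  have IG: "set_integrable lborel {1..} ?G"
    by (intro set_integral_diff(1) set_integrable_mult_right) (use I(1) I2 in auto)
  have ei: "einterval (ereal 1) \<infinity> = {1<..}" by (auto simp: einterval_def)
  have "(LBINT x=ereal 1..\<infinity>. ?G x) = 0 - ?F 1"
  proof (rule interval_integral_FTC_integrable[where F="?F"])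
    show "set_integrable lborel (einterval (ereal 1) \<infinity>) ?G"
      unfolding ei by (rule set_integrable_subset[OF IG]) auto
    show "((?F \<circ> real_of_ereal) \<longlongrightarrow> ?F 1) (at_right (ereal 1))"
      unfolding ereal_tendsto_simps using cF[of 1 q] by (auto simp: isCont_def intro: tendsto_within_subset)
    have t0: "((\<lambda>x. x powr (- q)) \<longlongrightarrow> 0) at_top"
      using q by (intro tendsto_neg_powr filterlim_ident) auto
    have "(?F \<longlongrightarrow> 0) at_top"
    proof (rule Lim_null_comparison[OF _ t0])
      show "\<forall>\<^sub>F x in at_top. norm (?F x) \<le> x powr (- q)"
        using eventually_gt_at_top[of 0] by eventually_elim (simp add: cmod_oscillating_power)
    qed
    then show "((?F \<circ> real_of_ereal) \<longlongrightarrow> 0) (at_left \<infinity>)" unfolding ereal_tendsto_simps .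
  next
    fix x assume "ereal 1 < ereal x"
    then have x: "x > 1" by simp
    show "(?F has_vector_derivative ?G x) (at x)" by (rule d[OF x])
    show "isCont ?G x" using x by (intro continuous_intros cF) auto
  qed simp
  then have "(LINT x:{1<..}|lborel. ?G x) = - ?F 1"
    by (simp add: interval_lebesgue_integral_def ei)
  also have "(LINT x:{1<..}|lborel. ?G x) = (LINT x:{1..}|lborel. ?G x)"
    unfolding set_lebesgue_integral_def
  proof (rule integral_cong_AE)
    show "AE x in lborel. indicator {1<..} x *\<^sub>R ?G x = indicator {1..} x *\<^sub>R ?G x"
      using AE_lborel_singleton[of 1] by eventually_elim (auto simp: indicator_def)
  qed measurable
  also have "\<dots> = \<i> * of_real (\<eta>\<^sup>2) * (LINT x:{1..}|lborel. ?F x) - ?c * (LINT x:{1..}|lborel. oscillating_power (q + 1) \<alpha> \<eta> x)"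
    using set_integral_diff(2)[of lborel "{1..}" "\<lambda>x. \<i> * of_real (\<eta>\<^sup>2) * ?F x" "\<lambda>x. ?c * oscillating_power (q + 1) \<alpha> \<eta> x"]
      I(1) I2 by (simp only: set_integral_mult_right set_integrable_mult_right simp_thms)
  finally have "\<i> * of_real (\<eta>\<^sup>2) * (LINT x:{1..}|lborel. ?F x) = - ?F 1 + ?c * (LINT x:{1..}|lborel. oscillating_power (q + 1) \<alpha> \<eta> x)"
    by (simp only: diff_eq_eq)
  moreover have "?F 1 = iexp (\<eta>\<^sup>2)" by (simp add: oscillating_power_def)
  ultimately show ?thesis by simp
qed

text \<open>
  Two integrations by parts: the first yields the leading term, the second shows that the
  remaining integral with exponent \<open>7/2\<close> is itself of order \<open>1 / \<eta>\<^sup>2\<close>.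
\<close>

lemma edge_integral_expansion:
  obtains K where "K > 0"
    "\<And>\<eta>. \<eta> \<noteq> 0 \<Longrightarrow> cmod (edge_integral \<alpha> \<eta> - \<i> * iexp (\<eta>\<^sup>2) / of_real (\<eta>\<^sup>2)) \<le> K / \<bar>\<eta>\<bar> ^ 4"
proof -
  let ?J = "\<lambda>q \<eta>. LINT \<tau>:{1..}|lborel. oscillating_power q \<alpha> \<eta> \<tau>"
  let ?c = "\<lambda>q. of_real q + \<i> * of_real \<alpha> :: complex"
  define K where "K = cmod (?c (5 / 2)) * (1 + cmod (?c (7 / 2)) * (2 / 7)) + 1"
  have K: "K > 0" unfolding K_def by (intro add_nonneg_pos mult_nonneg_nonneg add_nonneg_nonneg) auto
  have "cmod (edge_integral \<alpha> \<eta> - \<i> * iexp (\<eta>\<^sup>2) / of_real (\<eta>\<^sup>2)) \<le> K / \<bar>\<eta>\<bar> ^ 4" if "\<eta> \<noteq> 0" for \<eta>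
  proof -
    have e: "\<eta>\<^sup>2 > 0" using that by simp
    have 1: "\<i> * of_real (\<eta>\<^sup>2) * edge_integral \<alpha> \<eta> = - iexp (\<eta>\<^sup>2) + ?c (5 / 2) * ?J (7 / 2) \<eta>"
      using oscillating_power_by_parts[of "5 / 2" \<eta> \<alpha>] unfolding edge_integral_eq by simp
    have 2: "\<i> * of_real (\<eta>\<^sup>2) * ?J (7 / 2) \<eta> = - iexp (\<eta>\<^sup>2) + ?c (7 / 2) * ?J (9 / 2) \<eta>"
      using oscillating_power_by_parts[of "7 / 2" \<eta> \<alpha>] by simp
    have J: "cmod (?J (9 / 2) \<eta>) \<le> 2 / 7" using oscillating_power_integrable(2)[of "9 / 2" \<alpha> \<eta>] by simp
    have "\<eta>\<^sup>2 * cmod (?J (7 / 2) \<eta>) = cmod (\<i> * of_real (\<eta>\<^sup>2) * ?J (7 / 2) \<eta>)"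
      by (simp only: norm_mult norm_of_real norm_ii abs_power2 mult_1_left)
    also have "\<dots> \<le> cmod (- iexp (\<eta>\<^sup>2)) + cmod (?c (7 / 2) * ?J (9 / 2) \<eta>)"
      unfolding 2 by (rule norm_triangle_ineq)
    also have "\<dots> \<le> 1 + cmod (?c (7 / 2)) * (2 / 7)"
      unfolding norm_mult norm_minus_cancel norm_exp_i_times by (intro add_left_mono mult_left_mono J) simp
    finally have 3: "\<eta>\<^sup>2 * cmod (?J (7 / 2) \<eta>) \<le> 1 + cmod (?c (7 / 2)) * (2 / 7)" .
    have "\<i> * of_real (\<eta>\<^sup>2) * (edge_integral \<alpha> \<eta> - \<i> * iexp (\<eta>\<^sup>2) / of_real (\<eta>\<^sup>2))
       = \<i> * of_real (\<eta>\<^sup>2) * edge_integral \<alpha> \<eta> + iexp (\<eta>\<^sup>2)"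
      using that by (simp add: right_diff_distrib field_simps)
    also have "\<dots> = ?c (5 / 2) * ?J (7 / 2) \<eta>" unfolding 1 by simp
    finally have 4: "\<i> * of_real (\<eta>\<^sup>2) * (edge_integral \<alpha> \<eta> - \<i> * iexp (\<eta>\<^sup>2) / of_real (\<eta>\<^sup>2)) = ?c (5 / 2) * ?J (7 / 2) \<eta>" .
    let ?D = "edge_integral \<alpha> \<eta> - \<i> * iexp (\<eta>\<^sup>2) / of_real (\<eta>\<^sup>2)"
    have 5: "\<eta>\<^sup>2 * cmod ?D = cmod (?c (5 / 2)) * cmod (?J (7 / 2) \<eta>)"
      using arg_cong[OF 4, of cmod] by (simp only: norm_mult norm_of_real norm_ii abs_power2 mult_1_left)
    have "\<bar>\<eta>\<bar> ^ 4 * cmod ?D = \<eta>\<^sup>2 * (\<eta>\<^sup>2 * cmod ?D)"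
      by (simp flip: power_add mult.assoc)
    also have "\<dots> = cmod (?c (5 / 2)) * (\<eta>\<^sup>2 * cmod (?J (7 / 2) \<eta>))" unfolding 5 by (simp only: mult_ac)
    also have "\<dots> \<le> cmod (?c (5 / 2)) * (1 + cmod (?c (7 / 2)) * (2 / 7))" by (intro mult_left_mono 3) simp
    also have "\<dots> \<le> K" unfolding K_def by simp
    finally have "\<bar>\<eta>\<bar> ^ 4 * cmod ?D \<le> K" .
    moreover have "\<bar>\<eta>\<bar> ^ 4 > 0" using that by simp
    ultimately show ?thesis by (simp only: pos_le_divide_eq mult.commute)
  qed
  then show ?thesis using that K by blast
qed

text \<open>
  The scaling \<open>s = T\<tau>\<close>; the factor \<open>T\<close> to \<open>-3/2 - \<i>\<alpha>\<close> is the one removed by the normalization in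
  the theorem.
\<close>

lemma main_term_integral:
  assumes T: "T > 0"
  shows "set_integrable lborel {T..} (\<lambda>s. c * (of_real (s powr (- 5 / 2)) * iexp (- (\<alpha> * ln s)) * Q * iexp (s * (\<eta> / sqrt T)\<^sup>2)))"
    and "(LINT s:{T..}|lborel. c * (of_real (s powr (- 5 / 2)) * iexp (- (\<alpha> * ln s)) * Q * iexp (s * (\<eta> / sqrt T)\<^sup>2)))
      = c * of_real (T powr (- 3 / 2)) * iexp (- (\<alpha> * ln T)) * Q * edge_integral \<alpha> \<eta>"
proof -
  let ?m = "\<lambda>s. c * (of_real (s powr (- 5 / 2)) * iexp (- (\<alpha> * ln s)) * Q * iexp (s * (\<eta> / sqrt T)\<^sup>2))"
  let ?k = "c * of_real (T powr (- 5 / 2)) * iexp (- (\<alpha> * ln T)) * Q"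
  have eq: "indicator {T..} (0 + T * x) *\<^sub>R ?m (0 + T * x) = ?k * (indicator {1..} x *\<^sub>R oscillating_power (5 / 2) \<alpha> \<eta> x)" for x
  proof (cases "x \<ge> 1")
    case True
    have i: "indicator {T..} (0 + T * x) = (1::real)" "indicator {1..} x = (1::real)" using True T by auto
    have x: "x > 0" using True by simp
    have p: "(T * x) powr (- 5 / 2) = T powr (- 5 / 2) * x powr (- (5 / 2))" using T x by (simp add: powr_mult)
    have l: "ln (T * x) = ln T + ln x" using T x by (simp add: ln_mult)
    have r: "T * x * (\<eta> / sqrt T)\<^sup>2 = \<eta>\<^sup>2 * x" using T by (simp add: power_divide)
    have e: "iexp (- (\<alpha> * (ln T + ln x))) = iexp (- (\<alpha> * ln T)) * iexp (- (\<alpha> * ln x))"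
      by (simp add: algebra_simps flip: exp_add)
    show ?thesis
      unfolding i scaleR_one unfolding add_0_left p l r e oscillating_power_eq[OF x] of_real_mult by (simp only: mult_ac)
  next
    case False
    then show ?thesis using T by simp
  qed
  have io: "integrable lborel (\<lambda>x. indicator {1..} x *\<^sub>R oscillating_power (5 / 2) \<alpha> \<eta> x)"
    using oscillating_power_integrable(1)[of "5 / 2" \<alpha> \<eta>] unfolding set_integrable_def by simp
  have "integrable lborel (\<lambda>x. indicator {T..} (0 + T * x) *\<^sub>R ?m (0 + T * x))"
    unfolding eq by (rule integrable_mult_right[OF io])
  then show "set_integrable lborel {T..} ?m"
    unfolding set_integrable_def
    using lborel_integrable_real_affine_iff[of T "\<lambda>s. indicator {T..} s *\<^sub>R ?m s" 0] T by simp
  have "(LINT s:{T..}|lborel. ?m s) = T *\<^sub>R (LINT x|lborel. indicator {T..} (0 + T * x) *\<^sub>R ?m (0 + T * x))"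
    unfolding set_lebesgue_integral_def using T by (subst lborel_integral_real_affine[where c=T and t=0]) auto
  also have "\<dots> = of_real T * (?k * edge_integral \<alpha> \<eta>)"
    unfolding eq edge_integral_eq set_lebesgue_integral_def by (simp only: integral_mult_right_zero scaleR_conv_of_real)
  also have "\<dots> = c * of_real (T * T powr (- 5 / 2)) * iexp (- (\<alpha> * ln T)) * Q * edge_integral \<alpha> \<eta>"
    by (simp only: of_real_mult mult_ac)
  also have "T * T powr (- 5 / 2) = T powr (- 3 / 2)"
    using T powr_add[of T 1 "- 5 / 2"] by simp
  finally show "(LINT s:{T..}|lborel. ?m s) = c * of_real (T powr (- 3 / 2)) * iexp (- (\<alpha> * ln T)) * Q * edge_integral \<alpha> \<eta>" .
qed

section \<open>The edge layer\<close>

text \<open>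
  The pointwise error in \<open>s\<close> is integrated over \<open>s \<ge> T\<close>: the powers \<open>-5/2 - a\<close>, \<open>-5/2\<close> and \<open>-3\<close> gain
  one each, and the normalizing factor \<open>T\<close> to \<open>3/2\<close> leaves \<open>-a\<close>, \<open>0\<close> and \<open>-1/2\<close>.
\<close>

lemma edge_profile_estimate:
  fixes A P :: "real \<Rightarrow> complex"
  assumes W: "potential W" and u: "regular_curve u" and mild: "mild_solution \<beta> \<gamma> W u"
    and P: "uniform_limit UNIV (renormalized_profile \<beta> u) P at_top"
    and M: "M \<ge> 0" and H: "H \<ge> 0" and a: "a \<ge> 0" "a \<le> 1 / 4"
    and v: "\<And>s. s \<ge> 1 \<Longrightarrow> AE y in lborel. cmod (u s y) \<le> M * s powr (- 1 / 2)"
    and vd: "\<And>s. s \<ge> 1 \<Longrightarrow> AE y in lborel. cmod (u s y - scattering_ansatz \<beta> A s y) \<le> M * s powr (- 1 / 2 - a)"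
    and A: "continuous_on UNIV A" "\<And>x. cmod (A x) \<le> M"
    and AH: "\<And>x y. cmod (A x - A y) \<le> H * \<bar>x - y\<bar> powr (a + 1 / 8)"
    and \<alpha>: "\<alpha> = \<beta> * (cmod (A (- \<gamma>)))\<^sup>2"
  obtains K where "K \<ge> 0" "\<And>T \<eta>. T \<ge> 1 \<Longrightarrow>
      cmod (of_real (T powr (3 / 2)) * iexp (\<alpha> * ln T) *
           (P (- \<gamma> / 2 + \<eta> / sqrt T) - renormalized_profile \<beta> u T (- \<gamma> / 2 + \<eta> / sqrt T))
         - \<i> * of_real (LINT x|lborel. W x) * of_real ((cmod (A (- \<gamma>))) ^ 4) * A (- \<gamma>) * edge_integral \<alpha> \<eta>)
      \<le> K * (T powr (- a) + \<bar>\<eta>\<bar> / sqrt T + T powr (- 1 / 2))"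
proof -
  define Q where "Q = quintic (A (- \<gamma>))"
  define M0 where "M0 = complex_of_real (LINT x|lborel. W x)"
  define KW where "KW = (LINT x|lborel. \<bar>W x\<bar> * (1 + \<bar>x\<bar>))"
  define K1 where "K1 = 5 * M ^ 5 + 9 * H * (5 * M ^ 4 + 2 * M ^ 6 * \<bar>\<beta>\<bar>)"
  have KW: "KW \<ge> 0" unfolding KW_def by (intro integral_nonneg_AE) simp
  have K1: "K1 \<ge> 0" unfolding K1_def using M H by auto
  have M5: "M ^ 5 \<ge> 0" using M by simp
  define K where "K = KW * (K1 + M ^ 5)"
  have K: "K \<ge> 0" unfolding K_def using KW K1 M5 by auto
  have main: "cmod (of_real (T powr (3 / 2)) * iexp (\<alpha> * ln T) *
           (P (- \<gamma> / 2 + \<eta> / sqrt T) - renormalized_profile \<beta> u T (- \<gamma> / 2 + \<eta> / sqrt T))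
         - \<i> * M0 * Q * edge_integral \<alpha> \<eta>)
      \<le> K * (T powr (- a) + \<bar>\<eta>\<bar> / sqrt T + T powr (- 1 / 2))" if T: "T \<ge> 1" for T \<eta>
  proof -
    have T0: "T > 0" using T by simp
    let ?x0 = "\<eta> / sqrt T"
    let ?z = "- \<gamma> / 2 + ?x0"
    let ?m = "\<lambda>s. M0 * (of_real (s powr (- 5 / 2)) * iexp (- (\<alpha> * ln s)) * Q * iexp (s * ?x0\<^sup>2))"
    let ?e = "\<lambda>s. KW * (K1 * s powr (- 5 / 2 - a) + M ^ 5 * (s powr (- 5 / 2) * \<bar>?x0\<bar> + s powr (- 3)))"
    let ?i = "\<lambda>s. indicator {T..} s :: real"
    let ?E = "KW * (K1 * (T powr (- 3 / 2 - a) / (3 / 2 + a)) + M ^ 5 * (T powr (- 3 / 2) / (3 / 2) * \<bar>?x0\<bar> + T powr (- 2) / 2))"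
    have t1: "has_bochner_integral lborel (\<lambda>s. ?i s * s powr (- 5 / 2 - a)) (T powr (- 3 / 2 - a) / (3 / 2 + a))"
    proof -
      have e: "- (5 / 2 + a) = - 5 / 2 - a" "1 - (5 / 2 + a) = - 3 / 2 - a" "5 / 2 + a - 1 = 3 / 2 + a" by simp_all
      have "5 / 2 + a > 1" using a by simp
      from powr_tail[OF this T0] show ?thesis unfolding e .
    qed
    have t2: "has_bochner_integral lborel (\<lambda>s. ?i s * s powr (- 5 / 2)) (T powr (- 3 / 2) / (3 / 2))"
      using powr_tail[of "5 / 2" T] T0 by simp
    have t3: "has_bochner_integral lborel (\<lambda>s. ?i s * s powr (- 3)) (T powr (- 2) / 2)"
      using powr_tail[of 3 T] T0 by simp
    have "has_bochner_integral lborel (\<lambda>s. KW * (K1 * (?i s * s powr (- 5 / 2 - a))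
        + M ^ 5 * (?i s * s powr (- 5 / 2) * \<bar>?x0\<bar> + ?i s * s powr (- 3)))) ?E"
      by (intro has_bochner_integral_mult_right has_bochner_integral_mult_left has_bochner_integral_add t1 t2 t3)
    moreover have "(\<lambda>s. KW * (K1 * (?i s * s powr (- 5 / 2 - a))
        + M ^ 5 * (?i s * s powr (- 5 / 2) * \<bar>?x0\<bar> + ?i s * s powr (- 3)))) = (\<lambda>s. ?i s *\<^sub>R ?e s)"
      by (simp add: algebra_simps)
    ultimately have he: "has_bochner_integral lborel (\<lambda>s. ?i s *\<^sub>R ?e s) ?E" by (simp only:)
    have e: "set_integrable lborel {T..} ?e" "(LINT s:{T..}|lborel. ?e s) = ?E"
      using he unfolding set_integrable_def set_lebesgue_integral_def by (simp_all add: has_bochner_integral_iff)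
    have le: "cmod (iexp (s * ?z\<^sup>2) * fourier (moving_quintic \<gamma> W u s) ?z - ?m s) \<le> ?e s" if "s \<ge> T" for s
    proof -
      have s: "s \<ge> 1" using that T by simp
      show ?thesis
        using moving_quintic_fourier_estimate[OF W u s M H a v[OF s] vd[OF s] A AH, of \<gamma> ?x0]
        unfolding \<alpha> Q_def M0_def KW_def K1_def .
    qed
    let ?D = "P ?z - renormalized_profile \<beta> u T ?z"
    let ?I = "LINT s:{T..}|lborel. ?m s"
    have "cmod (?D - \<i> * ?I) \<le> (LINT s:{T..}|lborel. ?e s)"
      by (rule profile_tail[OF W u mild T P main_term_integral(1)[OF T0] e(1) le])
    also have "\<dots> \<le> KW * (K1 * T powr (- 3 / 2 - a) + M ^ 5 * (T powr (- 3 / 2) * \<bar>?x0\<bar> + T powr (- 2)))"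
    proof -
      \<comment> \<open>The divisors that come from integrating the powers exceed 1 and are dropped.\<close>
      have "T powr (- 3 / 2 - a) / (3 / 2 + a) \<le> T powr (- 3 / 2 - a)" using a by (simp add: divide_le_eq mult_le_cancel_left1)
      moreover have "T powr (- 3 / 2) / (3 / 2) \<le> T powr (- 3 / 2)" by simp
      moreover have "T powr (- 2) / 2 \<le> T powr (- 2)" by simp
      ultimately show ?thesis unfolding e(2)
        by (intro mult_left_mono add_mono mult_right_mono KW K1 M5) auto
    qed
    finally have est: "cmod (?D - \<i> * ?I) \<le> KW * (K1 * T powr (- 3 / 2 - a) + M ^ 5 * (T powr (- 3 / 2) * \<bar>?x0\<bar> + T powr (- 2)))" .
    let ?t = "of_real (T powr (3 / 2)) * iexp (\<alpha> * ln T)"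
    have tp: "T powr (3 / 2) * T powr r = T powr (3 / 2 + r)" for r by (simp add: powr_add)
    have "?t * (\<i> * ?I) = \<i> * M0 * Q * edge_integral \<alpha> \<eta>"
    proof -
      have I: "?I = M0 * of_real (T powr (- 3 / 2)) * iexp (- (\<alpha> * ln T)) * Q * edge_integral \<alpha> \<eta>"
        by (rule main_term_integral(2)[OF T0])
      have c: "complex_of_real (T powr (3 / 2)) * of_real (T powr (- 3 / 2)) = 1"
        using tp[of "- 3 / 2"] T0 by (simp flip: of_real_mult)
      have d: "iexp (\<alpha> * ln T) * iexp (- (\<alpha> * ln T)) = 1" by (simp flip: exp_add)
      have "?t * (\<i> * ?I) = (complex_of_real (T powr (3 / 2)) * of_real (T powr (- 3 / 2))) *
         (iexp (\<alpha> * ln T) * iexp (- (\<alpha> * ln T))) * (\<i> * M0 * Q * edge_integral \<alpha> \<eta>)"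
        unfolding I by (simp only: mult_ac)
      then show ?thesis unfolding c d by simp
    qed
    then have "?t * ?D - \<i> * M0 * Q * edge_integral \<alpha> \<eta> = ?t * (?D - \<i> * ?I)"
      by (simp only: right_diff_distrib)
    then have "cmod (?t * ?D - \<i> * M0 * Q * edge_integral \<alpha> \<eta>) = T powr (3 / 2) * cmod (?D - \<i> * ?I)"
      by (simp only: norm_mult norm_of_real norm_exp_i_times abs_of_nonneg powr_ge_zero mult_1_right)
    also have "\<dots> \<le> T powr (3 / 2) * (KW * (K1 * T powr (- 3 / 2 - a) + M ^ 5 * (T powr (- 3 / 2) * \<bar>?x0\<bar> + T powr (- 2))))"
      by (intro mult_left_mono est) simp
    also have "\<dots> = KW * (K1 * (T powr (3 / 2) * T powr (- 3 / 2 - a)) + M ^ 5 * ((T powr (3 / 2) * T powr (- 3 / 2)) * \<bar>?x0\<bar> + T powr (3 / 2) * T powr (- 2)))"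
      by (simp only: distrib_left mult_ac)
    also have "\<dots> = KW * (K1 * T powr (- a) + M ^ 5 * (\<bar>?x0\<bar> + T powr (- 1 / 2)))"
      unfolding tp using T0 by simp
    also have "\<dots> \<le> KW * ((K1 + M ^ 5) * (T powr (- a) + \<bar>?x0\<bar> + T powr (- 1 / 2)))"
    proof (rule mult_left_mono[OF _ KW])
      have "0 \<le> K1 * (\<bar>?x0\<bar> + T powr (- 1 / 2)) + M ^ 5 * T powr (- a)" using K1 M5 by simp
      then show "K1 * T powr (- a) + M ^ 5 * (\<bar>?x0\<bar> + T powr (- 1 / 2)) \<le> (K1 + M ^ 5) * (T powr (- a) + \<bar>?x0\<bar> + T powr (- 1 / 2))"
        by (simp only: distrib_left distrib_right)
    qed
    also have "\<dots> = K * (T powr (- a) + \<bar>\<eta>\<bar> / sqrt T + T powr (- 1 / 2))"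
    proof -
      have "\<bar>?x0\<bar> = \<bar>\<eta>\<bar> / sqrt T" using T0 by simp
      then show ?thesis unfolding K_def by (simp only: mult.assoc)
    qed
    finally show ?thesis .
  qed
  show ?thesis
  proof (rule that[OF K])
    fix T \<eta> :: real assume "T \<ge> 1"
    from main[OF this, of \<eta>]
    show "cmod (of_real (T powr (3 / 2)) * iexp (\<alpha> * ln T) *
           (P (- \<gamma> / 2 + \<eta> / sqrt T) - renormalized_profile \<beta> u T (- \<gamma> / 2 + \<eta> / sqrt T))
         - \<i> * of_real (LINT x|lborel. W x) * of_real ((cmod (A (- \<gamma>))) ^ 4) * A (- \<gamma>) * edge_integral \<alpha> \<eta>)
      \<le> K * (T powr (- a) + \<bar>\<eta>\<bar> / sqrt T + T powr (- 1 / 2))"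
      unfolding M0_def Q_def quintic_def by (simp only: mult.assoc)
  qed
qed

lemma edge_integral_bigo:
  "(\<lambda>\<eta>. cmod (edge_integral \<alpha> \<eta> - \<i> * iexp (\<eta>\<^sup>2) / of_real (\<eta>\<^sup>2))) \<in> O[at_infinity](\<lambda>\<eta>. 1 / \<bar>\<eta>\<bar> ^ 4)"
proof -
  obtain K where K: "\<And>\<eta>. \<eta> \<noteq> 0 \<Longrightarrow> cmod (edge_integral \<alpha> \<eta> - \<i> * iexp (\<eta>\<^sup>2) / of_real (\<eta>\<^sup>2)) \<le> K / \<bar>\<eta>\<bar> ^ 4"
    using edge_integral_expansion by blast
  show ?thesis
  proof (rule bigoI[where c=K])
    have "\<forall>\<^sub>F \<eta> in at_infinity. (\<eta>::real) \<noteq> 0" by (rule eventually_not_equal_at_infinity)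
    then show "\<forall>\<^sub>F \<eta> in at_infinity. norm (cmod (edge_integral \<alpha> \<eta> - \<i> * iexp (\<eta>\<^sup>2) / of_real (\<eta>\<^sup>2))) \<le> K * norm (1 / \<bar>\<eta>\<bar> ^ 4)"
    proof eventually_elim
      case (elim \<eta>)
      then show ?case using K[OF elim] by (simp add: divide_inverse)
    qed
  qed
qed

text \<open>
  Once \<open>\<eta>\<^sup>2 \<ge> 2 K\<close>, the remainder of the expansion is at most half of the leading term.
\<close>

lemma edge_integral_two_sided:
  obtains \<eta>0 where "\<And>\<eta>. \<eta>0 \<le> \<bar>\<eta>\<bar> \<Longrightarrow> 1 / (2 * \<eta>\<^sup>2) \<le> cmod (edge_integral \<alpha> \<eta>) \<and> cmod (edge_integral \<alpha> \<eta>) \<le> 3 / (2 * \<eta>\<^sup>2)"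
proof -
  obtain K where K0: "K > 0" and K: "\<And>\<eta>. \<eta> \<noteq> 0 \<Longrightarrow> cmod (edge_integral \<alpha> \<eta> - \<i> * iexp (\<eta>\<^sup>2) / of_real (\<eta>\<^sup>2)) \<le> K / \<bar>\<eta>\<bar> ^ 4"
    using edge_integral_expansion by blast
  show ?thesis
  proof (rule that[of "sqrt (2 * K)"])
    fix \<eta> :: real assume \<eta>: "sqrt (2 * K) \<le> \<bar>\<eta>\<bar>"
    have "(sqrt (2 * K))\<^sup>2 \<le> \<bar>\<eta>\<bar>\<^sup>2" using K0 \<eta> by (intro power_mono) auto
    then have e: "2 * K \<le> \<eta>\<^sup>2" using K0 by simp
    then have e0: "\<eta>\<^sup>2 > 0" using K0 by linarith
    then have n0: "\<eta> \<noteq> 0" by auto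
    let ?d = "\<i> * iexp (\<eta>\<^sup>2) / of_real (\<eta>\<^sup>2)"
    have "K / \<bar>\<eta>\<bar> ^ 4 = K / (\<eta>\<^sup>2 * \<eta>\<^sup>2)" by (simp flip: power_add)
    also have "\<dots> \<le> (\<eta>\<^sup>2 / 2) / (\<eta>\<^sup>2 * \<eta>\<^sup>2)" using e e0 by (intro divide_right_mono) auto
    also have "\<dots> = 1 / (2 * \<eta>\<^sup>2)"
    proof -
      have "(x / 2) / (x * x) = 1 / (2 * x)" if "x > 0" for x :: real using that by (simp add: field_simps)
      from this[OF e0] show ?thesis .
    qed
    finally have 1: "cmod (edge_integral \<alpha> \<eta> - ?d) \<le> 1 / (2 * \<eta>\<^sup>2)" using K[OF n0] by linarith
    have 2: "cmod ?d = 2 * (1 / (2 * \<eta>\<^sup>2))" by (simp add: norm_divide norm_mult norm_power)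
    have "cmod ?d \<le> cmod (edge_integral \<alpha> \<eta>) + cmod (edge_integral \<alpha> \<eta> - ?d)"
      using norm_triangle_sub[of ?d "edge_integral \<alpha> \<eta>"] by (simp add: norm_minus_commute)
    moreover have "cmod (edge_integral \<alpha> \<eta>) \<le> cmod ?d + cmod (edge_integral \<alpha> \<eta> - ?d)"
      by (rule norm_triangle_sub)
    moreover have "3 / (2 * \<eta>\<^sup>2) = 3 * (1 / (2 * \<eta>\<^sup>2))" by simp
    ultimately show "1 / (2 * \<eta>\<^sup>2) \<le> cmod (edge_integral \<alpha> \<eta>) \<and> cmod (edge_integral \<alpha> \<eta>) \<le> 3 / (2 * \<eta>\<^sup>2)"
      using 1 2 by linarith
  qed
qed

lemma powr_sum_smallo_iff:
  "(\<lambda>T::real. T powr p + T powr q) \<in> o[at_top](\<lambda>T. T powr r) \<longleftrightarrow> p < r \<and> q < r"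
proof
  have iff: "(\<lambda>T::real. T powr x) \<in> o[at_top](\<lambda>T. T powr r) \<longleftrightarrow> x < r" for x
    by (rule powr_smallo_iff[OF filterlim_ident]) simp
  {
    assume S: "(\<lambda>T::real. T powr p + T powr q) \<in> o[at_top](\<lambda>T. T powr r)"
    have "(\<lambda>T::real. T powr p) \<in> O[at_top](\<lambda>T. T powr p + T powr q)"
      by (rule landau_o.big_mono) (auto intro!: always_eventually)
    moreover have "(\<lambda>T::real. T powr q) \<in> O[at_top](\<lambda>T. T powr p + T powr q)"
      by (rule landau_o.big_mono) (auto intro!: always_eventually)
    ultimately show "p < r \<and> q < r"
      using landau_o.big_small_trans[OF _ S] iff by blast
  }
  assume "p < r \<and> q < r"
  then show "(\<lambda>T::real. T powr p + T powr q) \<in> o[at_top](\<lambda>T. T powr r)"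
    using iff by (intro sum_in_smallo(1)) auto
qed

theorem theorem4p5:
  fixes \<beta> \<gamma> \<epsilon>0 C\<delta> C \<epsilon> \<zeta>0 \<alpha> M0 \<delta> a :: real
    and W :: "real \<Rightarrow> real"
    and u :: "real \<Rightarrow> real \<Rightarrow> complex"
    and A P_plus E Lim_prof :: "real \<Rightarrow> complex"
    and D :: "real \<Rightarrow> real \<Rightarrow> complex"
    and A0 :: complex
  assumes "potential W"
    and "small_data_theory \<beta> W \<epsilon>0 C\<delta> C"
    and "0 < \<epsilon>" and "\<epsilon> \<le> \<epsilon>0"
    and "global_solution \<beta> \<gamma> W u" and "Sigma_norm (u 1) \<le> \<epsilon>"
    and "\<delta> = C\<delta> * \<bar>\<beta>\<bar> * \<epsilon>\<^sup>2"
    and "scattering_profile \<beta> C \<epsilon> \<delta> u A" and "continuous_on UNIV A"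
    and "limit_profile \<beta> u P_plus"
    and "\<zeta>0 = - \<gamma> / 2"
    and "A0 = A (- \<gamma>)"
    and "\<alpha> = \<beta> * (cmod A0)\<^sup>2"
    and "M0 = (LINT x|lborel. W x)"
    and "a = 1 / 4 - 2 * \<delta>"
    and "\<And>\<eta>. Lim_prof \<eta> = \<i> * of_real M0 * of_real ((cmod A0) ^ 4) * A0 * edge_integral \<alpha> \<eta>"
    and "\<And>T \<eta>. D T \<eta> =
           of_real (T powr (3 / 2)) * iexp (\<alpha> * ln T) *
             (P_plus (\<zeta>0 + \<eta> / sqrt T) - renormalized_profile \<beta> u T (\<zeta>0 + \<eta> / sqrt T))
           - Lim_prof \<eta>"
  shows "a > 0 \<and>
    (\<forall>R>0. \<forall>\<kappa>. 0 \<le> \<kappa> \<and> \<kappa> < 1 / 2 \<longrightarrow>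
       (\<exists>K. \<forall>T\<ge>2. \<forall>\<eta>. \<bar>\<eta>\<bar> \<le> R * T powr \<kappa> \<longrightarrow>
          cmod (D T \<eta>) \<le> K * (T powr (- a) + T powr (- 1 / 2 + \<kappa>)))) \<and>
    (\<forall>b c. \<exists>K. \<forall>T\<ge>2. \<forall>\<eta>\<in>{b..c}. cmod (D T \<eta>) \<le> K * T powr (- a)) \<and>
    (\<lambda>\<eta>. cmod (edge_integral \<alpha> \<eta> - \<i> * iexp (\<eta>\<^sup>2) / of_real (\<eta>\<^sup>2)))
       \<in> O[at_infinity](\<lambda>\<eta>. 1 / \<bar>\<eta>\<bar> ^ 4) \<and>
    (\<exists>\<eta>0. \<forall>\<kappa> c1 c2. 0 \<le> \<kappa> \<and> \<kappa> < 1 / 2 \<and> 0 < c1 \<and> c1 \<le> c2 \<longrightarrow>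
       (\<exists>k1>0. \<exists>k2>0. \<forall>T\<ge>2. \<forall>\<eta>.
          \<eta>0 \<le> \<bar>\<eta>\<bar> \<and> c1 * T powr \<kappa> \<le> \<bar>\<eta>\<bar> \<and> \<bar>\<eta>\<bar> \<le> c2 * T powr \<kappa> \<longrightarrow>
            k1 * (\<bar>M0\<bar> * (cmod A0) ^ 5) * T powr (- 2 * \<kappa>) \<le> cmod (Lim_prof \<eta>) \<and>
            cmod (Lim_prof \<eta>) \<le> k2 * (\<bar>M0\<bar> * (cmod A0) ^ 5) * T powr (- 2 * \<kappa>))) \<and>
    (\<forall>\<kappa>. 0 \<le> \<kappa> \<and> \<kappa> < 1 / 2 \<longrightarrow>
       ((\<lambda>T. T powr (- a) + T powr (- 1 / 2 + \<kappa>)) \<in> o[at_top](\<lambda>T. T powr (- 2 * \<kappa>))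
          \<longleftrightarrow> 2 * \<kappa> < min a (1 / 2 - \<kappa>)) \<and>
       (2 * \<kappa> < min a (1 / 2 - \<kappa>) \<longleftrightarrow> \<kappa> < 1 / 8 - \<delta>))"
proof -
  note W = assms(1) and admissible = assms(2) and eps = assms(3,4) and sol = assms(5) and small = assms(6)
    and \<delta> = assms(7) and profile = assms(8) and contA = assms(9) and limit = assms(10)
    and \<zeta>0 = assms(11) and A0 = assms(12) and \<alpha> = assms(13) and M0 = assms(14) and a = assms(15)
    and Lim_prof = assms(16) and D = assms(17)
  have curve: "continuous_in_Sigma u" and mild: "mild_solution \<beta> \<gamma> W u"
    using sol by (auto simp: global_solution_def)
  have "Sigma_space (u 1)" using curve by (simp add: continuous_in_Sigma_def)
  then have data: "0 < \<epsilon> \<and> \<epsilon> \<le> \<epsilon>0 \<and> Sigma_space (u 1) \<and> Sigma_norm (u 1) \<le> \<epsilon>"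
    using eps small by simp
  have cpos: "C\<delta> > 0" "C > 0" using admissible by (auto simp: small_data_theory_def)
  have sol1: "global_solution \<beta> \<gamma> W u \<and> (AE y in lborel. u 1 y = u 1 y)" using sol by simp
  have "\<delta> < 1 / 16 \<and> (\<forall>v. global_solution \<beta> \<gamma> W v \<and> (AE y in lborel. v 1 y = u 1 y) \<longrightarrow>
      small_data_bounds C \<epsilon> \<delta> v \<and>
       (\<exists>A. scattering_profile \<beta> C \<epsilon> \<delta> v A \<and>
          (\<forall>B. scattering_profile \<beta> C \<epsilon> \<delta> v B \<longrightarrow> (AE x in lborel. B x = A x)) \<and> (\<forall>\<sigma><1 - 2 * \<delta>. Hs \<sigma> A)))"
    using admissible[unfolded small_data_theory_def Let_def] data unfolding \<delta> by blast
  with sol1 have "\<delta> < 1 / 16 \<and> small_data_bounds C \<epsilon> \<delta> u \<and>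
       (\<exists>A. (\<forall>B. scattering_profile \<beta> C \<epsilon> \<delta> u B \<longrightarrow> (AE x in lborel. B x = A x)) \<and> (\<forall>\<sigma><1 - 2 * \<delta>. Hs \<sigma> A))"
    by blast
  \<comment> \<open>The assumptions give a profile \<open>A'\<close> that is unique up to null sets; \<open>A\<close> is its continuous version.\<close>
  then obtain A' where \<delta>1: "\<delta> < 1 / 16" and bounds: "small_data_bounds C \<epsilon> \<delta> u"
    and AA': "AE x in lborel. A x = A' x" and Hs: "\<And>\<sigma>. \<sigma> < 1 - 2 * \<delta> \<Longrightarrow> Hs \<sigma> A'"
    using profile by blast
  have \<delta>0: "\<delta> \<ge> 0" unfolding \<delta> using cpos by simp
  have a0: "a > 1 / 8" and a1: "a \<le> 1 / 4" using \<delta>0 \<delta>1 unfolding a by auto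
  have apos: "a > 0" using a0 by linarith
  define M where "M = C * \<epsilon>"
  have M: "M \<ge> 0" unfolding M_def using cpos eps by simp
  have u: "regular_curve u"
    by (rule solution_regular_curve[OF curve bounds _ \<delta>0]) (use M M_def in simp)
  have v: "AE y in lborel. cmod (u s y) \<le> M * s powr (- 1 / 2)" if "s \<ge> 1" for s
    using bounds that unfolding small_data_bounds_def M_def by (intro Linf_AE) auto
  have vd: "AE y in lborel. cmod (u s y - scattering_ansatz \<beta> A s y) \<le> M * s powr (- 1 / 2 - a)" if "s \<ge> 1" for s
  proof -
    have "- 1 / 2 - a = - 3 / 4 + 2 * \<delta>" unfolding a by simp
    then show ?thesis
      using profile that unfolding scattering_profile_def Let_def M_def by (intro Linf_AE) auto
  qed
  have AM: "cmod (A x) \<le> M" for x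
  proof (rule AE_le_continuous[OF contA])
    have "Linf A" "L2_norm A + Linf_norm A \<le> M" using profile by (auto simp: scattering_profile_def M_def)
    then have "Linf_norm A \<le> M" using L2_norm_nonneg[of A] by linarith
    then show "AE x in lborel. cmod (A x) \<le> M" using \<open>Linf A\<close> by (intro Linf_AE)
  qed
  \<comment> \<open>With \<open>\<sigma> = 15/16 - 2\<delta>\<close> the order \<open>a + 1/8 = 3/8 - 2\<delta>\<close> lies below \<open>\<sigma> - 1/2 = 7/16 - 2\<delta>\<close>.\<close>
  have "Hs (15 / 16 - 2 * \<delta>) A'" by (rule Hs) simp
  then obtain H where H: "H \<ge> 0" "\<And>x y. cmod (A x - A y) \<le> H * \<bar>x - y\<bar> powr (a + 1 / 8)"
    by (rule Hs_Hoelder[OF _ contA AA', where h = "a + 1 / 8"]) (use apos a1 a in auto)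
  obtain K where K: "K \<ge> 0" "\<And>T \<eta>. T \<ge> 1 \<Longrightarrow>
      cmod (of_real (T powr (3 / 2)) * iexp (\<alpha> * ln T) *
           (P_plus (- \<gamma> / 2 + \<eta> / sqrt T) - renormalized_profile \<beta> u T (- \<gamma> / 2 + \<eta> / sqrt T))
         - \<i> * of_real (LINT x|lborel. W x) * of_real ((cmod (A (- \<gamma>))) ^ 4) * A (- \<gamma>) * edge_integral \<alpha> \<eta>)
      \<le> K * (T powr (- a) + \<bar>\<eta>\<bar> / sqrt T + T powr (- 1 / 2))"
    by (rule edge_profile_estimate[OF W u mild _ M H(1) _ a1 v vd contA AM H(2)])
       (use limit apos \<alpha> A0 in \<open>auto simp: limit_profile_def\<close>)
  have est: "cmod (D T \<eta>) \<le> K * (T powr (- a) + \<bar>\<eta>\<bar> / sqrt T + T powr (- 1 / 2))" if "T \<ge> 2" for T \<eta>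
    using K(2)[of T \<eta>] that unfolding D Lim_prof \<zeta>0 M0 A0 by simp
  have sq: "1 / sqrt T = T powr (- 1 / 2)" if "T \<ge> 2" for T
    using powr_minus_divide[of T "1 / 2"] powr_half_sqrt[of T] that by simp
  have part1: "\<exists>K. \<forall>T\<ge>2. \<forall>\<eta>. \<bar>\<eta>\<bar> \<le> R * T powr \<kappa> \<longrightarrow> cmod (D T \<eta>) \<le> K * (T powr (- a) + T powr (- 1 / 2 + \<kappa>))"
    if R: "R > 0" and \<kappa>: "\<kappa> \<ge> 0" for R \<kappa>
  proof (intro exI[of _ "K * (R + 1)"] allI impI)
    fix T \<eta> :: real assume T: "2 \<le> T" and \<eta>: "\<bar>\<eta>\<bar> \<le> R * T powr \<kappa>"
    let ?p = "T powr (- 1 / 2 + \<kappa>)"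
    have "\<bar>\<eta>\<bar> / sqrt T = \<bar>\<eta>\<bar> * T powr (- 1 / 2)" unfolding sq[OF T, symmetric] by simp
    also have "\<dots> \<le> R * T powr \<kappa> * T powr (- 1 / 2)" using \<eta> by (intro mult_right_mono) auto
    also have "\<dots> = R * ?p"
    proof -
      have "T powr \<kappa> * T powr (- 1 / 2) = ?p" unfolding powr_add[symmetric] by (simp add: add.commute)
      then show ?thesis by (simp only: mult.assoc)
    qed
    finally have 1: "\<bar>\<eta>\<bar> / sqrt T \<le> R * ?p" .
    have 2: "T powr (- 1 / 2) \<le> ?p" using T \<kappa> by (intro powr_mono) auto
    have "0 \<le> R * T powr (- a)" using R by simp
    with 1 2 have "T powr (- a) + \<bar>\<eta>\<bar> / sqrt T + T powr (- 1 / 2) \<le> (R + 1) * (T powr (- a) + ?p)"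
      by (simp add: distrib_left distrib_right)
    from order_trans[OF est[OF T] mult_left_mono[OF this K(1)]]
    show "cmod (D T \<eta>) \<le> K * (R + 1) * (T powr (- a) + ?p)" by (simp only: mult.assoc)
  qed
  have part2: "\<exists>K. \<forall>T\<ge>2. \<forall>\<eta>\<in>{b..c}. cmod (D T \<eta>) \<le> K * T powr (- a)" for b c
  proof (intro exI[of _ "K * (\<bar>b\<bar> + \<bar>c\<bar> + 2)"] allI impI ballI)
    fix T \<eta> :: real assume T: "2 \<le> T" and "\<eta> \<in> {b..c}"
    then have \<eta>: "\<bar>\<eta>\<bar> \<le> \<bar>b\<bar> + \<bar>c\<bar>" by auto
    have p: "T powr (- 1 / 2) \<le> T powr (- a)" using T a1 by (intro powr_mono) auto
    have "\<bar>\<eta>\<bar> / sqrt T = \<bar>\<eta>\<bar> * T powr (- 1 / 2)" unfolding sq[OF T, symmetric] by simp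
    also have "\<dots> \<le> (\<bar>b\<bar> + \<bar>c\<bar>) * T powr (- a)" using \<eta> p by (intro mult_mono) auto
    finally have "T powr (- a) + \<bar>\<eta>\<bar> / sqrt T + T powr (- 1 / 2) \<le> (\<bar>b\<bar> + \<bar>c\<bar> + 2) * T powr (- a)"
      using p by (simp only: distrib_right)
    from order_trans[OF est[OF T] mult_left_mono[OF this K(1)]]
    show "cmod (D T \<eta>) \<le> K * (\<bar>b\<bar> + \<bar>c\<bar> + 2) * T powr (- a)" by (simp only: mult.assoc)
  qed
  obtain \<eta>0 where \<eta>0: "\<And>\<eta>. \<eta>0 \<le> \<bar>\<eta>\<bar> \<Longrightarrow>
      1 / (2 * \<eta>\<^sup>2) \<le> cmod (edge_integral \<alpha> \<eta>) \<and> cmod (edge_integral \<alpha> \<eta>) \<le> 3 / (2 * \<eta>\<^sup>2)"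
    using edge_integral_two_sided by blast
  have part4: "\<exists>k1>0. \<exists>k2>0. \<forall>T\<ge>2. \<forall>\<eta>.
      \<eta>0 \<le> \<bar>\<eta>\<bar> \<and> c1 * T powr \<kappa> \<le> \<bar>\<eta>\<bar> \<and> \<bar>\<eta>\<bar> \<le> c2 * T powr \<kappa> \<longrightarrow>
        k1 * (\<bar>M0\<bar> * (cmod A0) ^ 5) * T powr (- 2 * \<kappa>) \<le> cmod (Lim_prof \<eta>) \<and>
        cmod (Lim_prof \<eta>) \<le> k2 * (\<bar>M0\<bar> * (cmod A0) ^ 5) * T powr (- 2 * \<kappa>)"
    if c: "0 < c1" "c1 \<le> c2" for \<kappa> c1 c2
  proof (rule exI[of _ "1 / (2 * c2\<^sup>2)"], rule conjI, goal_cases)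
    case 2
    show ?case
    proof (rule exI[of _ "3 / (2 * c1\<^sup>2)"], intro conjI allI impI)
      show "0 < 3 / (2 * c1\<^sup>2)" using c by auto
      fix T \<eta> :: real assume T: "2 \<le> T"
        and h: "\<eta>0 \<le> \<bar>\<eta>\<bar> \<and> c1 * T powr \<kappa> \<le> \<bar>\<eta>\<bar> \<and> \<bar>\<eta>\<bar> \<le> c2 * T powr \<kappa>"
      define G where "G = \<bar>M0\<bar> * (cmod A0) ^ 5"
      define q where "q = (T powr \<kappa>)\<^sup>2"
      have G: "G \<ge> 0" unfolding G_def by simp
      have q: "q > 0" unfolding q_def using T by simp
      have "T powr (- 2 * \<kappa>) = 1 / T powr (\<kappa> + \<kappa>)" using powr_minus_divide[of T "2 * \<kappa>"] by simp
      then have Tq: "T powr (- 2 * \<kappa>) = 1 / q" unfolding q_def powr_add power2_eq_square .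
      have L: "cmod (Lim_prof \<eta>) = G * cmod (edge_integral \<alpha> \<eta>)"
        unfolding Lim_prof G_def by (simp add: norm_mult norm_power numeral_eq_Suc)
      have lo: "c1\<^sup>2 * q \<le> \<eta>\<^sup>2"
        using power_mono[of "c1 * T powr \<kappa>" "\<bar>\<eta>\<bar>" 2] h c unfolding q_def by (simp add: power_mult_distrib)
      have hi: "\<eta>\<^sup>2 \<le> c2\<^sup>2 * q"
        using power_mono[of "\<bar>\<eta>\<bar>" "c2 * T powr \<kappa>" 2] h unfolding q_def by (simp add: power_mult_distrib)
      have pos: "0 < c1\<^sup>2 * q" using c q by simp
      have "1 / (2 * c2\<^sup>2) * (1 / q) = 1 / (2 * (c2\<^sup>2 * q))" by simp
      also have "\<dots> \<le> 1 / (2 * \<eta>\<^sup>2)" by (rule frac_le) (use lo hi pos in linarith)+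
      also have "\<dots> \<le> cmod (edge_integral \<alpha> \<eta>)" using \<eta>0 h by blast
      finally have 1: "1 / (2 * c2\<^sup>2) * (1 / q) \<le> cmod (edge_integral \<alpha> \<eta>)" .
      have "cmod (edge_integral \<alpha> \<eta>) \<le> 3 / (2 * \<eta>\<^sup>2)" using \<eta>0 h by blast
      also have "\<dots> \<le> 3 / (2 * (c1\<^sup>2 * q))" by (rule frac_le) (use lo pos in linarith)+
      also have "\<dots> = 3 / (2 * c1\<^sup>2) * (1 / q)" by simp
      finally have 2: "cmod (edge_integral \<alpha> \<eta>) \<le> 3 / (2 * c1\<^sup>2) * (1 / q)" .
      show "1 / (2 * c2\<^sup>2) * (\<bar>M0\<bar> * (cmod A0) ^ 5) * T powr (- 2 * \<kappa>) \<le> cmod (Lim_prof \<eta>)"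
        using mult_left_mono[OF 1 G] unfolding Tq L G_def[symmetric] by (simp only: mult_ac)
      show "cmod (Lim_prof \<eta>) \<le> 3 / (2 * c1\<^sup>2) * (\<bar>M0\<bar> * (cmod A0) ^ 5) * T powr (- 2 * \<kappa>)"
        using mult_left_mono[OF 2 G] unfolding Tq L G_def[symmetric] by (simp only: mult_ac)
    qed
  qed (use c in auto)
  have part5: "((\<lambda>T. T powr (- a) + T powr (- 1 / 2 + \<kappa>)) \<in> o[at_top](\<lambda>T. T powr (- 2 * \<kappa>))
          \<longleftrightarrow> 2 * \<kappa> < min a (1 / 2 - \<kappa>))" for \<kappa>
    unfolding powr_sum_smallo_iff by auto
  have part6: "2 * \<kappa> < min a (1 / 2 - \<kappa>) \<longleftrightarrow> \<kappa> < 1 / 8 - \<delta>" for \<kappa>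
    unfolding a using \<delta>0 by auto
  show ?thesis
  proof (intro conjI, goal_cases)
    case 1 show ?case by (rule apos)
    case 2 show ?case by (intro allI impI, elim conjE, rule part1)
    case 3 show ?case by (intro allI part2)
    case 4 show ?case by (rule edge_integral_bigo)
    case 5 show ?case by (rule exI[of _ \<eta>0], intro allI impI, elim conjE, rule part4)
    case 6 show ?case by (intro allI impI conjI part5 part6)
  qed
qed

end
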